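(* Let $(\Omega,\mathcal{H},\hat{\mathbb{E}})$ be a sublinear expectation space with $\hat{\mathbb{E}}$ regular, and let $\{X_i\}_{i\in\mathbb{N}}$ be an i.i.d. sequence on it satisfying $$\lim_{\lambda\to\infty}\hat{\mathbb{E}}[(|X_1|-\lambda)^+]=0 .$$ Let $\mathcal{P}_*\circ\boldsymbol{X}^{-1}$ and $\mathcal{P}$ be the sets of probability measures on $(\mathbb{R}^{\mathbb{N}},\mathcal{B}(\mathbb{R}^{\mathbb{N}}))$ defined in the context, and let $$\mathcal{Q}_{\max}=\{\mu:\ E_\mu[\varphi]\le\hat{\mathbb{E}}[\varphi(X_1,\dots,X_n)],\ \forall n\in\mathbb{N},\ \forall\varphi\in C_{Lip}(\mathbb{R}^n)\},$$ where $\mu$ ranges over probability measures on $(\mathbb{R}^{\mathbb{N}},\mathcal{B}(\mathbb{R}^{\mathbb{N}}))$ and $\varphi\in C_{Lip}(\mathbb{R}^n)$ is regarded as a function of the first $n$ coordinates. Then $$\mathcal{P}_*\circ\boldsymbol{X}^{-1}=\mathcal{P}=\mathcal{Q}_{\max}.$$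
   Context: $C_{Lip}(\mathbb{R}^n)$ (resp. $C_{b.Lip}(\mathbb{R}^n)$) is the space of Lipschitz (resp. bounded Lipschitz) functions on $\mathbb{R}^n$. Sublinear expectation space $(\Omega,\mathcal{H},\hat{\mathbb{E}})$: $\Omega$ is a set; $\mathcal{H}$ is a linear space of real functions on $\Omega$ such that $X_1,\dots,X_n\in\mathcal{H}$ implies $\varphi(X_1,\dots,X_n)\in\mathcal{H}$ for all $\varphi\in C_{Lip}(\mathbb{R}^n)$; $\hat{\mathbb{E}}:\mathcal{H}\to\mathbb{R}$ satisfies monotonicity ($X\ge Y\Rightarrow\hat{\mathbb{E}}[X]\ge\hat{\mathbb{E}}[Y]$), $\hat{\mathbb{E}}[c]=c$ for constants $c$, sub-additivity, and positive homogeneity. $\hat{\mathbb{E}}$ is regular if $\hat{\mathbb{E}}[Z_i]\downarrow0$ for each sequence $\{Z_i\}\subset\mathcal{H}$ with $Z_i\downarrow0$ (pointwise). I.i.d.: $X_i\in\mathcal{H}$; $X,Y$ are identically distributed if $\hat{\mathbb{E}}[\varphi(X)]=\hat{\mathbb{E}}[\varphi(Y)]$ for all $\varphi\in C_{b.Lip}(\mathbb{R})$; $X_n$ is independent of $(X_1,\dots,X_{n-1})$ if for all $\varphi\in C_{b.Lip}(\mathbb{R}^n)$ $$\hat{\mathbb{E}}[\varphi(X_1,\dots,X_n)]=\hat{\mathbb{E}}\Big[\hat{\mathbb{E}}[\varphi(x_1,\dots,x_{n-1},X_n)]\big|_{(x_1,\dots,x_{n-1})=(X_1,\dots,X_{n-1})}\Big];$$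 the sequence is independent if $X_{n+1}$ is independent of $(X_1,\dots,X_n)$ for each $n\ge1$, and i.i.d. if moreover all $X_i$ are identically distributed with $X_1$. $\mathcal{P}_*$: the set of all probability measures $P$ on $(\Omega,\sigma(\mathcal{H}))$, $\sigma(\mathcal{H})$ being the $\sigma$-algebra generated by $\mathcal{H}$, with $E_P[X]\le\hat{\mathbb{E}}[X]$ for all $X\in\mathcal{H}$. With $\boldsymbol{X}=(X_1,X_2,\dots):\Omega\to\mathbb{R}^{\mathbb{N}}$, $\mathcal{P}_*\circ\boldsymbol{X}^{-1}=\{P\circ\boldsymbol{X}^{-1}:P\in\mathcal{P}_*\}$. $\mathcal{P}$: let $\mathcal{P}_1=\{\mu\text{ probability on }(\mathbb{R},\mathcal{B}(\mathbb{R})):E_\mu[\varphi]\le\hat{\mathbb{E}}[\varphi(X_1)]\ \forall\varphi\in C_{Lip}(\mathbb{R})\}$. Then $\mathcal{P}$ is the set of all probability measures $P$ on $(\mathbb{R}^{\mathbb{N}},\mathcal{B}(\mathbb{R}^{\mathbb{N}}))$ for which there are $\mu_1\in\mathcal{P}_1$ and probability kernels $\kappa_i$, $i\ge2$ ($\kappa_i(x_1,\dots,x_{i-1},\cdot)$ a probability measure on $\mathbb{R}$ for every $(x_1,\dots,x_{i-1})$, $\kappa_i(\cdot,B)$ $\mathcal{B}(\mathbb{R}^{i-1})$-measurable for every $B\in\mathcal{B}(\mathbb{R})$) with $\kappa_i(x_1,\dots,x_{i-1},\cdot)\in\mathcal{P}_1$, such that for all $n\ge1$ and $A\in\mathcal{B}(\mathbb{R}^n)$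 $$P(A\times\mathbb{R}^{\mathbb{N}-n})=\int_{\mathbb{R}}\mu_1(dx_1)\int_{\mathbb{R}}\kappa_2(x_1,dx_2)\cdots\int_{\mathbb{R}}I_A(x_1,\dots,x_n)\,\kappa_n(x_1,\dots,x_{n-1},dx_n).$$ *)

theory Defs
  imports "HOL-Probability.Probability"
begin

text \<open>
  Since the dimension \<open>n\<close> is quantified inside statements, a function on \<open>\<real>\<^sup>n\<close> is represented by a
  function on sequences that depends on the coordinates \<open>0, \<dots>, n - 1\<close> only. The Lipschitz bound
  in terms of the Euclidean norm of the first \<open>n\<close> coordinates of \<open>x - y\<close> forces this dependence,
  so no separate condition is needed. All indices are shifted by one: \<open>X 0\<close> is the first variable.
\<close>

definition C_Lip :: "nat \<Rightarrow> ((nat \<Rightarrow> real) \<Rightarrow> real) set" where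
  "C_Lip n = {\<phi>. \<exists>L\<ge>0. \<forall>x y. \<bar>\<phi> x - \<phi> y\<bar> \<le> L * L2_set (\<lambda>i. x i - y i) {0..<n}}"

definition C_bLip :: "nat \<Rightarrow> ((nat \<Rightarrow> real) \<Rightarrow> real) set" where
  "C_bLip n = {\<phi> \<in> C_Lip n. bounded (range \<phi>)}"

definition C_Lip_real :: "(real \<Rightarrow> real) set" where
  "C_Lip_real = {\<phi>. \<exists>L. L-lipschitz_on UNIV \<phi>}"

definition C_bLip_real :: "(real \<Rightarrow> real) set" where
  "C_bLip_real = {\<phi> \<in> C_Lip_real. bounded (range \<phi>)}"

text \<open>
  The underlying set \<open>\<Omega>\<close> is the type \<^typ>\<open>'a\<close>; the expectation \<open>E\<close> is constrained on \<open>H\<close> only.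
\<close>

locale sublinear_expectation_space =
  fixes H :: "('a \<Rightarrow> real) set" and E :: "('a \<Rightarrow> real) \<Rightarrow> real"
  assumes zero_mem: "(\<lambda>_. 0) \<in> H"
    and add_mem: "\<lbrakk>X \<in> H; Y \<in> H\<rbrakk> \<Longrightarrow> (\<lambda>\<omega>. X \<omega> + Y \<omega>) \<in> H"
    and scale_mem: "X \<in> H \<Longrightarrow> (\<lambda>\<omega>. c * X \<omega>) \<in> H"
    and Lip_mem: "\<lbrakk>n \<ge> 1; \<And>i. i < n \<Longrightarrow> Z i \<in> H; \<phi> \<in> C_Lip n\<rbrakk> \<Longrightarrow> (\<lambda>\<omega>. \<phi> (\<lambda>i. Z i \<omega>)) \<in> H"
    and mono: "\<lbrakk>X \<in> H; Y \<in> H; \<And>\<omega>. Y \<omega> \<le> X \<omega>\<rbrakk> \<Longrightarrow> E Y \<le> E X"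
    and const: "E (\<lambda>_. c) = c"
    and subadd: "\<lbrakk>X \<in> H; Y \<in> H\<rbrakk> \<Longrightarrow> E (\<lambda>\<omega>. X \<omega> + Y \<omega>) \<le> E X + E Y"
    and pos_homog: "\<lbrakk>X \<in> H; c \<ge> 0\<rbrakk> \<Longrightarrow> E (\<lambda>\<omega>. c * X \<omega>) = c * E X"

definition regular_expectation :: "('a \<Rightarrow> real) set \<Rightarrow> (('a \<Rightarrow> real) \<Rightarrow> real) \<Rightarrow> bool" where
  "regular_expectation H E \<longleftrightarrow>
     (\<forall>Z :: nat \<Rightarrow> 'a \<Rightarrow> real.
        (\<forall>i. Z i \<in> H) \<and> (\<forall>\<omega>. decseq (\<lambda>i. Z i \<omega>) \<and> (\<lambda>i. Z i \<omega>) \<longlonglongrightarrow> 0) \<longrightarrow>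
        decseq (\<lambda>i. E (Z i)) \<and> (\<lambda>i. E (Z i)) \<longlonglongrightarrow> 0)"

definition identically_distributed ::
    "(('a \<Rightarrow> real) \<Rightarrow> real) \<Rightarrow> ('a \<Rightarrow> real) \<Rightarrow> ('a \<Rightarrow> real) \<Rightarrow> bool" where
  "identically_distributed E X Y \<longleftrightarrow>
     (\<forall>\<phi>\<in>C_bLip_real. E (\<lambda>\<omega>. \<phi> (X \<omega>)) = E (\<lambda>\<omega>. \<phi> (Y \<omega>)))"

text \<open>
  \<open>X n\<close> is independent of \<open>(X 0, \<dots>, X (n - 1))\<close>. The values at \<open>\<omega>\<close> of these variables are frozen
  in the inner expectation; coordinates beyond \<open>n\<close> are irrelevant for \<open>\<phi> \<in> C_bLip (Suc n)\<close>.
\<close>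

definition independent_of_previous ::
    "(('a \<Rightarrow> real) \<Rightarrow> real) \<Rightarrow> (nat \<Rightarrow> 'a \<Rightarrow> real) \<Rightarrow> nat \<Rightarrow> bool" where
  "independent_of_previous E X n \<longleftrightarrow>
     (\<forall>\<phi>\<in>C_bLip (Suc n).
        E (\<lambda>\<omega>. \<phi> (\<lambda>i. X i \<omega>)) = E (\<lambda>\<omega>. E (\<lambda>\<omega>'. \<phi> ((\<lambda>i. X i \<omega>)(n := X n \<omega>')))))"

definition iid_sequence ::
    "('a \<Rightarrow> real) set \<Rightarrow> (('a \<Rightarrow> real) \<Rightarrow> real) \<Rightarrow> (nat \<Rightarrow> 'a \<Rightarrow> real) \<Rightarrow> bool" where
  "iid_sequence H E X \<longleftrightarrow>
     (\<forall>i. X i \<in> H) \<and>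
     (\<forall>n\<ge>1. independent_of_previous E X n) \<and>
     (\<forall>i. identically_distributed E (X i) (X 0))"

definition sigma_H :: "('a \<Rightarrow> real) set \<Rightarrow> 'a measure" where
  "sigma_H H = sigma UNIV {X -` B | X B. X \<in> H \<and> B \<in> sets (borel :: real measure)}"

text \<open>
  In the following sets of measures, integrability is required explicitly because the Bochner
  integral of a non-integrable function is 0 by convention. As the classes of test functions are
  closed under absolute values, the domination \<open>E\<^sub>P[\<bar>X\<bar>] \<le> E[\<bar>X\<bar>] < \<infinity>\<close> entails it on paper.
\<close>

definition P_star ::
    "('a \<Rightarrow> real) set \<Rightarrow> (('a \<Rightarrow> real) \<Rightarrow> real) \<Rightarrow> 'a measure set" where
  "P_star H E =
     {P. prob_space P \<and> sets P = sets (sigma_H H) \<and>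
         (\<forall>X\<in>H. integrable P X \<and> integral\<^sup>L P X \<le> E X)}"

abbreviation R_pow :: "nat \<Rightarrow> (nat \<Rightarrow> real) measure" where
  "R_pow n \<equiv> PiM {0..<n} (\<lambda>_. borel)"

abbreviation R_seq :: "(nat \<Rightarrow> real) measure" where
  "R_seq \<equiv> PiM UNIV (\<lambda>_. borel)"

lemma sets_R_seq: "sets R_seq = sets (borel :: (nat \<Rightarrow> real) measure)"
  by (rule sets_PiM_equal_borel)

definition P_star_law ::
    "('a \<Rightarrow> real) set \<Rightarrow> (('a \<Rightarrow> real) \<Rightarrow> real) \<Rightarrow> (nat \<Rightarrow> 'a \<Rightarrow> real) \<Rightarrow> (nat \<Rightarrow> real) measure set" where
  "P_star_law H E X = (\<lambda>P. distr P R_seq (\<lambda>\<omega> i. X i \<omega>)) ` P_star H E"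

definition P_one :: "(('a \<Rightarrow> real) \<Rightarrow> real) \<Rightarrow> ('a \<Rightarrow> real) \<Rightarrow> real measure set" where
  "P_one E Y =
     {\<mu>. prob_space \<mu> \<and> sets \<mu> = sets borel \<and>
         (\<forall>\<phi>\<in>C_Lip_real. integrable \<mu> \<phi> \<and> integral\<^sup>L \<mu> \<phi> \<le> E (\<lambda>\<omega>. \<phi> (Y \<omega>)))}"

text \<open>
  \<open>iterated_integral \<kappa> f m i x\<close> integrates out the \<open>m\<close> coordinates \<open>i, \<dots>, i + m - 1\<close> of \<open>f\<close>,
  given the coordinates \<open>x\<close> below \<open>i\<close>:
  \<open>\<integral> \<kappa> i (x, dy\<^sub>i) \<integral> \<kappa> (i + 1) (x, y\<^sub>i, dy\<^sub>i\<^sub>+\<^sub>1) \<dots> f (x, y\<^sub>i, y\<^sub>i\<^sub>+\<^sub>1, \<dots>)\<close>.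
\<close>

primrec iterated_integral ::
    "(nat \<Rightarrow> (nat \<Rightarrow> real) \<Rightarrow> real measure) \<Rightarrow> ((nat \<Rightarrow> real) \<Rightarrow> ennreal) \<Rightarrow>
     nat \<Rightarrow> nat \<Rightarrow> (nat \<Rightarrow> real) \<Rightarrow> ennreal" where
  "iterated_integral \<kappa> f 0 i x = f x"
| "iterated_integral \<kappa> f (Suc m) i x =
     (\<integral>\<^sup>+ y. iterated_integral \<kappa> f m (Suc i) (x(i := y)) \<partial>\<kappa> i x)"

text \<open>
  The initial law is the kernel \<open>\<kappa> 0\<close> from the one-point space \<open>\<real>\<^sup>0 = {\<lambda>_. undefined}\<close>, that is,
  \<open>\<mu>\<^sub>1 = \<kappa> 0 (\<lambda>_. undefined)\<close>, and \<open>\<kappa> i\<close> is the conditional law of coordinate \<open>i\<close> given the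
  coordinates \<open>0, \<dots>, i - 1\<close>. The set \<^term>\<open>prod_emb UNIV (\<lambda>_. borel) {0..<n} A\<close> is the
  cylinder \<open>A \<times> \<real> \<times> \<real> \<times> \<dots>\<close>.
\<close>

definition P_kernel ::
    "(('a \<Rightarrow> real) \<Rightarrow> real) \<Rightarrow> ('a \<Rightarrow> real) \<Rightarrow> (nat \<Rightarrow> real) measure set" where
  "P_kernel E Y =
     {P. prob_space P \<and> sets P = sets R_seq \<and>
         (\<exists>\<kappa>. (\<forall>i. \<forall>x\<in>space (R_pow i). \<kappa> i x \<in> P_one E Y) \<and>
              (\<forall>i. \<forall>B\<in>sets borel. (\<lambda>x. measure (\<kappa> i x) B) \<in> borel_measurable (R_pow i)) \<and>
              (\<forall>n\<ge>1. \<forall>A\<in>sets (R_pow n).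
                 emeasure P (prod_emb UNIV (\<lambda>_. borel) {0..<n} A) =
                 iterated_integral \<kappa> (indicator A) n 0 (\<lambda>_. undefined)))}"

definition Q_max ::
    "(('a \<Rightarrow> real) \<Rightarrow> real) \<Rightarrow> (nat \<Rightarrow> 'a \<Rightarrow> real) \<Rightarrow> (nat \<Rightarrow> real) measure set" where
  "Q_max E X =
     {\<mu>. prob_space \<mu> \<and> sets \<mu> = sets R_seq \<and>
         (\<forall>n\<ge>1. \<forall>\<phi>\<in>C_Lip n. integrable \<mu> \<phi> \<and> integral\<^sup>L \<mu> \<phi> \<le> E (\<lambda>\<omega>. \<phi> (\<lambda>i. X i \<omega>)))}"

end

theory Submission
  imports Defs
begin

text \<open>
  Both \<^term>\<open>P_star_law H E X\<close> and \<^term>\<open>P_kernel E (X 0)\<close> are compared with \<^term>\<open>Q_max E X\<close>, the set of all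
  laws on the sequence space that are dominated by \<^term>\<open>E\<close> on Lipschitz functions of finitely many
  coordinates.

  A law of \<open>X\<close> under a measure dominated by \<^term>\<open>E\<close> is in \<^term>\<open>Q_max E X\<close> because \<open>\<phi> (X 0, \<dots>, X n)\<close> is an
  element of \<open>H\<close>. Conversely, \<open>\<mu>\<close> in \<^term>\<open>Q_max E X\<close> prescribes the linear functional that maps \<open>\<phi> (X)\<close>
  to \<open>\<integral> \<phi> d\<mu>\<close>. It is dominated by \<^term>\<open>E\<close> and extends to all of \<open>H\<close> (\<open>hahn_banach\<close>). As \<^term>\<open>E\<close> is
  regular, the extension is continuous along sequences that decrease to 0, so it is the integral
  for a probability measure on \<open>\<sigma>(H)\<close> (\<open>daniell_stone\<close>), under which \<open>X\<close> has the law \<open>\<mu>\<close>.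

  For the kernels, independence and identical distribution say that the last variable of a
  function \<open>\<phi> (X 0, \<dots>, X n)\<close> can be integrated out, with the earlier ones frozen
  (\<open>E_integrate_out\<close>). A kernel with values in \<^term>\<open>P_one E (X 0)\<close> does not exceed this operation at any
  frozen point, hence iterated integrals do not exceed \<^term>\<open>E\<close> (\<open>iterated_integral_le\<close>). Conversely,
  \<open>\<mu>\<close> in \<^term>\<open>Q_max E X\<close> has conditional laws of each coordinate given the previous ones
  (\<open>disintegration_real\<close>). The functions \<open>\<psi> (x 0, \<dots>, x (n - 1)) \<cdot> (f (x n) - E (f (X 0)))\<close> with
  \<open>\<psi> \<ge> 0\<close> have sublinear expectation 0. So their \<open>\<mu>\<close>-integrals are at most 0, which says that the
  conditional expectation of \<open>f (x n)\<close> is almost surely at most \<open>E (f (X 0))\<close>. A countable family of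
  functions \<open>f\<close> suffices to characterise \<^term>\<open>P_one E (X 0)\<close> (\<open>P_oneI\<close>), so almost every conditional
  law is in this set, and the kernels can be changed on null sets (\<open>conditional_kernel\<close>).

  Independence and identical distribution concern bounded functions. The passage to all Lipschitz
  functions is by truncation, again with the help of regularity (\<open>dominated_by_truncations\<close>).
\<close>

section \<open>Vector lattices of functions\<close>

text \<open>
  Vector lattices of real functions that contain the constants occur in four places below: the
  domain of the expectation, the two kinds of Lipschitz functions, and the Lipschitz cylinder
  functions. They all inherit their closure properties from here.
\<close>

locale function_lattice =
  fixes H :: "('a \<Rightarrow> real) set"
  assumes const_mem: "(\<lambda>_. c) \<in> H"
    and add_mem: "\<lbrakk>X \<in> H; Y \<in> H\<rbrakk> \<Longrightarrow> (\<lambda>\<omega>. X \<omega> + Y \<omega>) \<in> H"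
    and scale_mem: "X \<in> H \<Longrightarrow> (\<lambda>\<omega>. c * X \<omega>) \<in> H"
    and abs_mem: "X \<in> H \<Longrightarrow> (\<lambda>\<omega>. \<bar>X \<omega>\<bar>) \<in> H"
begin

lemma diff_mem: "\<lbrakk>X \<in> H; Y \<in> H\<rbrakk> \<Longrightarrow> (\<lambda>\<omega>. X \<omega> - Y \<omega>) \<in> H"
  using add_mem[OF _ scale_mem[of Y "-1"], of X] by simp

lemma max_mem: "\<lbrakk>X \<in> H; Y \<in> H\<rbrakk> \<Longrightarrow> (\<lambda>\<omega>. max (X \<omega>) (Y \<omega>)) \<in> H"
proof -
  assume "X \<in> H" "Y \<in> H"
  then have "(\<lambda>\<omega>. (1/2) * (X \<omega> + Y \<omega> + \<bar>X \<omega> - Y \<omega>\<bar>)) \<in> H"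
    by (intro scale_mem add_mem abs_mem diff_mem)
  moreover have "(\<lambda>\<omega>. (1/2) * (X \<omega> + Y \<omega> + \<bar>X \<omega> - Y \<omega>\<bar>)) = (\<lambda>\<omega>. max (X \<omega>) (Y \<omega>))"
    by (auto simp: fun_eq_iff max_def)
  ultimately show ?thesis by simp
qed

lemma min_mem: "\<lbrakk>X \<in> H; Y \<in> H\<rbrakk> \<Longrightarrow> (\<lambda>\<omega>. min (X \<omega>) (Y \<omega>)) \<in> H"
proof -
  assume "X \<in> H" "Y \<in> H"
  then have "(\<lambda>\<omega>. X \<omega> + Y \<omega> - max (X \<omega>) (Y \<omega>)) \<in> H"
    by (intro diff_mem add_mem max_mem)
  moreover have "(\<lambda>\<omega>. X \<omega> + Y \<omega> - max (X \<omega>) (Y \<omega>)) = (\<lambda>\<omega>. min (X \<omega>) (Y \<omega>))"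
    by (auto simp: fun_eq_iff)
  ultimately show ?thesis by simp
qed

lemma sum_mem: "(\<And>i. i \<in> S \<Longrightarrow> X i \<in> H) \<Longrightarrow> (\<lambda>\<omega>. \<Sum>i\<in>S. X i \<omega>) \<in> H"
  by (induction S rule: infinite_finite_induct) (auto intro: const_mem add_mem)

lemmas mem = const_mem add_mem scale_mem abs_mem diff_mem max_mem min_mem sum_mem

end

section \<open>Lipschitz functions of finitely many coordinates\<close>

lemma C_LipI:
  assumes "0 \<le> L" "\<And>x y. \<phi> x - \<phi> y \<le> L * L2_set (\<lambda>i. x i - y i) {0..<n}"
  shows "\<phi> \<in> C_Lip n"
proof -
  have "\<bar>\<phi> x - \<phi> y\<bar> \<le> L * L2_set (\<lambda>i. x i - y i) {0..<n}" for x y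
    using assms(2)[of x y] assms(2)[of y x] by (simp add: L2_set_def power2_commute abs_le_iff)
  with assms(1) show ?thesis unfolding C_Lip_def by blast
qed

lemma C_LipE:
  assumes "\<phi> \<in> C_Lip n"
  obtains L where "0 \<le> L" "\<And>x y. \<bar>\<phi> x - \<phi> y\<bar> \<le> L * L2_set (\<lambda>i. x i - y i) {0..<n}"
  using assms unfolding C_Lip_def by blast

lemma C_Lip_cong:
  assumes \<phi>: "\<phi> \<in> C_Lip n" and eq: "\<And>i. i < n \<Longrightarrow> x i = y i"
  shows "\<phi> x = \<phi> y"
proof -
  obtain L where "\<bar>\<phi> x - \<phi> y\<bar> \<le> L * L2_set (\<lambda>i. x i - y i) {0..<n}" by (rule C_LipE[OF \<phi>]) blast
  moreover have "L2_set (\<lambda>i. x i - y i) {0..<n} = 0" using eq by (simp add: L2_set_eq_0_iff)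
  ultimately show ?thesis by simp
qed

lemma C_Lip_mono:
  assumes \<phi>: "\<phi> \<in> C_Lip n" and "n \<le> m" shows "\<phi> \<in> C_Lip m"
proof -
  obtain L where L: "0 \<le> L" "\<And>x y. \<bar>\<phi> x - \<phi> y\<bar> \<le> L * L2_set (\<lambda>i. x i - y i) {0..<n}"
    by (rule C_LipE[OF \<phi>]) blast
  have "\<bar>\<phi> x - \<phi> y\<bar> \<le> L * L2_set (\<lambda>i. x i - y i) {0..<m}" for x y
  proof -
    have "L2_set (\<lambda>i. x i - y i) {0..<n} \<le> L2_set (\<lambda>i. x i - y i) {0..<m}"
      unfolding L2_set_def using \<open>n \<le> m\<close> by (intro real_sqrt_le_mono sum_mono2) auto
    then show ?thesis using L(2)[of x y] mult_left_mono[OF _ L(1)] by (meson order_trans)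
  qed
  with L(1) show ?thesis unfolding C_Lip_def by blast
qed

lemma C_Lip_const: "(\<lambda>_. c) \<in> C_Lip n"
  by (rule C_LipI[of 0]) auto

lemma C_Lip_coord: "i < n \<Longrightarrow> (\<lambda>x. x i) \<in> C_Lip n"
proof (rule C_LipI[of 1])
  fix x y :: "nat \<Rightarrow> real" assume "i < n"
  then have "\<bar>x i - y i\<bar> \<le> L2_set (\<lambda>i. \<bar>x i - y i\<bar>) {0..<n}" by (intro member_le_L2_set) auto
  then show "x i - y i \<le> 1 * L2_set (\<lambda>i. x i - y i) {0..<n}" by (simp add: L2_set_def)
qed simp

lemma C_Lip_add:
  assumes "\<phi> \<in> C_Lip n" "\<psi> \<in> C_Lip n" shows "(\<lambda>x. \<phi> x + \<psi> x) \<in> C_Lip n"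
proof -
  obtain L where L: "0 \<le> L" "\<And>x y. \<bar>\<phi> x - \<phi> y\<bar> \<le> L * L2_set (\<lambda>i. x i - y i) {0..<n}"
    by (rule C_LipE[OF assms(1)]) blast
  obtain K where K: "0 \<le> K" "\<And>x y. \<bar>\<psi> x - \<psi> y\<bar> \<le> K * L2_set (\<lambda>i. x i - y i) {0..<n}"
    by (rule C_LipE[OF assms(2)]) blast
  show ?thesis
  proof (rule C_LipI[of "L + K"])
    fix x y :: "nat \<Rightarrow> real"
    have "\<phi> x + \<psi> x - (\<phi> y + \<psi> y) \<le> \<bar>\<phi> x - \<phi> y\<bar> + \<bar>\<psi> x - \<psi> y\<bar>" by linarith
    also have "\<dots> \<le> L * L2_set (\<lambda>i. x i - y i) {0..<n} + K * L2_set (\<lambda>i. x i - y i) {0..<n}"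
      by (intro add_mono L K)
    finally show "\<phi> x + \<psi> x - (\<phi> y + \<psi> y) \<le> (L + K) * L2_set (\<lambda>i. x i - y i) {0..<n}"
      by (simp add: distrib_right)
  qed (use L K in simp)
qed

lemma C_Lip_mult:
  assumes "\<phi> \<in> C_Lip n" "\<psi> \<in> C_Lip n" and B: "\<And>x. \<bar>\<phi> x\<bar> \<le> B" "\<And>x. \<bar>\<psi> x\<bar> \<le> B"
  shows "(\<lambda>x. \<phi> x * \<psi> x) \<in> C_Lip n"
proof -
  obtain L where L: "0 \<le> L" "\<And>x y. \<bar>\<phi> x - \<phi> y\<bar> \<le> L * L2_set (\<lambda>i. x i - y i) {0..<n}"
    by (rule C_LipE[OF assms(1)]) blast
  obtain K where K: "0 \<le> K" "\<And>x y. \<bar>\<psi> x - \<psi> y\<bar> \<le> K * L2_set (\<lambda>i. x i - y i) {0..<n}"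
    by (rule C_LipE[OF assms(2)]) blast
  have B0: "0 \<le> B" using B(1) abs_ge_zero order_trans by blast
  show ?thesis
  proof (rule C_LipI[of "B * K + L * B"])
    fix x y :: "nat \<Rightarrow> real"
    let ?D = "L2_set (\<lambda>i. x i - y i) {0..<n}"
    have "\<phi> x * \<psi> x - \<phi> y * \<psi> y = \<phi> x * (\<psi> x - \<psi> y) + (\<phi> x - \<phi> y) * \<psi> y"
      by (simp add: algebra_simps)
    also have "\<dots> \<le> \<bar>\<phi> x\<bar> * \<bar>\<psi> x - \<psi> y\<bar> + \<bar>\<phi> x - \<phi> y\<bar> * \<bar>\<psi> y\<bar>"
      by (metis abs_ge_self abs_mult add_mono)
    also have "\<dots> \<le> B * (K * ?D) + (L * ?D) * B"
      using B L K B0 by (intro add_mono mult_mono) (auto simp: L2_set_nonneg)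
    finally show "\<phi> x * \<psi> x - \<phi> y * \<psi> y \<le> (B * K + L * B) * ?D" by (simp add: algebra_simps)
  qed (use B0 L K in auto)
qed

lemma C_Lip_real_iff: "f \<in> C_Lip_real \<longleftrightarrow> (\<exists>L\<ge>0. \<forall>s t. \<bar>f s - f t\<bar> \<le> L * \<bar>s - t\<bar>)"
  by (auto simp: C_Lip_real_def lipschitz_on_def dist_real_def)

lemma C_Lip_comp:
  assumes f: "f \<in> C_Lip_real" and \<phi>: "\<phi> \<in> C_Lip n" shows "(\<lambda>x. f (\<phi> x)) \<in> C_Lip n"
proof -
  obtain K where K: "0 \<le> K" "\<And>s t. \<bar>f s - f t\<bar> \<le> K * \<bar>s - t\<bar>" using f by (auto simp: C_Lip_real_iff)
  obtain L where L: "0 \<le> L" "\<And>x y. \<bar>\<phi> x - \<phi> y\<bar> \<le> L * L2_set (\<lambda>i. x i - y i) {0..<n}"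
    by (rule C_LipE[OF \<phi>]) blast
  have "\<bar>f (\<phi> x) - f (\<phi> y)\<bar> \<le> K * (L * L2_set (\<lambda>i. x i - y i) {0..<n})" for x y
    using K L by (meson mult_left_mono order_trans)
  with K L show ?thesis unfolding C_Lip_def
    by (intro CollectI exI[of _ "K * L"]) (auto simp: mult.assoc)
qed

lemma C_Lip_real_abs: "abs \<in> C_Lip_real"
  unfolding C_Lip_real_iff by (intro exI[of _ 1]) auto

lemma C_Lip_real_scale: "(\<lambda>t. c * t) \<in> C_Lip_real"
  unfolding C_Lip_real_iff by (intro exI[of _ "\<bar>c\<bar>"]) (simp only: right_diff_distrib[symmetric] abs_mult, simp)

lemma function_lattice_C_Lip: "function_lattice (C_Lip n)"
  by standard (rule C_Lip_const C_Lip_add C_Lip_comp[OF C_Lip_real_abs] C_Lip_comp[OF C_Lip_real_scale]; assumption)+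

interpretation C_Lip: function_lattice "C_Lip n" for n
  by (rule function_lattice_C_Lip)

lemma function_lattice_C_Lip_real: "function_lattice C_Lip_real"
proof -
  have eq: "f \<in> C_Lip_real \<longleftrightarrow> (\<lambda>x. f (x 0)) \<in> C_Lip 1" for f
  proof
    assume "f \<in> C_Lip_real"
    then show "(\<lambda>x. f (x 0)) \<in> C_Lip 1"
      by (rule C_Lip_comp[of f "\<lambda>x. x 0"]) (rule C_Lip_coord, simp)
  next
    assume "(\<lambda>x. f (x 0)) \<in> C_Lip 1"
    then obtain L where L: "0 \<le> L"
      "\<forall>(x::nat \<Rightarrow> real) y. \<bar>f (x 0) - f (y 0)\<bar> \<le> L * L2_set (\<lambda>i. x i - y i) {0..<1}"
      unfolding C_Lip_def mem_Collect_eq by blast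
    then have "\<bar>f s - f t\<bar> \<le> L * \<bar>s - t\<bar>" for s t
      using L(2)[rule_format, of "\<lambda>_. s" "\<lambda>_. t"] by (simp add: L2_set_def)
    with L(1) show "f \<in> C_Lip_real" unfolding C_Lip_real_iff by blast
  qed
  show ?thesis
    by standard (simp_all only: eq C_Lip.const_mem C_Lip.add_mem C_Lip.scale_mem C_Lip.abs_mem)
qed

interpretation C_Lip_real: function_lattice C_Lip_real
  by (rule function_lattice_C_Lip_real)

text \<open>
  A Lipschitz function of finitely many coordinates is continuous for the product topology, since
  convergence of the first \<open>n\<close> coordinates is all that its modulus of continuity asks for. This is
  the reason why it is Borel measurable on the sequence space.
\<close>

lemma C_Lip_continuous:
  assumes \<phi>: "\<phi> \<in> C_Lip n" shows "continuous_on UNIV \<phi>"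
proof -
  obtain L where L: "0 \<le> L" "\<And>x y. \<bar>\<phi> x - \<phi> y\<bar> \<le> L * L2_set (\<lambda>i. x i - y i) {0..<n}"
    by (rule C_LipE[OF \<phi>]) blast
  have "(\<phi> \<longlongrightarrow> \<phi> x) (at x)" for x
  proof -
    have "((\<lambda>y::nat \<Rightarrow> real. y i) \<longlongrightarrow> x i) (at x)" for i
    proof -
      have "continuous_on UNIV (\<lambda>y::nat \<Rightarrow> real. y i)" by simp
      then show ?thesis by (simp add: continuous_on_def)
    qed
    then have "((\<lambda>y. L * L2_set (\<lambda>i. y i - x i) {0..<n}) \<longlongrightarrow> L * L2_set (\<lambda>i. x i - x i) {0..<n}) (at x)"
      unfolding L2_set_def by (intro tendsto_intros)
    then have "((\<lambda>y. L * L2_set (\<lambda>i. y i - x i) {0..<n}) \<longlongrightarrow> 0) (at x)" by (simp add: L2_set_def)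
    then have "((\<lambda>y. \<phi> y - \<phi> x) \<longlongrightarrow> 0) (at x)"
      by (rule Lim_null_comparison[rotated]) (use L in simp)
    then show ?thesis by (simp add: LIM_zero_iff)
  qed
  then show ?thesis by (simp add: continuous_on_def)
qed

lemma C_Lip_measurable: "\<phi> \<in> C_Lip n \<Longrightarrow> \<phi> \<in> borel_measurable R_seq"
  using borel_measurable_continuous_onI[OF C_Lip_continuous] measurable_cong_sets[OF sets_R_seq refl] by blast

text \<open>
  Elements of the finite product take the value \<open>undefined\<close> outside of their index set; padding
  them with zeros instead embeds the finite product measurably into the sequence space.
\<close>

lemma C_Lip_measurable_R_pow:
  assumes "\<phi> \<in> C_Lip n" shows "\<phi> \<in> borel_measurable (R_pow n)"
proof -
  have "(\<lambda>x i. if i < n then x i else 0) \<in> R_pow n \<rightarrow>\<^sub>M R_seq"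
  proof (rule measurable_PiM_single')
    fix i show "(\<lambda>x. if i < n then x i else 0) \<in> borel_measurable (R_pow n)"
      by (cases "i < n") auto
  qed auto
  from measurable_compose[OF this C_Lip_measurable[OF assms]]
  have "(\<lambda>x. \<phi> (\<lambda>i. if i < n then x i else 0)) \<in> borel_measurable (R_pow n)" .
  also have "(\<lambda>x. \<phi> (\<lambda>i. if i < n then x i else 0)) = \<phi>"
    by (intro ext C_Lip_cong[OF assms]) auto
  finally show ?thesis .
qed

lemma C_Lip_real_measurable: "f \<in> C_Lip_real \<Longrightarrow> f \<in> borel_measurable borel"
  unfolding C_Lip_real_def
  by (blast intro: borel_measurable_continuous_onI lipschitz_on_continuous_on)

section \<open>Truncation\<close>

definition truncate :: "nat \<Rightarrow> real \<Rightarrow> real" where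
  "truncate k t = max (- real k) (min (real k) t)"

lemma truncate_bound: "\<bar>truncate k t\<bar> \<le> real k"
  by (auto simp: truncate_def)

lemma truncate_eq: "\<bar>t\<bar> \<le> real k \<Longrightarrow> truncate k t = t"
  by (auto simp: truncate_def)

lemma abs_truncate_le: "\<bar>truncate k t\<bar> \<le> \<bar>t\<bar>"
  by (auto simp: truncate_def)

lemma truncate_error: "\<bar>truncate k t - t\<bar> = max 0 (\<bar>t\<bar> - real k)"
  by (auto simp: truncate_def)

lemma truncate_tendsto: "(\<lambda>k. truncate k t) \<longlonglongrightarrow> t"
proof (rule tendsto_eventually)
  obtain N :: nat where "\<bar>t\<bar> \<le> real N" using real_arch_simple by blast
  then show "\<forall>\<^sub>F k in sequentially. truncate k t = t"
    unfolding eventually_sequentially by (intro exI[of _ N]) (auto intro!: truncate_eq)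
qed

lemma C_Lip_real_truncate: "truncate k \<in> C_Lip_real"
proof -
  have "(\<lambda>t. t) \<in> C_Lip_real" using C_Lip_real_scale[of 1] by simp
  then have "(\<lambda>t. max (- real k) (min (real k) t)) \<in> C_Lip_real"
    by (rule C_Lip_real.max_mem[OF C_Lip_real.const_mem C_Lip_real.min_mem[OF C_Lip_real.const_mem]])
  then show ?thesis by (simp add: truncate_def[abs_def])
qed

lemma truncate_measurable[measurable]: "truncate k \<in> borel_measurable borel"
  by (rule C_Lip_real_measurable[OF C_Lip_real_truncate])

lemma C_bLip_truncate:
  assumes "\<phi> \<in> C_Lip n" shows "(\<lambda>x. truncate k (\<phi> x)) \<in> C_bLip n"
proof -
  have "bounded (range (\<lambda>x. truncate k (\<phi> x)))"
    by (rule boundedI[where B="real k"]) (auto intro: truncate_bound)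
  then show ?thesis using C_Lip_comp[OF C_Lip_real_truncate assms] unfolding C_bLip_def by blast
qed

section \<open>Sublinear expectations and the Hahn-Banach theorem\<close>

context sublinear_expectation_space
begin

lemma Lip_real_mem:
  assumes "f \<in> C_Lip_real" "Y \<in> H" shows "(\<lambda>\<omega>. f (Y \<omega>)) \<in> H"
  using Lip_mem[of 1 "\<lambda>_. Y" "\<lambda>x. f (x 0)"] C_Lip_comp[OF assms(1) C_Lip_coord[of 0 1]] assms(2) by simp

sublocale lattice: function_lattice H
proof
  show "(\<lambda>_. c) \<in> H" for c
    by (rule Lip_real_mem[OF C_Lip_real.const_mem zero_mem])
  show "X \<in> H \<Longrightarrow> (\<lambda>\<omega>. \<bar>X \<omega>\<bar>) \<in> H" for X by (rule Lip_real_mem[OF C_Lip_real_abs])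
qed (rule add_mem scale_mem; assumption)+

lemma E_translate:
  assumes "Y \<in> H" shows "E (\<lambda>\<omega>. Y \<omega> + c) = E Y + c"
proof (rule antisym)
  show "E (\<lambda>\<omega>. Y \<omega> + c) \<le> E Y + c"
    using subadd[OF assms lattice.const_mem[of c]] by (simp add: const)
  show "E Y + c \<le> E (\<lambda>\<omega>. Y \<omega> + c)"
    using subadd[OF add_mem[OF assms lattice.const_mem[of c]] lattice.const_mem[of "-c"]] by (simp add: const)
qed

lemma E_le_add:
  assumes "X \<in> H" "Y \<in> H" "\<And>\<omega>. X \<omega> \<le> Y \<omega> + c" shows "E X \<le> E Y + c"
  using mono[OF add_mem[OF assms(2) lattice.const_mem[of c]] assms(1,3)] E_translate[OF assms(2)] by simp

lemma E_triangle:
  assumes "X \<in> H" "Y \<in> H" shows "E X \<le> E Y + E (\<lambda>\<omega>. X \<omega> - Y \<omega>)"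
  using subadd[OF assms(2) lattice.diff_mem[OF assms]] by simp

text \<open>
  Partial linear functionals below \<^term>\<open>E\<close> are encoded by their graphs. A linear subspace of
  \<open>H \<times> \<real>\<close> that lies below the graph of \<^term>\<open>E\<close> is automatically single-valued, because a vector
  \<open>(0, r)\<close> in it satisfies \<open>r \<le> 0\<close> and \<open>- r \<le> 0\<close>. So unions of chains need no further argument, and
  a functional may be prescribed on functions of \<open>X\<close> without choosing representatives.
\<close>

definition dominated_subspace :: "(('a \<Rightarrow> real) \<times> real) set \<Rightarrow> bool" where
  "dominated_subspace G \<longleftrightarrow>
     ((\<lambda>_. 0, 0) \<in> G) \<and>
     (\<forall>X r Y s. (X, r) \<in> G \<longrightarrow> (Y, s) \<in> G \<longrightarrow> (\<lambda>\<omega>. X \<omega> + Y \<omega>, r + s) \<in> G) \<and>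
     (\<forall>X r c. (X, r) \<in> G \<longrightarrow> (\<lambda>\<omega>. c * X \<omega>, c * r) \<in> G) \<and>
     (\<forall>X r. (X, r) \<in> G \<longrightarrow> X \<in> H \<and> r \<le> E X)"

lemma dominated_subspaceD:
  assumes "dominated_subspace G"
  shows "(\<lambda>_. 0, 0) \<in> G"
    and "(X, r) \<in> G \<Longrightarrow> (Y, s) \<in> G \<Longrightarrow> (\<lambda>\<omega>. X \<omega> + Y \<omega>, r + s) \<in> G"
    and "(X, r) \<in> G \<Longrightarrow> (\<lambda>\<omega>. c * X \<omega>, c * r) \<in> G"
    and "(X, r) \<in> G \<Longrightarrow> X \<in> H"
    and "(X, r) \<in> G \<Longrightarrow> r \<le> E X"
  using assms unfolding dominated_subspace_def by blast+

lemma dominated_subspace_functional: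
  assumes G: "dominated_subspace G" and "(X, r) \<in> G" "(X, s) \<in> G" shows "r = s"
proof -
  have *: "u \<le> v" if "(X, u) \<in> G" "(X, v) \<in> G" for u v
  proof -
    have "(\<lambda>\<omega>. X \<omega> + -1 * X \<omega>, u + -1 * v) \<in> G"
      using dominated_subspaceD(2)[OF G that(1) dominated_subspaceD(3)[OF G that(2), of "-1"]] .
    from dominated_subspaceD(5)[OF G this] show ?thesis by (simp add: const)
  qed
  show ?thesis using *[OF assms(2,3)] *[OF assms(3,2)] by simp
qed

definition adjoin :: "(('a \<Rightarrow> real) \<times> real) set \<Rightarrow> ('a \<Rightarrow> real) \<Rightarrow> real \<Rightarrow> (('a \<Rightarrow> real) \<times> real) set" where
  "adjoin G Z a = {(\<lambda>\<omega>. X \<omega> + t * Z \<omega>, r + t * a) | X r t. (X, r) \<in> G}"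

lemma adjoinI:
  "(X, r) \<in> G \<Longrightarrow> p = (\<lambda>\<omega>. X \<omega> + t * Z \<omega>, r + t * a) \<Longrightarrow> p \<in> adjoin G Z a"
  unfolding adjoin_def by blast

lemma adjoinE:
  assumes "(U, u) \<in> adjoin G Z a"
  obtains X r t where "(X, r) \<in> G" "U = (\<lambda>\<omega>. X \<omega> + t * Z \<omega>)" "u = r + t * a"
  using assms unfolding adjoin_def by blast

text \<open>
  The one-dimensional step of the Hahn-Banach theorem. The value \<open>a\<close> at \<open>Z\<close> has to lie above all
  numbers \<open>r - E (X - Z)\<close> and below all numbers \<open>E (Y + Z) - s\<close>, where \<open>(X, r)\<close> and \<open>(Y, s)\<close> range
  over the graph. Sub-additivity separates the two families, and positive homogeneity turns the
  two bounds into domination on the whole line \<open>X + t Z\<close>.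
\<close>

lemma dominated_subspace_extend:
  assumes G: "dominated_subspace G" and Z: "Z \<in> H"
  shows "\<exists>a. dominated_subspace (adjoin G Z a)"
proof -
  note D = dominated_subspaceD[OF G]
  define l where "l = (\<lambda>(X, r). r - E (\<lambda>\<omega>. X \<omega> - Z \<omega>))"
  have sep: "l (X, r) \<le> E (\<lambda>\<omega>. Y \<omega> + Z \<omega>) - s" if "(X, r) \<in> G" "(Y, s) \<in> G" for X r Y s
  proof -
    have H: "X \<in> H" "Y \<in> H" using that D(4) by auto
    have "r + s \<le> E (\<lambda>\<omega>. X \<omega> + Y \<omega>)" by (rule D(5)[OF D(2)[OF that]])
    also have "\<dots> = E (\<lambda>\<omega>. (X \<omega> - Z \<omega>) + (Y \<omega> + Z \<omega>))" by simp
    also have "\<dots> \<le> E (\<lambda>\<omega>. X \<omega> - Z \<omega>) + E (\<lambda>\<omega>. Y \<omega> + Z \<omega>)"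
      using H Z by (intro subadd lattice.mem)
    finally show ?thesis by (simp add: l_def)
  qed
  define a where "a = (SUP p\<in>G. l p)"
  have bdd: "bdd_above (l ` G)"
    using sep[OF _ D(1)] by (intro bdd_aboveI[of _ "E (\<lambda>\<omega>. 0 + Z \<omega>) - 0"]) auto
  have lower: "r - E (\<lambda>\<omega>. X \<omega> - Z \<omega>) \<le> a" if "(X, r) \<in> G" for X r
    using cSUP_upper[OF that bdd] by (simp add: a_def l_def)
  have upper: "a \<le> E (\<lambda>\<omega>. X \<omega> + Z \<omega>) - r" if "(X, r) \<in> G" for X r
    unfolding a_def using D(1) sep[OF _ that] by (intro cSUP_least) auto
  have dom: "r + t * a \<le> E (\<lambda>\<omega>. X \<omega> + t * Z \<omega>)" if Xr: "(X, r) \<in> G" for X r t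
  proof -
    have X: "X \<in> H" by (rule D(4)[OF Xr])
    consider "t = 0" | "t > 0" | "t < 0" by linarith
    then show ?thesis
    proof cases
      assume "t = 0" then show ?thesis using D(5)[OF Xr] by simp
    next
      assume t: "t > 0"
      have "a \<le> E (\<lambda>\<omega>. (1/t) * X \<omega> + Z \<omega>) - (1/t) * r" by (rule upper[OF D(3)[OF Xr]])
      then have "r + t * a \<le> t * E (\<lambda>\<omega>. (1/t) * X \<omega> + Z \<omega>)" using t by (simp add: field_simps)
      also have "\<dots> = E (\<lambda>\<omega>. t * ((1/t) * X \<omega> + Z \<omega>))"
        using t X Z by (intro pos_homog[symmetric] lattice.mem) auto
      finally show ?thesis using t by (simp add: algebra_simps)
    next
      assume t: "t < 0"
      have "(1/(-t)) * r - E (\<lambda>\<omega>. (1/(-t)) * X \<omega> - Z \<omega>) \<le> a" by (rule lower[OF D(3)[OF Xr]])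
      then have "r + t * a \<le> (-t) * E (\<lambda>\<omega>. (1/(-t)) * X \<omega> - Z \<omega>)" using t by (simp add: field_simps)
      also have "\<dots> = E (\<lambda>\<omega>. (-t) * ((1/(-t)) * X \<omega> - Z \<omega>))"
        using t X Z by (intro pos_homog[symmetric] lattice.mem) auto
      finally show ?thesis using t by (simp add: algebra_simps)
    qed
  qed
  have "dominated_subspace (adjoin G Z a)"
    unfolding dominated_subspace_def
  proof (intro conjI allI impI)
    show "(\<lambda>_. 0, 0) \<in> adjoin G Z a"
      by (rule adjoinI[OF D(1), of _ 0]) simp
  next
    fix U u V v assume "(U, u) \<in> adjoin G Z a" "(V, v) \<in> adjoin G Z a"
    then obtain X r s Y q t where
      U: "(X, r) \<in> G" "U = (\<lambda>\<omega>. X \<omega> + s * Z \<omega>)" "u = r + s * a" and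
      V: "(Y, q) \<in> G" "V = (\<lambda>\<omega>. Y \<omega> + t * Z \<omega>)" "v = q + t * a" by (elim adjoinE)
    show "(\<lambda>\<omega>. U \<omega> + V \<omega>, u + v) \<in> adjoin G Z a"
      by (rule adjoinI[OF D(2)[OF U(1) V(1)], of _ "s + t"]) (simp add: U V algebra_simps)
  next
    fix U u c assume "(U, u) \<in> adjoin G Z a"
    then obtain X r s where U: "(X, r) \<in> G" "U = (\<lambda>\<omega>. X \<omega> + s * Z \<omega>)" "u = r + s * a"
      by (rule adjoinE)
    show "(\<lambda>\<omega>. c * U \<omega>, c * u) \<in> adjoin G Z a"
      by (rule adjoinI[OF D(3)[OF U(1)], of _ c "c * s"]) (simp add: U algebra_simps)
  next
    fix U u assume "(U, u) \<in> adjoin G Z a"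
    then obtain X r s where U: "(X, r) \<in> G" "U = (\<lambda>\<omega>. X \<omega> + s * Z \<omega>)" "u = r + s * a"
      by (rule adjoinE)
    show "U \<in> H" unfolding U(2,3) using D(4)[OF U(1)] Z by (intro lattice.mem)
    show "u \<le> E U" unfolding U(2,3) by (rule dom[OF U(1)])
  qed
  then show ?thesis by blast
qed

theorem hahn_banach:
  assumes G0: "dominated_subspace G0"
  obtains I where
    "\<And>X Y. X \<in> H \<Longrightarrow> Y \<in> H \<Longrightarrow> I (\<lambda>\<omega>. X \<omega> + Y \<omega>) = I X + I Y"
    "\<And>X c. X \<in> H \<Longrightarrow> I (\<lambda>\<omega>. c * X \<omega>) = c * I X"
    "\<And>X. X \<in> H \<Longrightarrow> I X \<le> E X"
    "\<And>X r. (X, r) \<in> G0 \<Longrightarrow> I X = (r::real)"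
proof -
  let ?A = "{G. dominated_subspace G \<and> G0 \<subseteq> G}"
  have "\<exists>M\<in>?A. \<forall>G\<in>?A. M \<subseteq> G \<longrightarrow> G = M"
  proof (rule subset_Zorn_nonempty)
    show "?A \<noteq> {}" using G0 by blast
    fix C assume "C \<noteq> {}" and "subset.chain ?A C"
    then have C: "\<And>G. G \<in> C \<Longrightarrow> dominated_subspace G \<and> G0 \<subseteq> G"
      and chain: "\<And>G G'. G \<in> C \<Longrightarrow> G' \<in> C \<Longrightarrow> G \<subseteq> G' \<or> G' \<subseteq> G"
      unfolding subset.chain_def by blast+
    have "dominated_subspace (\<Union>C)"
      unfolding dominated_subspace_def
    proof (intro conjI allI impI)
      show "(\<lambda>_. 0, 0) \<in> \<Union>C" using \<open>C \<noteq> {}\<close> C dominated_subspaceD(1) by blast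
    next
      fix X r Y s assume "(X, r) \<in> \<Union>C" "(Y, s) \<in> \<Union>C"
      then obtain G G' where "G \<in> C" "(X, r) \<in> G" "G' \<in> C" "(Y, s) \<in> G'" by blast
      then obtain G where "G \<in> C" "(X, r) \<in> G" "(Y, s) \<in> G" using chain by blast
      then show "(\<lambda>\<omega>. X \<omega> + Y \<omega>, r + s) \<in> \<Union>C" using C dominated_subspaceD(2) by blast
    next
      fix X r c assume "(X, r) \<in> \<Union>C"
      then show "(\<lambda>\<omega>. c * X \<omega>, c * r) \<in> \<Union>C" using C dominated_subspaceD(3) by blast
    next
      fix X r assume "(X, r) \<in> \<Union>C"
      then show "X \<in> H" "r \<le> E X" using C dominated_subspaceD(4,5) by blast+
    qed
    then show "\<Union>C \<in> ?A" using C \<open>C \<noteq> {}\<close> by blast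
  qed
  then obtain M where M_A: "M \<in> ?A" and M_max: "\<forall>G\<in>?A. M \<subseteq> G \<longrightarrow> G = M" by (rule bexE)
  from M_A have M: "dominated_subspace M" and G0M: "G0 \<subseteq> M" by simp_all
  have max: "G = M" if "dominated_subspace G" "M \<subseteq> G" for G
    using M_max that G0M by (simp add: subset_trans)
  note D = dominated_subspaceD[OF M]
  have total: "\<exists>r. (Z, r) \<in> M" if Z: "Z \<in> H" for Z
  proof -
    obtain a where a: "dominated_subspace (adjoin M Z a)"
      using dominated_subspace_extend[OF M Z] by (rule exE)
    \<comment> \<open>maximality: adjoining \<open>Z\<close> cannot enlarge the graph\<close>
    have "p \<in> adjoin M Z a" if "p \<in> M" for p
      using that by (intro adjoinI[of "fst p" "snd p" M p 0]) simp_all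
    then have "adjoin M Z a = M" by (intro max[OF a]) blast
    moreover have "(Z, a) \<in> adjoin M Z a"
      by (rule adjoinI[OF D(1), of _ 1]) simp
    ultimately show ?thesis by auto
  qed
  define I where "I X = (THE r. (X, r) \<in> M)" for X
  have I: "I X = r" if "(X, r) \<in> M" for X r
    unfolding I_def using that dominated_subspace_functional[OF M] by blast
  show thesis
  proof (rule that[of I])
    fix X Y assume "X \<in> H" "Y \<in> H"
    then obtain r s where "(X, r) \<in> M" "(Y, s) \<in> M" using total by blast
    then show "I (\<lambda>\<omega>. X \<omega> + Y \<omega>) = I X + I Y" using I[OF D(2)] I by simp
  next
    fix X c assume "X \<in> H"
    then obtain r where "(X, r) \<in> M" using total by blast
    then show "I (\<lambda>\<omega>. c * X \<omega>) = c * I X" using I[OF D(3)] I by simp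
  next
    fix X assume "X \<in> H"
    then obtain r where "(X, r) \<in> M" using total by blast
    then show "I X \<le> E X" using D(5) I by simp
  next
    fix X r assume "(X, r) \<in> G0"
    then show "I X = r" using G0M I by blast
  qed
qed

end

section \<open>Continuity of regular sublinear expectations\<close>

locale regular_sublinear_expectation = sublinear_expectation_space H E
  for H :: "('a \<Rightarrow> real) set" and E +
  assumes regular: "regular_expectation H E"
begin

lemma E_vanish:
  assumes "\<And>i. Z i \<in> H" "\<And>\<omega>. decseq (\<lambda>i. Z i \<omega>)" "\<And>\<omega>. (\<lambda>i. Z i \<omega>) \<longlonglongrightarrow> 0"
  shows "(\<lambda>i::nat. E (Z i)) \<longlonglongrightarrow> 0"
  using regular assms unfolding regular_expectation_def by blast

text \<open>
  Regularity is continuity from above at 0; sub-additivity transports it to every limit in \<open>H\<close>.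
\<close>

lemma E_decseq:
  assumes Zi: "\<And>i. Z i \<in> H" and Z: "Z' \<in> H" and dec: "\<And>\<omega>. decseq (\<lambda>i. Z i \<omega>)"
    and lim: "\<And>\<omega>. (\<lambda>i. Z i \<omega>) \<longlonglongrightarrow> Z' \<omega>"
  shows "(\<lambda>i::nat. E (Z i)) \<longlonglongrightarrow> E Z'"
proof (rule tendsto_sandwich[where f="\<lambda>_. E Z'" and h="\<lambda>i. E Z' + E (\<lambda>\<omega>. Z i \<omega> - Z' \<omega>)"])
  have "(\<lambda>i. E (\<lambda>\<omega>. Z i \<omega> - Z' \<omega>)) \<longlonglongrightarrow> 0"
  proof (rule E_vanish)
    show "(\<lambda>\<omega>. Z i \<omega> - Z' \<omega>) \<in> H" for i using Zi Z by (rule lattice.diff_mem)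
    show "decseq (\<lambda>i. Z i \<omega> - Z' \<omega>)" for \<omega> using dec[of \<omega>] by (simp add: decseq_def)
    show "(\<lambda>i. Z i \<omega> - Z' \<omega>) \<longlonglongrightarrow> 0" for \<omega> using lim[of \<omega>] by (rule LIM_zero)
  qed
  from tendsto_add[OF tendsto_const this]
  show "(\<lambda>i. E Z' + E (\<lambda>\<omega>. Z i \<omega> - Z' \<omega>)) \<longlonglongrightarrow> E Z'" by simp
  show "(\<lambda>i. E Z') \<longlonglongrightarrow> E Z'" by simp
  show "eventually (\<lambda>i. E Z' \<le> E (Z i)) sequentially"
    using Zi Z decseq_ge[OF dec lim] by (intro always_eventually allI mono)
  show "eventually (\<lambda>i. E (Z i) \<le> E Z' + E (\<lambda>\<omega>. Z i \<omega> - Z' \<omega>)) sequentially"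
    using Zi Z by (intro always_eventually allI E_triangle)
qed

lemma truncate_mem: "g \<in> H \<Longrightarrow> (\<lambda>\<omega>. truncate k (g \<omega>)) \<in> H"
  by (rule Lip_real_mem[OF C_Lip_real_truncate])

text \<open>
  The truncation error is at most \<open>(\<bar>g\<bar> - k)\<^sup>+\<close>, which decreases to 0 inside \<open>H\<close>.
\<close>

lemma E_truncate_tendsto:
  assumes g: "g \<in> H" shows "(\<lambda>k. E (\<lambda>\<omega>. truncate k (g \<omega>))) \<longlonglongrightarrow> E g"
proof -
  let ?r = "\<lambda>k \<omega>. max 0 (\<bar>g \<omega>\<bar> - real k)"
  have rH: "?r k \<in> H" for k using g by (intro lattice.mem)
  have rE: "(\<lambda>k. E (?r k)) \<longlonglongrightarrow> 0"
  proof (rule E_vanish[OF rH])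
    show "decseq (\<lambda>k. ?r k \<omega>)" for \<omega> by (auto simp: decseq_def)
    show "(\<lambda>k. ?r k \<omega>) \<longlonglongrightarrow> 0" for \<omega>
      using tendsto_rabs_zero[OF LIM_zero[OF truncate_tendsto[of "g \<omega>"]]] by (simp only: truncate_error)
  qed
  have err: "truncate k t - t \<le> max 0 (\<bar>t\<bar> - real k)" "t - truncate k t \<le> max 0 (\<bar>t\<bar> - real k)" for k t
    using truncate_error[of k t] by linarith+
  have up: "E (\<lambda>\<omega>. truncate k (g \<omega>)) \<le> E g + E (?r k)" for k
  proof -
    have "E (\<lambda>\<omega>. truncate k (g \<omega>)) \<le> E g + E (\<lambda>\<omega>. truncate k (g \<omega>) - g \<omega>)"
      by (intro E_triangle truncate_mem g)
    also have "E (\<lambda>\<omega>. truncate k (g \<omega>) - g \<omega>) \<le> E (?r k)"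
      by (intro mono rH lattice.diff_mem truncate_mem g err)
    finally show ?thesis by simp
  qed
  have lo: "E g - E (?r k) \<le> E (\<lambda>\<omega>. truncate k (g \<omega>))" for k
  proof -
    have "E g \<le> E (\<lambda>\<omega>. truncate k (g \<omega>)) + E (\<lambda>\<omega>. g \<omega> - truncate k (g \<omega>))"
      by (intro E_triangle truncate_mem g)
    also have "E (\<lambda>\<omega>. g \<omega> - truncate k (g \<omega>)) \<le> E (?r k)"
      by (intro mono rH lattice.diff_mem truncate_mem g err)
    finally show ?thesis by simp
  qed
  show ?thesis
  proof (rule tendsto_sandwich[where f="\<lambda>k. E g - E (?r k)" and h="\<lambda>k. E g + E (?r k)"])
    show "(\<lambda>k. E g - E (?r k)) \<longlonglongrightarrow> E g" "(\<lambda>k. E g + E (?r k)) \<longlonglongrightarrow> E g"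
      using rE by (auto intro!: tendsto_eq_intros)
  qed (use up lo in auto)
qed

text \<open>
  Independence and identical distribution speak of bounded functions only, whereas the sets of
  measures are defined by unbounded ones. This lemma bridges the gap: the bound on truncations of
  \<open>\<bar>f\<bar>\<close> gives integrability by monotone convergence, and then both sides converge along the
  truncations of \<open>f\<close>.
\<close>

lemma dominated_by_truncations:
  assumes M: "prob_space M" and f[measurable]: "f \<in> borel_measurable M" and g: "g \<in> H"
    and le: "\<And>k. (\<integral>x. truncate k (f x) \<partial>M) \<le> E (\<lambda>\<omega>. truncate k (g \<omega>))"
    and abs_le: "\<And>k. (\<integral>x. truncate k \<bar>f x\<bar> \<partial>M) \<le> E (\<lambda>\<omega>. truncate k \<bar>g \<omega>\<bar>)"
  shows "integrable M f \<and> integral\<^sup>L M f \<le> E g"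
proof -
  interpret prob_space M by fact
  have tr_int: "integrable M (\<lambda>x. truncate k (h x))" if [measurable]: "h \<in> borel_measurable M" for h k
  proof (rule integrable_const_bound[of _ "real k"])
    show "AE x in M. norm (truncate k (h x)) \<le> real k"
      unfolding real_norm_def by (rule AE_I2) (rule truncate_bound)
  qed measurable
  have abs_g: "E (\<lambda>\<omega>. truncate k \<bar>g \<omega>\<bar>) \<le> E (\<lambda>\<omega>. \<bar>g \<omega>\<bar>)" for k
    using g by (intro mono truncate_mem lattice.mem) (auto simp: truncate_def)
  have "(\<integral>\<^sup>+x. ennreal \<bar>f x\<bar> \<partial>M) = (\<integral>\<^sup>+x. (SUP k. ennreal (truncate k \<bar>f x\<bar>)) \<partial>M)"
  proof (rule nn_integral_cong)
    fix x
    show "ennreal \<bar>f x\<bar> = (SUP k. ennreal (truncate k \<bar>f x\<bar>))"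
    proof (rule antisym)
      obtain N :: nat where "\<bar>f x\<bar> \<le> real N" using real_arch_simple by blast
      then show "ennreal \<bar>f x\<bar> \<le> (SUP k. ennreal (truncate k \<bar>f x\<bar>))"
        by (intro SUP_upper2[of N]) (auto simp: truncate_eq)
      show "(SUP k. ennreal (truncate k \<bar>f x\<bar>)) \<le> ennreal \<bar>f x\<bar>"
        by (intro SUP_least ennreal_leI) (auto simp: truncate_def)
    qed
  qed
  also have "\<dots> = (SUP k. \<integral>\<^sup>+x. ennreal (truncate k \<bar>f x\<bar>) \<partial>M)"
    by (intro nn_integral_monotone_convergence_SUP)
       (auto simp: incseq_def le_fun_def truncate_def intro!: ennreal_leI)
  also have "\<dots> \<le> ennreal (E (\<lambda>\<omega>. \<bar>g \<omega>\<bar>))"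
  proof (rule SUP_least)
    fix k
    have "(\<integral>\<^sup>+x. ennreal (truncate k \<bar>f x\<bar>) \<partial>M) = ennreal (\<integral>x. truncate k \<bar>f x\<bar> \<partial>M)"
      by (intro nn_integral_eq_integral tr_int) (auto simp: truncate_def)
    also have "\<dots> \<le> ennreal (E (\<lambda>\<omega>. \<bar>g \<omega>\<bar>))"
      using abs_le[of k] abs_g[of k] by (intro ennreal_leI) simp
    finally show "(\<integral>\<^sup>+x. ennreal (truncate k \<bar>f x\<bar>) \<partial>M) \<le> ennreal (E (\<lambda>\<omega>. \<bar>g \<omega>\<bar>))" .
  qed
  finally have fint: "integrable M f"
    by (intro integrableI_bounded) (auto intro: le_less_trans)
  have "(\<lambda>k. \<integral>x. truncate k (f x) \<partial>M) \<longlonglongrightarrow> integral\<^sup>L M f"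
  proof (rule integral_dominated_convergence[where w="\<lambda>x. \<bar>f x\<bar>"])
    show "integrable M (\<lambda>x. \<bar>f x\<bar>)" using fint by simp
    show "AE x in M. (\<lambda>k. truncate k (f x)) \<longlonglongrightarrow> f x" by (intro AE_I2 truncate_tendsto)
    show "AE x in M. norm (truncate k (f x)) \<le> \<bar>f x\<bar>" for k by (simp add: abs_truncate_le)
  qed measurable
  then have "integral\<^sup>L M f \<le> E g"
    by (rule LIMSEQ_le[OF _ E_truncate_tendsto[OF g]]) (use le in auto)
  with fint show ?thesis by blast
qed

end

section \<open>The Daniell-Stone theorem\<close>

text \<open>
  The measure is built on \<open>\<Omega> \<times> \<real>\<close>, following Kindler: the strips between two graphs form a
  semiring of sets, and the functional applied to the width \<open>g - f\<close> is a pre-measure on it. The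
  Caratheodory extension of this pre-measure measures regions under graphs, and its restriction to
  \<open>A \<times> [0, 1)\<close> is the measure of \<open>A\<close>. In this way no integral has to be defined from scratch.
\<close>

locale daniell_functional = function_lattice H
    for H :: "('a \<Rightarrow> real) set" +
  fixes I :: "('a \<Rightarrow> real) \<Rightarrow> real"
  assumes I_add: "\<lbrakk>X \<in> H; Y \<in> H\<rbrakk> \<Longrightarrow> I (\<lambda>\<omega>. X \<omega> + Y \<omega>) = I X + I Y"
    and I_scale: "X \<in> H \<Longrightarrow> I (\<lambda>\<omega>. c * X \<omega>) = c * I X"
    and I_nonneg: "\<lbrakk>X \<in> H; \<And>\<omega>. 0 \<le> X \<omega>\<rbrakk> \<Longrightarrow> 0 \<le> I X"
    and I_one: "I (\<lambda>_. 1) = 1"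
    and I_cont: "\<lbrakk>\<And>i. Z i \<in> H; \<And>\<omega>. decseq (\<lambda>i. Z i \<omega>); \<And>\<omega>. (\<lambda>i. Z i \<omega>) \<longlonglongrightarrow> 0\<rbrakk>
                   \<Longrightarrow> (\<lambda>i::nat. I (Z i)) \<longlonglongrightarrow> 0"
begin

lemma I_diff: "\<lbrakk>X \<in> H; Y \<in> H\<rbrakk> \<Longrightarrow> I (\<lambda>\<omega>. X \<omega> - Y \<omega>) = I X - I Y"
  using I_add[OF _ scale_mem[of Y "-1"], of X] I_scale[of Y "-1"] by simp

lemma I_const: "I (\<lambda>_. c) = c"
  using I_scale[OF const_mem[of 1], of c] I_one by simp

lemma I_sum: "(\<And>i. i \<in> S \<Longrightarrow> X i \<in> H) \<Longrightarrow> I (\<lambda>\<omega>. \<Sum>i\<in>S. X i \<omega>) = (\<Sum>i\<in>S. I (X i))"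
  by (induction S rule: infinite_finite_induct) (auto simp: I_const I_add sum_mem)

definition strip :: "('a \<Rightarrow> real) \<Rightarrow> ('a \<Rightarrow> real) \<Rightarrow> ('a \<times> real) set" where
  "strip f g = {(\<omega>, t). f \<omega> \<le> t \<and> t < g \<omega>}"

definition strip_measure :: "('a \<times> real) measure" where
  "strip_measure =
     extend_measure UNIV {(f, g). f \<in> H \<and> g \<in> H \<and> (\<forall>\<omega>. f \<omega> \<le> g \<omega>)}
       (\<lambda>(f, g). strip f g) (\<lambda>(f, g). ennreal (I (\<lambda>\<omega>. g \<omega> - f \<omega>)))"

abbreviation strip_pair :: "('a \<Rightarrow> real) \<Rightarrow> ('a \<Rightarrow> real) \<Rightarrow> bool" where
  "strip_pair f g \<equiv> f \<in> H \<and> g \<in> H \<and> (\<forall>\<omega>. f \<omega> \<le> g \<omega>)"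

lemma strip_section: "Pair \<omega> -` strip f g = {f \<omega>..<g \<omega>}"
  by (auto simp: strip_def)

lemma semiring_of_strips:
  "semiring_of_sets UNIV {strip f g | f g. strip_pair f g}" (is "semiring_of_sets _ ?S")
proof
  show "?S \<subseteq> Pow UNIV" by simp
  show "{} \<in> ?S"
    by (rule CollectI, rule exI[of _ "\<lambda>_. 0"], rule exI[of _ "\<lambda>_. 0"]) (auto simp: strip_def const_mem)
  fix A B assume "A \<in> ?S" "B \<in> ?S"
  then obtain f g u v where A: "A = strip f g" "strip_pair f g" and B: "B = strip u v" "strip_pair u v"
    by blast
  show "A \<inter> B \<in> ?S"
  proof -
    let ?l = "\<lambda>\<omega>. max (f \<omega>) (u \<omega>)" and ?r = "\<lambda>\<omega>. max (max (f \<omega>) (u \<omega>)) (min (g \<omega>) (v \<omega>))"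
    have "A \<inter> B = strip ?l ?r" by (auto simp: A B strip_def)
    moreover have "strip_pair ?l ?r" using A B by (auto intro!: mem)
    ultimately show ?thesis by blast
  qed
  show "\<exists>C\<subseteq>?S. finite C \<and> disjoint C \<and> A - B = \<Union> C"
  proof -
    let ?r = "\<lambda>\<omega>. max (f \<omega>) (min (g \<omega>) (u \<omega>))" and ?l = "\<lambda>\<omega>. min (g \<omega>) (max (f \<omega>) (v \<omega>))"
    let ?C = "{strip f ?r, strip ?l g}"
    have "strip_pair f ?r" "strip_pair ?l g" using A B by (auto intro!: mem)
    then have "?C \<subseteq> ?S" by blast
    moreover have "A - B = \<Union> ?C"
      using A B by (fastforce simp: strip_def)
    moreover have "p \<notin> strip f ?r \<inter> strip ?l g" for p
      using B(2)[THEN conjunct2, THEN conjunct2, rule_format, of "fst p"]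
      by (auto simp: strip_def split_beta less_max_iff_disj min_le_iff_disj)
    then have "strip f ?r \<inter> strip ?l g = {}" by blast
    then have "disjoint ?C" unfolding disjoint_def by blast
    ultimately show ?thesis by (intro exI[of _ ?C] conjI finite.intros)
  qed
qed

lemma strip_width:
  assumes "strip_pair f g" shows "emeasure lborel (Pair \<omega> -` strip f g) = ennreal (g \<omega> - f \<omega>)"
  using assms by (simp add: strip_section)

text \<open>
  Countable additivity on strips is Daniell's continuity condition: if a strip is a disjoint union
  of strips, then comparing the lengths of the sections over each \<open>\<omega>\<close> shows that the widths add up
  pointwise, and the tails of this series decrease to 0.
\<close>

lemma emeasure_strip:
  assumes "f \<in> H" "g \<in> H" "\<And>\<omega>. f \<omega> \<le> g \<omega>"
  shows "emeasure strip_measure (strip f g) = ennreal (I (\<lambda>\<omega>. g \<omega> - f \<omega>))"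
proof (rule extend_measure_caratheodory_pair[OF strip_measure_def])
  show "strip_pair f g" using assms by auto
  show "semiring_of_sets UNIV {strip f g | f g. strip_pair f g}"
    by (rule semiring_of_strips)
next
  fix f g assume "strip_pair f g" "strip f g = {}"
  then have "g \<omega> - f \<omega> = 0" for \<omega>
    using strip_width[of f g \<omega>] by (simp add: ennreal_eq_0_iff antisym)
  then show "ennreal (I (\<lambda>\<omega>. g \<omega> - f \<omega>)) = 0" by (simp add: I_const)
next
  fix f g u v assume *: "strip_pair f g" "strip_pair u v" "strip f g = strip u v"
  then have "g \<omega> - f \<omega> = v \<omega> - u \<omega>" for \<omega>
    using strip_width[of f g \<omega>] strip_width[of u v \<omega>] by simp
  then show "ennreal (I (\<lambda>\<omega>. g \<omega> - f \<omega>)) = ennreal (I (\<lambda>\<omega>. v \<omega> - u \<omega>))" by simp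
next
  fix f g assume "strip_pair f g"
  then show "0 \<le> ennreal (I (\<lambda>\<omega>. g \<omega> - f \<omega>))" by simp
next
  fix A B :: "nat \<Rightarrow> 'a \<Rightarrow> real" and f g
  assume AB: "\<And>n. strip_pair (A n) (B n)" and fg: "strip_pair f g"
    and disj: "disjoint_family (\<lambda>n. strip (A n) (B n))" and un: "(\<Union>i. strip (A i) (B i)) = strip f g"
  have sums: "(\<lambda>n. B n \<omega> - A n \<omega>) sums (g \<omega> - f \<omega>)" for \<omega>
  proof -
    have "(\<Sum>n. emeasure lborel (Pair \<omega> -` strip (A n) (B n)))
        = emeasure lborel (\<Union>n. Pair \<omega> -` strip (A n) (B n))"
    proof (rule suminf_emeasure)
      show "range (\<lambda>n. Pair \<omega> -` strip (A n) (B n)) \<subseteq> sets lborel"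
        by (auto simp: strip_section)
      show "disjoint_family (\<lambda>n. Pair \<omega> -` strip (A n) (B n))"
        using disj unfolding disjoint_family_on_def by blast
    qed
    also have "(\<Union>n. Pair \<omega> -` strip (A n) (B n)) = Pair \<omega> -` strip f g"
      unfolding un[symmetric] by auto
    finally have *: "(\<Sum>n. ennreal (B n \<omega> - A n \<omega>)) = ennreal (g \<omega> - f \<omega>)"
      using AB fg by (simp add: strip_width)
    have summ: "summable (\<lambda>n. B n \<omega> - A n \<omega>)"
      using AB by (intro summable_suminf_not_top) (auto simp: *)
    then have "ennreal (\<Sum>n. B n \<omega> - A n \<omega>) = ennreal (g \<omega> - f \<omega>)"
      using AB by (subst suminf_ennreal2[symmetric]) (auto simp: *)
    moreover have "0 \<le> (\<Sum>n. B n \<omega> - A n \<omega>)" using AB summ by (intro suminf_nonneg) auto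
    ultimately have "(\<Sum>n. B n \<omega> - A n \<omega>) = g \<omega> - f \<omega>" using fg by simp
    then show ?thesis using summ by (simp add: sums_iff)
  qed
  \<comment> \<open>the tail of the pointwise series is a sequence in \<open>H\<close> that decreases to 0\<close>
  define Z where "Z N = (\<lambda>\<omega>. (g \<omega> - f \<omega>) - (\<Sum>n<N. B n \<omega> - A n \<omega>))" for N
  have "(\<lambda>N. I (Z N)) \<longlonglongrightarrow> 0"
  proof (rule I_cont)
    show "Z N \<in> H" for N unfolding Z_def using AB fg by (auto intro!: mem)
    show "decseq (\<lambda>N. Z N \<omega>)" for \<omega>
      using AB by (intro decseq_SucI) (auto simp: Z_def)
    show "(\<lambda>N. Z N \<omega>) \<longlonglongrightarrow> 0" for \<omega>
      unfolding Z_def using sums[of \<omega>] by (auto simp: sums_def intro!: tendsto_eq_intros)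
  qed
  moreover have "I (Z N) = I (\<lambda>\<omega>. g \<omega> - f \<omega>) - (\<Sum>n<N. I (\<lambda>\<omega>. B n \<omega> - A n \<omega>))" for N
    unfolding Z_def using AB fg by (simp add: I_diff I_sum mem)
  ultimately have "(\<lambda>N. I (\<lambda>\<omega>. g \<omega> - f \<omega>) - (\<Sum>n<N. I (\<lambda>\<omega>. B n \<omega> - A n \<omega>))) \<longlonglongrightarrow> 0"
    by simp
  from tendsto_diff[OF tendsto_const[of "I (\<lambda>\<omega>. g \<omega> - f \<omega>)"] this]
  have "(\<lambda>n. I (\<lambda>\<omega>. B n \<omega> - A n \<omega>)) sums I (\<lambda>\<omega>. g \<omega> - f \<omega>)"
    by (simp add: sums_def)
  moreover have "0 \<le> I (\<lambda>\<omega>. B n \<omega> - A n \<omega>)" for n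
    using AB by (intro I_nonneg diff_mem) auto
  ultimately show "(\<Sum>n. ennreal (I (\<lambda>\<omega>. B n \<omega> - A n \<omega>))) = ennreal (I (\<lambda>\<omega>. g \<omega> - f \<omega>))"
    by (intro suminf_ennreal_eq)
qed

lemma strip_in_sets:
  assumes "f \<in> H" "g \<in> H" "\<And>\<omega>. f \<omega> \<le> g \<omega>" shows "strip f g \<in> sets strip_measure"
  using assms unfolding strip_measure_def by (subst sets_extend_measure) (auto intro!: sigma_sets.Basic)

lemma space_strip_measure: "space strip_measure = UNIV"
  unfolding strip_measure_def by (subst space_extend_measure) auto

definition unit_strip :: "('a \<times> real) set" where "unit_strip = strip (\<lambda>_. 0) (\<lambda>_. 1)"

lemma unit_strip_sets: "unit_strip \<in> sets strip_measure"
  unfolding unit_strip_def by (intro strip_in_sets mem) auto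

definition base_measure :: "'a measure" where
  "base_measure = distr (restrict_space strip_measure unit_strip) (sigma_H H) fst"

text \<open>
  A set \<open>{X > a} \<times> [0, 1)\<close> is a countable union of strips from the zero function to
  \<open>min 1 (n \<cdot> (X - a)\<^sup>+)\<close>.
\<close>

lemma fst_measurable: "fst \<in> restrict_space strip_measure unit_strip \<rightarrow>\<^sub>M sigma_H H"
proof -
  let ?R = "restrict_space strip_measure unit_strip"
  have "(\<lambda>p. X (fst p)) \<in> borel_measurable ?R" if X: "X \<in> H" for X
  proof (subst borel_measurable_iff_greater, intro allI)
    fix a :: real
    \<comment> \<open>\<open>n \<cdot> (X - a)\<^sup>+\<close> truncated at 1 increases to the indicator of \<open>{X > a}\<close>\<close>
    define h where "h n = (\<lambda>\<omega>. min 1 (real n * max 0 (X \<omega> - a)))" for n :: nat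
    have h: "h n \<in> H" "0 \<le> h n \<omega>" for n \<omega>
      unfolding h_def using X by (auto intro!: mem)
    have "{p \<in> space ?R. a < X (fst p)} = (\<Union>n. strip (\<lambda>_. 0) (h n))" (is "?L = ?R'")
    proof (intro antisym subsetI)
      fix p assume "p \<in> ?L"
      then have p: "0 \<le> snd p" "snd p < 1" "a < X (fst p)"
        by (auto simp: space_restrict_space unit_strip_def strip_def)
      from reals_Archimedean3[of "X (fst p) - a"] p obtain n where "snd p < real n * (X (fst p) - a)"
        by auto
      with p show "p \<in> ?R'" by (auto simp: strip_def h_def split_beta intro!: exI[of _ n])
    next
      fix p assume "p \<in> ?R'"
      then obtain n where "p \<in> strip (\<lambda>_. 0) (h n)" by blast
      then have n: "0 \<le> snd p" "snd p < 1" "snd p < real n * max 0 (X (fst p) - a)"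
        by (simp_all add: strip_def h_def split_beta)
      then have "a < X (fst p)" by (cases "a < X (fst p)") auto
      with n show "p \<in> ?L"
        by (auto simp: space_restrict_space space_strip_measure unit_strip_def strip_def split_beta)
    qed
    moreover have "strip (\<lambda>_. 0) (h n) = strip (\<lambda>_. 0) (h n) \<inter> unit_strip" for n
      by (auto simp: strip_def unit_strip_def h_def)
    then have "strip (\<lambda>_. 0) (h n) \<in> sets ?R" for n
      using h strip_in_sets[of "\<lambda>_. 0" "h n"] const_mem
      by (auto simp: sets_restrict_space image_iff unit_strip_sets Int_commute)
    ultimately show "{p \<in> space ?R. a < X (fst p)} \<in> sets ?R" by auto
  qed
  from measurable_sets[OF this] show ?thesis
    unfolding sigma_H_def by (intro measurable_measure_of) (auto simp: vimage_comp comp_def vimage_def)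
qed

lemma sets_base_measure: "sets base_measure = sets (sigma_H H)"
  by (simp add: base_measure_def)

lemma space_base_measure: "space base_measure = UNIV"
  by (simp add: base_measure_def sigma_H_def)

lemma borel_measurable_base: "X \<in> H \<Longrightarrow> X \<in> borel_measurable base_measure"
  by (rule measurableI) (auto simp: sets_base_measure space_base_measure sigma_H_def)

lemma emeasure_base:
  assumes "A \<in> sets (sigma_H H)"
  shows "emeasure base_measure A = emeasure strip_measure (A \<times> {0..<1})"
    and "A \<times> {0..<1} \<in> sets strip_measure"
proof -
  have eq: "fst -` A \<inter> space (restrict_space strip_measure unit_strip) = A \<times> {0..<1}"
    by (auto simp: space_restrict_space space_strip_measure unit_strip_def strip_def)
  have "A \<times> {0..<1} \<in> sets (restrict_space strip_measure unit_strip)"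
    using measurable_sets[OF fst_measurable assms] by (simp add: eq)
  then show "A \<times> {0..<1} \<in> sets strip_measure"
    using unit_strip_sets by (auto simp: sets_restrict_space)
  have "emeasure base_measure A = emeasure (restrict_space strip_measure unit_strip) (A \<times> {0..<1})"
    unfolding base_measure_def using assms by (simp add: emeasure_distr[OF fst_measurable] eq)
  also have "\<dots> = emeasure strip_measure (A \<times> {0..<1})"
    using unit_strip_sets
    by (intro emeasure_restrict_space) (auto simp: space_strip_measure unit_strip_def strip_def)
  finally show "emeasure base_measure A = emeasure strip_measure (A \<times> {0..<1})" .
qed

lemma prob_space_base: "prob_space base_measure"
proof
  have U: "UNIV \<in> sets (sigma_H H)" using sets.top[of "sigma_H H"] by (simp add: sigma_H_def)
  have "UNIV \<times> {0..<1::real} = strip (\<lambda>_. 0) (\<lambda>_. 1)" by (auto simp: strip_def)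
  then show "emeasure base_measure (space base_measure) = 1"
    using emeasure_strip[of "\<lambda>_. 0" "\<lambda>_. 1"] const_mem
    by (simp add: space_base_measure emeasure_base U I_const)
qed

sublocale base: prob_space base_measure by (rule prob_space_base)

lemma functional_le_prob:
  assumes "h \<in> H" "\<And>\<omega>. 0 \<le> h \<omega>" "A \<in> sets (sigma_H H)" "\<And>\<omega>. h \<omega> \<le> indicator A \<omega>"
  shows "I h \<le> base.prob A"
proof -
  have "ennreal (I h) = emeasure strip_measure (strip (\<lambda>_. 0) h)"
    using assms by (simp add: emeasure_strip const_mem)
  also have "\<dots> \<le> emeasure strip_measure (A \<times> {0..<1})"
  proof (rule emeasure_mono)
    have "0 \<le> t \<Longrightarrow> t < h \<omega> \<Longrightarrow> \<omega> \<in> A \<and> t < 1" for \<omega> t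
      using assms(4)[of \<omega>] by (cases "\<omega> \<in> A") auto
    then show "strip (\<lambda>_. 0) h \<subseteq> A \<times> {0..<1}" by (auto simp: strip_def)
    show "A \<times> {0..<1} \<in> sets strip_measure" using assms by (simp add: emeasure_base)
  qed
  finally have "ennreal (I h) \<le> ennreal (base.prob A)"
    using assms by (simp add: emeasure_base base.emeasure_eq_measure[symmetric])
  then show ?thesis by simp
qed

lemma prob_le_functional:
  assumes "h \<in> H" "\<And>\<omega>. 0 \<le> h \<omega>" "A \<in> sets (sigma_H H)" "\<And>\<omega>. indicator A \<omega> \<le> h \<omega>"
  shows "base.prob A \<le> I h"
proof -
  have "emeasure strip_measure (A \<times> {0..<1}) \<le> emeasure strip_measure (strip (\<lambda>_. 0) h)"
  proof (rule emeasure_mono)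
    have "\<omega> \<in> A \<Longrightarrow> 1 \<le> h \<omega>" for \<omega> using assms(4)[of \<omega>] by simp
    then show "A \<times> {0..<1} \<subseteq> strip (\<lambda>_. 0) h" by (force simp: strip_def)
    show "strip (\<lambda>_. 0) h \<in> sets strip_measure" using assms by (intro strip_in_sets const_mem) auto
  qed
  then have "ennreal (base.prob A) \<le> ennreal (I h)"
    using assms by (simp add: emeasure_base base.emeasure_eq_measure[symmetric] emeasure_strip const_mem)
  then show ?thesis using I_nonneg[OF assms(1,2)] by simp
qed

text \<open>
  A bounded function is cut into horizontal layers \<open>h k\<close> of thickness \<open>e\<close>. The functional and the
  integral of the layer \<open>h k\<close> both lie between \<open>e P(f > (k + 1) e)\<close> and \<open>e P(f > k e)\<close>, and the sum
  of the differences of these bounds telescopes to at most \<open>e\<close>.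
\<close>

lemma integral_bounded:
  assumes f: "f \<in> H" and f0: "\<And>\<omega>. 0 \<le> f \<omega>" and fc: "\<And>\<omega>. f \<omega> \<le> c"
  shows "integral\<^sup>L base_measure f = I f"
proof (rule ccontr)
  assume neq: "integral\<^sup>L base_measure f \<noteq> I f"
  define e where "e = \<bar>integral\<^sup>L base_measure f - I f\<bar> / 2"
  have e: "e > 0" using neq by (simp add: e_def)
  obtain N :: nat where "c < real N * e" using reals_Archimedean3[OF e] by blast
  then have fN: "min (f \<omega>) (real N * e) = f \<omega>" for \<omega> using fc[of \<omega>] by simp
  define h where "h k = (\<lambda>\<omega>. min (f \<omega>) (real (Suc k) * e) - min (f \<omega>) (real k * e))" for k
  define A where "A k = {\<omega>. real k * e < f \<omega>}" for k :: nat
  have A: "A k \<in> sets (sigma_H H)" for k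
    using measurable_sets[OF borel_measurable_base[OF f], of "{real k * e<..}"]
    by (simp add: A_def vimage_def space_base_measure sets_base_measure)
  have hH: "h k \<in> H" for k unfolding h_def using f by (intro mem)
  have [measurable]: "h k \<in> borel_measurable base_measure" "A k \<in> sets base_measure" for k
    using borel_measurable_base[OF hH] A by (auto simp: sets_base_measure)
  have h0: "0 \<le> h k \<omega>" for k \<omega> using e by (auto simp: h_def algebra_simps)
  have up: "h k \<omega> \<le> e * indicator (A k) \<omega>" for k \<omega>
    using e by (auto simp: h_def A_def algebra_simps split: split_indicator)
  have lo: "e * indicator (A (Suc k)) \<omega> \<le> h k \<omega>" for k \<omega>
    using e h0[of k \<omega>] by (auto simp: h_def A_def algebra_simps split: split_indicator)
  have hint: "integrable base_measure (h k)" for k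
  proof (rule base.integrable_const_bound[where B=e])
    have "\<bar>h k \<omega>\<bar> \<le> e" for \<omega>
      using h0[of k \<omega>] up[of k \<omega>] e by (auto split: split_indicator_asm)
    then show "AE \<omega> in base_measure. norm (h k \<omega>) \<le> e" by simp
  qed simp
  have "(\<Sum>k<n. h k \<omega>) = min (f \<omega>) (real n * e)" for n \<omega>
    using f0[of \<omega>] by (induction n) (auto simp: h_def)
  then have f_sum: "f = (\<lambda>\<omega>. \<Sum>k<N. h k \<omega>)" using fN by (auto simp: fun_eq_iff)
  have If: "I f = (\<Sum>k<N. I (h k))" unfolding f_sum using hH by (simp add: I_sum)
  have Lf: "integral\<^sup>L base_measure f = (\<Sum>k<N. integral\<^sup>L base_measure (h k))"
    unfolding f_sum using hint by (simp add: Bochner_Integration.integral_sum)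
  have hs: "(\<lambda>\<omega>. (1/e) * h k \<omega>) \<in> H" for k using hH by (intro mem)
  have I_up: "I (h k) \<le> e * base.prob (A k)" for k
  proof -
    have "(1/e) * I (h k) \<le> base.prob (A k)"
      unfolding I_scale[OF hH, symmetric]
      using e h0[of k] up[of k] by (intro functional_le_prob hs A) (auto simp: field_simps)
    then show ?thesis using e by (simp add: field_simps)
  qed
  have I_lo: "e * base.prob (A (Suc k)) \<le> I (h k)" for k
  proof -
    have "base.prob (A (Suc k)) \<le> (1/e) * I (h k)"
      unfolding I_scale[OF hH, symmetric]
      using e h0[of k] lo[of k] by (intro prob_le_functional hs A) (auto simp: field_simps)
    then show ?thesis using e by (simp add: field_simps)
  qed
  have ind: "integrable base_measure (\<lambda>\<omega>. e * indicator (A k) \<omega>)" for k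
    using e by (intro base.integrable_const_bound[where B=e] AE_I2) (auto split: split_indicator)
  have L_up: "integral\<^sup>L base_measure (h k) \<le> e * base.prob (A k)" for k
  proof -
    have "integral\<^sup>L base_measure (h k) \<le> (\<integral>\<omega>. e * indicator (A k) \<omega> \<partial>base_measure)"
      using hint ind up by (intro integral_mono) auto
    then show ?thesis by simp
  qed
  have L_lo: "e * base.prob (A (Suc k)) \<le> integral\<^sup>L base_measure (h k)" for k
  proof -
    have "(\<integral>\<omega>. e * indicator (A (Suc k)) \<omega> \<partial>base_measure) \<le> integral\<^sup>L base_measure (h k)"
      using hint ind lo by (intro integral_mono) auto
    then show ?thesis by simp
  qed
  have "\<bar>integral\<^sup>L base_measure f - I f\<bar> \<le> (\<Sum>k<N. \<bar>integral\<^sup>L base_measure (h k) - I (h k)\<bar>)"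
    unfolding If Lf by (simp add: sum_subtractf[symmetric])
  also have "\<dots> \<le> (\<Sum>k<N. e * base.prob (A k) - e * base.prob (A (Suc k)))"
    using I_up I_lo L_up L_lo by (intro sum_mono) (smt (verit))
  also have "\<dots> = e * base.prob (A 0) - e * base.prob (A N)"
    by (rule sum_lessThan_telescope')
  also have "\<dots> \<le> e"
    using e base.prob_le_1[of "A 0"] by (smt (verit) mult_left_le measure_nonneg mult_nonneg_nonneg)
  finally show False using e by (simp add: e_def)
qed

lemma has_integral_nonneg:
  assumes f: "f \<in> H" and f0: "\<And>\<omega>. 0 \<le> f \<omega>"
  shows "integrable base_measure f \<and> integral\<^sup>L base_measure f = I f"
proof -
  define g where "g n = (\<lambda>\<omega>. min (f \<omega>) (real n))" for n
  have gH: "g n \<in> H" for n unfolding g_def using f by (intro mem)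
  have ig: "integrable base_measure (g n)" for n
    using f0 by (intro base.integrable_const_bound[where B="real n"] AE_I2)
       (auto intro!: borel_measurable_base[OF gH], auto simp: g_def)
  have Lg: "integral\<^sup>L base_measure (g n) = I (g n)" for n
    using gH f0 by (intro integral_bounded[where c="real n"]) (auto simp: g_def)
  have conv: "(\<lambda>n. g n \<omega>) \<longlonglongrightarrow> f \<omega>" for \<omega>
  proof (rule tendsto_eventually)
    obtain N :: nat where "f \<omega> \<le> real N" using real_arch_simple by blast
    then show "\<forall>\<^sub>F n in sequentially. g n \<omega> = f \<omega>"
      unfolding g_def eventually_sequentially by (intro exI[of _ N]) (auto intro!: min_absorb1)
  qed
  have "(\<lambda>n. I (\<lambda>\<omega>. f \<omega> - g n \<omega>)) \<longlonglongrightarrow> 0"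
  proof (rule I_cont)
    show "(\<lambda>\<omega>. f \<omega> - g n \<omega>) \<in> H" for n using f gH by (intro mem)
    show "decseq (\<lambda>n. f \<omega> - g n \<omega>)" for \<omega> by (intro decseq_SucI) (auto simp: g_def)
    show "(\<lambda>n. f \<omega> - g n \<omega>) \<longlonglongrightarrow> 0" for \<omega>
      using tendsto_diff[OF tendsto_const[of "f \<omega>"] conv[of \<omega>]] by simp
  qed
  then have "(\<lambda>n. I f - I (g n)) \<longlonglongrightarrow> 0" using f gH by (simp add: I_diff)
  from tendsto_diff[OF tendsto_const[of "I f"] this] have "(\<lambda>n. I (g n)) \<longlonglongrightarrow> I f" by simp
  then have "has_bochner_integral base_measure f (I f)"
  proof (intro has_bochner_integral_monotone_convergence[where f=g] ig AE_I2 conv borel_measurable_base[OF f])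
    show "mono (\<lambda>n. g n \<omega>)" for \<omega> by (auto simp: mono_def g_def)
    show "(\<lambda>n. integral\<^sup>L base_measure (g n)) \<longlonglongrightarrow> I f"
      unfolding Lg by fact
  qed
  then show ?thesis by (simp add: has_bochner_integral_iff)
qed

theorem daniell_stone:
  "\<exists>P. prob_space P \<and> sets P = sets (sigma_H H) \<and> (\<forall>X\<in>H. integrable P X \<and> integral\<^sup>L P X = I X)"
proof (intro exI conjI ballI)
  show "prob_space base_measure" "sets base_measure = sets (sigma_H H)"
    by (rule prob_space_base sets_base_measure)+
  fix X assume X: "X \<in> H"
  let ?p = "\<lambda>\<omega>. max 0 (X \<omega>)" and ?n = "\<lambda>\<omega>. max 0 (-1 * X \<omega>)"
  have H: "?p \<in> H" "?n \<in> H" by (intro mem X)+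
  have eq: "X = (\<lambda>\<omega>. ?p \<omega> - ?n \<omega>)" by (auto simp: fun_eq_iff max_def)
  show "integrable base_measure X"
    using has_integral_nonneg[OF H(1)] has_integral_nonneg[OF H(2)]
    by (subst eq) (auto intro!: Bochner_Integration.integrable_diff)
  show "integral\<^sup>L base_measure X = I X"
    using has_integral_nonneg[OF H(1)] has_integral_nonneg[OF H(2)]
    by (subst (1 2) eq) (simp add: I_diff[OF H, simplified])
qed

end

section \<open>Approximation of Borel sets by Lipschitz functions\<close>

text \<open>
  The same approximating function has to serve two measures, so that two measures that integrate
  all approximating functions alike can be compared on a set.
\<close>

definition L1_approximable ::
    "('b \<Rightarrow> real) set \<Rightarrow> 'b measure \<Rightarrow> 'b measure \<Rightarrow> 'b set \<Rightarrow> bool" where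
  "L1_approximable L M N B \<longleftrightarrow> B \<in> sets M \<and>
     (\<forall>e>0. \<exists>f\<in>L. range f \<subseteq> {0..1} \<and>
        (\<integral>x. \<bar>indicator B x - f x\<bar> \<partial>M) < e \<and> (\<integral>x. \<bar>indicator B x - f x\<bar> \<partial>N) < e)"

lemma integrable_indicator_error:
  assumes "finite_measure M" "f \<in> borel_measurable M" "range f \<subseteq> {0..1::real}" "B \<in> sets M"
  shows "integrable M (\<lambda>x. \<bar>indicator B x - f x\<bar>)"
proof -
  interpret finite_measure M by fact
  have [measurable]: "f \<in> borel_measurable M" "B \<in> sets M" by fact+
  have "\<bar>indicator B x - f x\<bar> \<le> 1" for x
  proof -
    have "f x \<in> {0..1}" using assms(3) by blast
    then show ?thesis by (auto simp: indicator_def abs_le_iff)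
  qed
  then show ?thesis by (intro integrable_const_bound[of _ 1] AE_I2) auto
qed

text \<open>
  Complements correspond to \<open>1 - f\<close>, and finite unions to maxima, whose errors are bounded by the
  sums of the errors. A countable union is exhausted by finitely many of its members up to a set of
  small measure.
\<close>

lemma sigma_algebra_L1_approximable:
  fixes M N :: "'b measure"
  assumes lat: "function_lattice L" and meas: "\<And>f. f \<in> L \<Longrightarrow> f \<in> borel_measurable M"
    and M: "finite_measure M" and N: "finite_measure N" and sets: "sets N = sets M"
    and space: "space M = UNIV"
  shows "sigma_algebra UNIV {B. L1_approximable L M N B}"
proof -
  interpret lat: function_lattice L by fact
  interpret M: finite_measure M by fact
  interpret N: finite_measure N by fact
  have measN: "f \<in> borel_measurable N" if "f \<in> L" for f
    using meas[OF that] by (simp cong: measurable_cong_sets add: sets)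
  note int = integrable_indicator_error[OF M meas] integrable_indicator_error[OF N measN]
  show ?thesis
    unfolding sigma_algebra_iff2
  proof (intro conjI ballI allI impI, goal_cases)
    case 1 show ?case by simp
  next
    case 2
    have "L1_approximable L M N {}"
      unfolding L1_approximable_def by (intro conjI allI impI bexI[of _ "\<lambda>_. 0"] lat.const_mem) auto
    then show ?case by simp
  next
    case (3 B)
    then have B: "L1_approximable L M N B" by simp
    have "L1_approximable L M N (UNIV - B)"
      unfolding L1_approximable_def
    proof (intro conjI allI impI)
      show "UNIV - B \<in> sets M" using B space unfolding L1_approximable_def by (metis sets.compl_sets)
      fix e :: real assume "0 < e"
      then obtain f where f: "f \<in> L" "range f \<subseteq> {0..1}"
        "(\<integral>x. \<bar>indicator B x - f x\<bar> \<partial>M) < e" "(\<integral>x. \<bar>indicator B x - f x\<bar> \<partial>N) < e"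
        using B unfolding L1_approximable_def by blast
      have "\<bar>indicator (UNIV - B) x - (1 - f x)\<bar> = \<bar>indicator B x - f x\<bar>" for x
        by (auto simp: indicator_def)
      moreover have "(\<lambda>x. 1 - f x) \<in> L" using f by (intro lat.mem)
      moreover have "range (\<lambda>x. 1 - f x) \<subseteq> {0..1}" using f(2) by (auto simp: subset_iff image_iff)
      ultimately show "\<exists>f\<in>L. range f \<subseteq> {0..1} \<and>
        (\<integral>x. \<bar>indicator (UNIV - B) x - f x\<bar> \<partial>M) < e \<and> (\<integral>x. \<bar>indicator (UNIV - B) x - f x\<bar> \<partial>N) < e"
        using f by (intro bexI[of _ "\<lambda>x. 1 - f x"]) auto
    qed
    then show ?case by simp
  next
    case (4 A)
    then have A: "L1_approximable L M N (A i)" for i by auto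
    then have A_sets: "A i \<in> sets M" for i unfolding L1_approximable_def by blast
    let ?U = "\<Union>i. A i"
    have "L1_approximable L M N ?U"
      unfolding L1_approximable_def
    proof (intro conjI allI impI)
      show U: "?U \<in> sets M" using A_sets by blast
      fix e :: real assume e: "0 < e"
      \<comment> \<open>finitely many of the sets exhaust the union up to \<open>e/2\<close>, for both measures\<close>
      have tail: "eventually (\<lambda>n. measure K (?U - (\<Union>i<n. A i)) < e / 2) sequentially"
        if K: "finite_measure K" "sets K = sets M" for K
      proof -
        interpret K: finite_measure K by fact
        have "(\<lambda>n. measure K (?U - (\<Union>i<n. A i))) \<longlonglongrightarrow> measure K (\<Inter>n. ?U - (\<Union>i<n. A i))"
        proof (rule K.finite_Lim_measure_decseq)
          show "range (\<lambda>n. ?U - (\<Union>i<n. A i)) \<subseteq> sets K" using A_sets U K by auto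
          show "decseq (\<lambda>n. ?U - (\<Union>i<n. A i))" by (force simp: decseq_def)
        qed
        also have "(\<Inter>n. ?U - (\<Union>i<n. A i)) = {}" by auto
        finally have "(\<lambda>n. measure K (?U - (\<Union>i<n. A i))) \<longlonglongrightarrow> 0" by simp
        then show ?thesis by (rule order_tendstoD(2)) (use e in simp)
      qed
      have "eventually (\<lambda>n. measure M (?U - (\<Union>i<n. A i)) < e / 2 \<and> measure N (?U - (\<Union>i<n. A i)) < e / 2) sequentially"
        using tail[OF M refl] tail[OF N sets] by (rule eventually_conj)
      then obtain n where n: "measure M (?U - (\<Union>i<n. A i)) < e / 2" "measure N (?U - (\<Union>i<n. A i)) < e / 2"
        by (auto simp: eventually_sequentially)
      \<comment> \<open>\<open>n\<close> errors of size \<open>d\<close> use up the other half of \<open>e\<close>\<close>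
      define d where "d = e / (2 * (real n + 1))"
      have d: "d > 0" "real n * d \<le> e / 2" using e by (auto simp: d_def field_simps)
      have "\<forall>i. \<exists>f\<in>L. range f \<subseteq> {0..1} \<and>
        (\<integral>x. \<bar>indicator (A i) x - f x\<bar> \<partial>M) < d \<and> (\<integral>x. \<bar>indicator (A i) x - f x\<bar> \<partial>N) < d"
        using A d unfolding L1_approximable_def by blast
      then obtain f where f: "\<And>i. f i \<in> L" "\<And>i. range (f i) \<subseteq> {0..1}"
        "\<And>i. (\<integral>x. \<bar>indicator (A i) x - f i x\<bar> \<partial>M) < d" "\<And>i. (\<integral>x. \<bar>indicator (A i) x - f i x\<bar> \<partial>N) < d"
        by metis
      have f01: "0 \<le> f i x" "f i x \<le> 1" for i x using f(2)[of i] by (auto simp: subset_iff image_iff)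
      define g where "g m = rec_nat (\<lambda>_. 0) (\<lambda>i h x. max (h x) (f i x)) m" for m
      have g_0: "g 0 = (\<lambda>_. 0)" and g_Suc: "g (Suc m) = (\<lambda>x. max (g m x) (f m x))" for m
        by (simp_all add: g_def)
      have gL: "g m \<in> L" for m
        by (induction m) (auto simp: g_0 g_Suc intro: lat.const_mem lat.max_mem f(1))
      have g01: "0 \<le> g m x \<and> g m x \<le> 1" for m x
        by (induction m) (auto simp: g_0 g_Suc f01 le_max_iff_disj)
      have g_err: "\<bar>indicator (\<Union>i<m. A i) x - g m x\<bar> \<le> (\<Sum>i<m. \<bar>indicator (A i) x - f i x\<bar>)" for m x
      proof (induction m)
        case (Suc m)
        have "indicator (\<Union>i<Suc m. A i) x = max (indicator (\<Union>i<m. A i) x) (indicator (A m) x :: real)"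
          by (auto simp: indicator_def less_Suc_eq)
        moreover have "\<bar>max a b - max c d\<bar> \<le> \<bar>a - c\<bar> + \<bar>b - d\<bar>" for a b c d :: real
          by (auto simp: max_def)
        ultimately have "\<bar>indicator (\<Union>i<Suc m. A i) x - g (Suc m) x\<bar>
          \<le> \<bar>indicator (\<Union>i<m. A i) x - g m x\<bar> + \<bar>indicator (A m) x - f m x\<bar>"
          unfolding g_Suc by metis
        then show ?case using Suc by simp
      qed (simp add: g_0)
      have bound: "(\<integral>x. \<bar>indicator ?U x - g n x\<bar> \<partial>K) < e"
        if K: "finite_measure K" "sets K = sets M" and nK: "measure K (?U - (\<Union>i<n. A i)) < e / 2"
          and fK: "\<And>i. (\<integral>x. \<bar>indicator (A i) x - f i x\<bar> \<partial>K) < d" for K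
      proof -
        interpret K: finite_measure K by fact
        have mK: "h \<in> borel_measurable K" if "h \<in> L" for h
          using meas[OF that] by (simp cong: measurable_cong_sets add: K)
        have iA: "integrable K (\<lambda>x. \<bar>indicator (A i) x - f i x\<bar>)" for i
          using A_sets K by (intro integrable_indicator_error K(1) mK f) simp
        have D: "?U - (\<Union>i<n. A i) \<in> sets K" using A_sets K U by auto
        have iD: "integrable K (indicator (?U - (\<Union>i<n. A i)) :: _ \<Rightarrow> real)"
          using D by (simp add: K.emeasure_eq_measure)
        have iU: "integrable K (\<lambda>x. \<bar>indicator ?U x - g n x\<bar>)"
          using U K g01 by (intro integrable_indicator_error K(1) mK gL) auto
        have "(\<integral>x. \<bar>indicator ?U x - g n x\<bar> \<partial>K)
          \<le> (\<integral>x. indicator (?U - (\<Union>i<n. A i)) x + (\<Sum>i<n. \<bar>indicator (A i) x - f i x\<bar>) \<partial>K)"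
        proof (intro integral_mono iU Bochner_Integration.integrable_add iD Bochner_Integration.integrable_sum iA)
          fix x
          have "\<bar>indicator ?U x - g n x\<bar> \<le> indicator (?U - (\<Union>i<n. A i)) x + \<bar>indicator (\<Union>i<n. A i) x - g n x\<bar>"
            by (auto simp: indicator_def)
          with g_err[where m=n and x=x] show "\<bar>indicator ?U x - g n x\<bar> \<le> indicator (?U - (\<Union>i<n. A i)) x + (\<Sum>i<n. \<bar>indicator (A i) x - f i x\<bar>)"
            by linarith
        qed
        also have "\<dots> = measure K (?U - (\<Union>i<n. A i)) + (\<Sum>i<n. \<integral>x. \<bar>indicator (A i) x - f i x\<bar> \<partial>K)"
          using D iA iD sets.sets_into_space[OF D]
          by (subst Bochner_Integration.integral_add) (auto simp: Bochner_Integration.integral_sum Int_absorb2 intro!: Bochner_Integration.integrable_sum)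
        also have "\<dots> \<le> measure K (?U - (\<Union>i<n. A i)) + (\<Sum>i<n. d)"
          using fK by (intro add_left_mono sum_mono less_imp_le)
        also have "\<dots> < e" using nK d(2) by simp
        finally show ?thesis .
      qed
      show "\<exists>f\<in>L. range f \<subseteq> {0..1} \<and>
        (\<integral>x. \<bar>indicator ?U x - f x\<bar> \<partial>M) < e \<and> (\<integral>x. \<bar>indicator ?U x - f x\<bar> \<partial>N) < e"
        using bound[OF M refl n(1) f(3)] bound[OF N sets n(2) f(4)] g01
        by (intro bexI[OF _ gL[of n]]) auto
    qed
    then show ?case by simp
  qed
qed

lemma sigma_space_R_seq: "sets M = sets R_seq \<Longrightarrow> space M = UNIV"
  using sets_eq_imp_space_eq[of M R_seq] by (simp add: space_PiM)

text \<open>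
  Half spaces \<open>{x i > a}\<close> are limits of the ramps \<open>min 1 (k \<cdot> (x i - a)\<^sup>+)\<close>. So the coordinates are
  measurable for the \<open>\<sigma>\<close>-algebra of approximable sets, which then contains every cylinder.
\<close>

lemma cylinder_L1_approximable:
  fixes M N :: "(nat \<Rightarrow> real) measure"
  assumes lat: "function_lattice L" and meas: "\<And>f. f \<in> L \<Longrightarrow> f \<in> borel_measurable R_seq"
    and M: "finite_measure M" "sets M = sets R_seq" and N: "finite_measure N" "sets N = sets R_seq"
    and coord: "\<And>i. i \<in> I \<Longrightarrow> (\<lambda>x. x i) \<in> L"
    and B: "B \<in> sets (PiM I (\<lambda>_. borel))"
  shows "L1_approximable L M N {x. restrict x I \<in> B}"
proof -
  interpret lat: function_lattice L by fact
  have measK: "f \<in> borel_measurable K" if "f \<in> L" "sets K = sets R_seq" for f and K :: "(nat \<Rightarrow> real) measure"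
    using meas[OF that(1)] that(2) by (simp cong: measurable_cong_sets)
  have sa: "sigma_algebra UNIV {B. L1_approximable L M N B}"
    by (rule sigma_algebra_L1_approximable[OF lat])
       (use M N measK sigma_space_R_seq in auto)
  define S where "S = sigma UNIV {B. L1_approximable L M N B}"
  have sets_S: "sets S = {B. L1_approximable L M N B}" and space_S: "space S = UNIV"
    unfolding S_def using sigma_algebra.sigma_sets_eq[OF sa] by simp_all
  have "(\<lambda>x. x i) \<in> borel_measurable S" if i: "i \<in> I" for i
  proof (subst borel_measurable_iff_greater, intro allI)
    fix a :: real
    define f where "f k = (\<lambda>x :: nat \<Rightarrow> real. min 1 (real k * max 0 (x i - a)))" for k :: nat
    have fL: "f k \<in> L" for k unfolding f_def using coord[OF i] by (intro lat.mem)
    have f01: "range (f k) \<subseteq> {0..1}" for k by (auto simp: f_def)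
    let ?U = "{x :: nat \<Rightarrow> real. a < x i}"
    have lim: "(\<lambda>k. f k x) \<longlonglongrightarrow> indicator ?U x" for x
    proof (rule tendsto_eventually)
      show "\<forall>\<^sub>F k in sequentially. f k x = indicator ?U x"
      proof (cases "a < x i")
        case True
        then obtain N :: nat where N: "1 < real N * (x i - a)" using reals_Archimedean3[of "x i - a"] by auto
        have "f k x = 1" if "N \<le> k" for k
        proof -
          have "real N * (x i - a) \<le> real k * (x i - a)" using True that by (intro mult_right_mono) auto
          with N True have "1 \<le> real k * max 0 (x i - a)" by (simp only: max.absorb2 less_imp_le diff_ge_0_iff_ge)
          then show ?thesis by (simp only: f_def min.absorb1)
        qed
        with True show ?thesis unfolding eventually_sequentially by (intro exI[of _ N] allI impI) simp
      qed (simp add: f_def)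
    qed
    have U: "?U \<in> sets R_seq"
    proof -
      have "{x \<in> space R_seq. a < x i} \<in> sets R_seq" by measurable
      then show ?thesis by (simp add: space_PiM)
    qed
    have conv: "(\<lambda>k. \<integral>x. \<bar>indicator ?U x - f k x\<bar> \<partial>K) \<longlonglongrightarrow> 0"
      if K: "finite_measure K" "sets K = sets R_seq" for K
    proof -
      interpret K: finite_measure K by fact
      have [measurable]: "?U \<in> sets K" "f k \<in> borel_measurable K" for k
        using U K measK[OF fL] by auto
      have "(\<lambda>k. \<integral>x. \<bar>indicator ?U x - f k x\<bar> \<partial>K) \<longlonglongrightarrow> (\<integral>x. 0 \<partial>K)"
      proof (rule integral_dominated_convergence[where w="\<lambda>_. 1"])
        show "AE x in K. (\<lambda>k. \<bar>indicator ?U x - f k x\<bar>) \<longlonglongrightarrow> 0"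
        proof (rule AE_I2)
          fix x
          from tendsto_diff[OF tendsto_const lim] 
          have "(\<lambda>k. indicator ?U x - f k x) \<longlonglongrightarrow> indicator ?U x - (indicator ?U x :: real)" .
          then show "(\<lambda>k. \<bar>indicator ?U x - f k x\<bar>) \<longlonglongrightarrow> 0" by (intro tendsto_rabs_zero) simp
        qed
        show "AE x in K. norm \<bar>indicator ?U x - f k x\<bar> \<le> 1" for k
        proof (rule AE_I2)
          fix x
          have "f k x \<in> {0..1}" using f01 by blast
          then show "norm \<bar>indicator ?U x - f k x\<bar> \<le> 1" by (auto simp: indicator_def abs_le_iff)
        qed
      qed measurable
      then show ?thesis by simp
    qed
    have "L1_approximable L M N ?U"
      unfolding L1_approximable_def
    proof (intro conjI allI impI)
      show "?U \<in> sets M" using U M by simp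
      fix e :: real assume e: "0 < e"
      have "eventually (\<lambda>k. (\<integral>x. \<bar>indicator ?U x - f k x\<bar> \<partial>M) < e \<and> (\<integral>x. \<bar>indicator ?U x - f k x\<bar> \<partial>N) < e) sequentially"
        using order_tendstoD(2)[OF conv[OF M] e] order_tendstoD(2)[OF conv[OF N] e] by (rule eventually_conj)
      then obtain k where "(\<integral>x. \<bar>indicator ?U x - f k x\<bar> \<partial>M) < e" "(\<integral>x. \<bar>indicator ?U x - f k x\<bar> \<partial>N) < e"
        by (auto simp: eventually_sequentially)
      then show "\<exists>f\<in>L. range f \<subseteq> {0..1} \<and> (\<integral>x. \<bar>indicator ?U x - f x\<bar> \<partial>M) < e \<and> (\<integral>x. \<bar>indicator ?U x - f x\<bar> \<partial>N) < e"
        using fL f01 by blast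
    qed
    then show "{x \<in> space S. a < x i} \<in> sets S" by (simp add: sets_S space_S)
  qed
  then have "(\<lambda>x. restrict x I) \<in> S \<rightarrow>\<^sub>M PiM I (\<lambda>_. borel)" by (rule measurable_restrict)
  from measurable_sets[OF this B] show ?thesis by (simp add: sets_S space_S vimage_def)
qed

lemma function_lattice_cylinder: "function_lattice (\<Union>n. C_Lip n)"
proof
  show "(\<lambda>_. c) \<in> (\<Union>n. C_Lip n)" for c using C_Lip.const_mem by blast
  fix X Y :: "(nat \<Rightarrow> real) \<Rightarrow> real" assume "X \<in> (\<Union>n. C_Lip n)" "Y \<in> (\<Union>n. C_Lip n)"
  then obtain n m where "X \<in> C_Lip n" "Y \<in> C_Lip m" by blast
  then have "X \<in> C_Lip (max n m)" "Y \<in> C_Lip (max n m)" by (auto elim: C_Lip_mono)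
  then show "(\<lambda>x. X x + Y x) \<in> (\<Union>n. C_Lip n)" using C_Lip.add_mem by blast
next
  fix X :: "(nat \<Rightarrow> real) \<Rightarrow> real" and c assume "X \<in> (\<Union>n. C_Lip n)"
  then show "(\<lambda>x. c * X x) \<in> (\<Union>n. C_Lip n)" "(\<lambda>x. \<bar>X x\<bar>) \<in> (\<Union>n. C_Lip n)"
    using C_Lip.scale_mem C_Lip.abs_mem by blast+
qed

lemma measure_eqI_C_Lip:
  fixes M N :: "(nat \<Rightarrow> real) measure"
  assumes M: "prob_space M" "sets M = sets R_seq" and N: "prob_space N" "sets N = sets R_seq"
    and eq: "\<And>n \<phi>. \<phi> \<in> C_Lip n \<Longrightarrow> range \<phi> \<subseteq> {0..1} \<Longrightarrow> integral\<^sup>L M \<phi> = integral\<^sup>L N \<phi>"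
  shows "M = N"
proof (rule measure_eqI)
  show "sets M = sets N" using M N by simp
  fix B assume BM: "B \<in> sets M"
  interpret M: prob_space M by fact
  interpret N: prob_space N by fact
  have B: "B \<in> sets R_seq" "B \<in> sets N" using BM M N by auto
  have app: "L1_approximable (\<Union>n. C_Lip n) M N {x. restrict x UNIV \<in> B}"
  proof (rule cylinder_L1_approximable[OF function_lattice_cylinder _ M.finite_measure_axioms M(2)
        N.finite_measure_axioms N(2) _ B(1)])
    show "\<phi> \<in> borel_measurable R_seq" if "\<phi> \<in> (\<Union>n. C_Lip n)" for \<phi>
      using that by (elim UN_E) (rule C_Lip_measurable)
    show "(\<lambda>x. x i) \<in> (\<Union>n. C_Lip n)" for i
      by (rule UN_I[of "Suc i"]) (simp_all add: C_Lip_coord)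
  qed
  have "restrict x UNIV = x" for x :: "nat \<Rightarrow> real" by (simp add: restrict_def)
  with app have app: "L1_approximable (\<Union>n. C_Lip n) M N B" by simp
  have "\<bar>measure M B - measure N B\<bar> \<le> e" if e: "0 < e" for e
  proof -
    have "0 < e / 2" using e by simp
    with app obtain \<phi> where "\<phi> \<in> (\<Union>n. C_Lip n)" and \<phi>': "range \<phi> \<subseteq> {0..1}"
      "(\<integral>x. \<bar>indicator B x - \<phi> x\<bar> \<partial>M) < e / 2" "(\<integral>x. \<bar>indicator B x - \<phi> x\<bar> \<partial>N) < e / 2"
      unfolding L1_approximable_def by blast
    then obtain n where "\<phi> \<in> C_Lip n" by (elim UN_E)
    note \<phi> = this \<phi>'
    have err: "\<bar>measure K B - integral\<^sup>L K \<phi>\<bar> \<le> (\<integral>x. \<bar>indicator B x - \<phi> x\<bar> \<partial>K)"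
      if K: "prob_space K" "sets K = sets R_seq" for K
    proof -
      interpret K: prob_space K by fact
      have [measurable]: "B \<in> sets K" "\<phi> \<in> borel_measurable K"
        using B K C_Lip_measurable[OF \<phi>(1)] by (auto cong: measurable_cong_sets)
      have "\<bar>\<phi> x\<bar> \<le> 1" for x
      proof -
        have "\<phi> x \<in> {0..1}" using \<phi>(2) by blast
        then show ?thesis by simp
      qed
      then have "integrable K \<phi>" by (intro K.integrable_const_bound[of _ 1] AE_I2) auto
      then have "measure K B - integral\<^sup>L K \<phi> = (\<integral>x. indicator B x - \<phi> x \<partial>K)"
        by (subst Bochner_Integration.integral_diff) (auto simp: K.emeasure_eq_measure)
      then show ?thesis using integral_abs_bound[of K "\<lambda>x. indicator B x - \<phi> x"] by simp
    qed
    show ?thesis using err[OF M] err[OF N] \<phi>(3,4) eq[OF \<phi>(1,2)] by linarith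
  qed
  then have "\<bar>measure M B - measure N B\<bar> \<le> 0" by (rule field_le_epsilon) simp
  then show "emeasure M B = emeasure N B" by (simp add: M.emeasure_eq_measure N.emeasure_eq_measure)
qed

section \<open>Disintegration of laws on a product with the real line\<close>

text \<open>
  The inequality of the integrals over the set where \<open>f\<close> exceeds \<open>g\<close> forces this set to be null.
\<close>

lemma AE_le_of_set_integral_le:
  fixes f g :: "'b \<Rightarrow> ennreal"
  assumes [measurable]: "f \<in> borel_measurable M" "g \<in> borel_measurable M"
    and fin: "(\<integral>\<^sup>+x. g x \<partial>M) < \<infinity>"
    and le: "\<And>B. B \<in> sets M \<Longrightarrow> (\<integral>\<^sup>+x. f x * indicator B x \<partial>M) \<le> (\<integral>\<^sup>+x. g x * indicator B x \<partial>M)"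
  shows "AE x in M. f x \<le> g x"
proof -
  define B where "B = {x \<in> space M. g x < f x}"
  have B[measurable]: "B \<in> sets M" unfolding B_def by measurable
  have finB: "(\<integral>\<^sup>+x. g x * indicator B x \<partial>M) < \<infinity>"
    by (rule le_less_trans[OF nn_integral_mono fin]) (auto split: split_indicator)
  have "(\<integral>\<^sup>+x. f x * indicator B x - g x * indicator B x \<partial>M)
      = (\<integral>\<^sup>+x. f x * indicator B x \<partial>M) - (\<integral>\<^sup>+x. g x * indicator B x \<partial>M)"
    using finB by (intro nn_integral_diff AE_I2) (auto simp: B_def split: split_indicator)
  also have "\<dots> = 0"
    using le[OF B] finB by (intro diff_eq_0_ennreal) (auto simp: less_top elim: le_less_trans)
  finally have "AE x in M. f x * indicator B x - g x * indicator B x = 0"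
    by (subst (asm) nn_integral_0_iff_AE) simp_all
  with AE_space show ?thesis
  proof eventually_elim
    fix x assume x: "x \<in> space M" and 0: "f x * indicator B x - g x * indicator B x = 0"
    show "f x \<le> g x"
      using x ennreal_minus_eq_0[OF 0] by (cases "x \<in> B") (auto simp: B_def)
  qed
qed

text \<open>
  The right-continuous regularisation of a family given at rational arguments. It is monotone and
  right-continuous for every \<open>d\<close>, so these properties of a conditional distribution function never
  depend on an exceptional set.
\<close>

definition rational_inf :: "(real \<Rightarrow> real) \<Rightarrow> real \<Rightarrow> real" where
  "rational_inf d t = (INF q\<in>{q\<in>\<rat>. t < q}. d q)"

context
  fixes d :: "real \<Rightarrow> real"
  assumes d: "\<And>q. 0 \<le> d q" "\<And>q. d q \<le> 1"
begin

lemma rational_inf_bdd: "bdd_below (d ` {q\<in>\<rat>. t < q})"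
  using d by (auto intro!: bdd_belowI[of _ 0])

lemma rational_above: "{q\<in>\<rat>. (t::real) < q} \<noteq> {}"
  using Rats_dense_in_real[of t "t + 1"] by auto

lemma rational_inf_lower: "q \<in> \<rat> \<Longrightarrow> t < q \<Longrightarrow> rational_inf d t \<le> d q"
  unfolding rational_inf_def by (rule cINF_lower[OF rational_inf_bdd]) auto

lemma rational_inf_greatest: "(\<And>q. q \<in> \<rat> \<Longrightarrow> t < q \<Longrightarrow> c \<le> d q) \<Longrightarrow> c \<le> rational_inf d t"
  unfolding rational_inf_def by (rule cINF_greatest[OF rational_above]) auto

lemma rational_inf_nonneg: "0 \<le> rational_inf d t"
  by (rule rational_inf_greatest) (use d in auto)

lemma rational_inf_le_1: "rational_inf d t \<le> 1"
  using Rats_dense_in_real[of t "t + 1"] rational_inf_lower[of _ t] d(2) by (metis less_add_one order_trans)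

lemma rational_inf_mono: "s \<le> t \<Longrightarrow> rational_inf d s \<le> rational_inf d t"
  by (rule rational_inf_greatest) (auto intro: rational_inf_lower)

lemma rational_inf_less: "rational_inf d t < c \<Longrightarrow> \<exists>q\<in>\<rat>. t < q \<and> d q < c"
  using rational_inf_greatest[of t c] by force

lemma rational_inf_right_continuous: "continuous (at_right t) (rational_inf d)"
proof (subst continuous_at_right_real_increasing)
  show "s \<le> t \<Longrightarrow> rational_inf d s \<le> rational_inf d t" for s t by (rule rational_inf_mono)
  show "\<forall>e>0. \<exists>h>0. rational_inf d (t + h) - rational_inf d t < e"
  proof safe
    fix e :: real assume "0 < e"
    then obtain q where q: "q \<in> \<rat>" "t < q" "d q < rational_inf d t + e"
      using rational_inf_less[of t "rational_inf d t + e"] by auto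
    then show "\<exists>h>0. rational_inf d (t + h) - rational_inf d t < e"
      using rational_inf_lower[of q "t + (q - t) / 2"] by (intro exI[of _ "(q - t) / 2"]) (auto simp: field_simps)
  qed
qed

end

text \<open>
  Only the second factor has to be the real line; the first one is an arbitrary measurable space.
  The densities \<open>c t\<close> of the measures \<open>B \<mapsto> J (B \<times> {..t})\<close> with respect to the first marginal are
  conditional distribution functions up to null sets. Their regularisation \<open>F\<close> over rational \<open>t\<close>
  is a genuine distribution function outside of the null set where the limits at infinity fail,
  and there any fixed law may be used instead.
\<close>

theorem disintegration_real:
  fixes J :: "('b \<times> real) measure"
  assumes J: "prob_space J" and sets_J: "sets J = sets (M \<Otimes>\<^sub>M borel)"
  obtains \<kappa> where "\<kappa> \<in> M \<rightarrow>\<^sub>M prob_algebra borel"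
    and "\<And>f. f \<in> borel_measurable (M \<Otimes>\<^sub>M borel) \<Longrightarrow>
           (\<integral>\<^sup>+p. f p \<partial>J) = (\<integral>\<^sup>+p. (\<integral>\<^sup>+y. f (fst p, y) \<partial>\<kappa> (fst p)) \<partial>J)"
proof -
  interpret J: prob_space J by fact
  note [measurable_cong] = sets_J
  have space_J: "space J = space M \<times> UNIV"
    using sets_eq_imp_space_eq[OF sets_J] by (simp add: space_pair_measure)
  define \<nu> where "\<nu> = distr J M fst"
  have [measurable_cong, simp]: "sets \<nu> = sets M" and [simp]: "space \<nu> = space M" by (auto simp: \<nu>_def)
  interpret nu: prob_space \<nu> unfolding \<nu>_def by (rule J.prob_space_distr) measurable
  define D where "D B t = emeasure J (B \<times> {..t})" for B and t :: real
  define N where "N t = distr (density J (indicator (space M \<times> {..t}))) M fst" for t :: real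
  have N: "emeasure (N t) B = D B t" if [measurable]: "B \<in> sets M" for B t
  proof -
    have "emeasure (N t) B = (\<integral>\<^sup>+p. indicator (space M \<times> {..t}) p * indicator (fst -` B \<inter> space J) p \<partial>J)"
      unfolding N_def by (subst emeasure_distr) (simp_all add: emeasure_density)
    also have "\<dots> = (\<integral>\<^sup>+p. indicator (B \<times> {..t}) p \<partial>J)"
      using sets.sets_into_space[OF that]
      by (intro nn_integral_cong) (auto simp: space_J split: split_indicator)
    finally show ?thesis unfolding D_def by simp
  qed
  have sets_N[measurable_cong]: "sets (N t) = sets M" for t by (simp add: N_def)
  have D_le: "D B t \<le> emeasure \<nu> B" if [measurable]: "B \<in> sets M" for B t
    unfolding D_def \<nu>_def using that sets.sets_into_space[OF that]
    by (subst emeasure_distr) (auto intro!: emeasure_mono simp: space_J)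
  define c where "c t = RN_deriv \<nu> (N t)" for t
  have c[measurable]: "c t \<in> borel_measurable M" for t
    unfolding c_def using borel_measurable_RN_deriv[of \<nu> "N t"] by simp
  have c\<nu>: "c t \<in> borel_measurable \<nu>" for t by measurable
  have c_int: "(\<integral>\<^sup>+x. c t x * indicator B x \<partial>\<nu>) = D B t" if [measurable]: "B \<in> sets M" for B t
  proof -
    have "absolutely_continuous \<nu> (N t)"
      unfolding absolutely_continuous_def using D_le[of _ t]
      by (auto simp: null_sets_def N sets_N) (metis le_zero_eq)
    then have "density \<nu> (c t) = N t"
      unfolding c_def by (rule nu.density_RN_deriv) (simp add: sets_N)
    then have "emeasure (density \<nu> (c t)) B = D B t" using N[OF that] by simp
    then show ?thesis by (subst (asm) emeasure_density) auto
  qed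
  have c_fin: "(\<integral>\<^sup>+x. c t x \<partial>\<nu>) < \<infinity>" for t
  proof -
    have "(\<integral>\<^sup>+x. c t x \<partial>\<nu>) = (\<integral>\<^sup>+x. c t x * indicator (space M) x \<partial>\<nu>)"
      by (intro nn_integral_cong) auto
    then show ?thesis using c_int[of "space M" t] by (simp add: D_def less_top[symmetric])
  qed
  have c_mono: "AE x in \<nu>. c s x \<le> c t x" if "s \<le> t" for s t
  proof (rule AE_le_of_set_integral_le)
    fix B assume B: "B \<in> sets \<nu>"
    then have [measurable]: "B \<in> sets M" by simp
    show "(\<integral>\<^sup>+x. c s x * indicator B x \<partial>\<nu>) \<le> (\<integral>\<^sup>+x. c t x * indicator B x \<partial>\<nu>)"
      using B that by (auto simp: c_int D_def intro!: emeasure_mono)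
  qed (rule c\<nu> c_fin)+
  have c_le_1: "AE x in \<nu>. c t x \<le> 1" for t
  proof (rule AE_le_of_set_integral_le)
    fix B assume B: "B \<in> sets \<nu>"
    then show "(\<integral>\<^sup>+x. c t x * indicator B x \<partial>\<nu>) \<le> (\<integral>\<^sup>+x. 1 * indicator B x \<partial>\<nu>)"
      using D_le[of B t] by (simp add: c_int)
  qed (use c\<nu> nu.emeasure_space_1 in simp_all)
  define d where "d x t = enn2real (min 1 (c t x))" for x t
  have d: "0 \<le> d x t" "d x t \<le> 1" for x t
    by (auto simp: d_def intro!: enn2real_leI)
  have [measurable]: "(\<lambda>x. d x t) \<in> borel_measurable M" for t
    unfolding d_def by measurable
  define F where "F x = rational_inf (d x)" for x
  have "countable {q\<in>\<rat>. (t::real) < q}" for t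
    using countable_rat by (rule countable_subset[rotated]) auto
  then have F[measurable]: "(\<lambda>x. F x t) \<in> borel_measurable M" for t
    unfolding F_def rational_inf_def by (intro borel_measurable_cINF_real) measurable
  note F_nonneg = rational_inf_nonneg[of "d x" for x, OF d, folded F_def]
    and F_le_1 = rational_inf_le_1[of "d x" for x, OF d, folded F_def]
    and F_mono = rational_inf_mono[of "d x" for x, OF d, folded F_def]
    and F_cont = rational_inf_right_continuous[of "d x" for x, OF d, folded F_def]
    and F_lower = rational_inf_lower[of "d x" for x, OF d, folded F_def]
    and F_greatest = rational_inf_greatest[of "d x" for x, OF d, folded F_def]
  have AE_d: "AE x in \<nu>. ennreal (d x t) = c t x" for t
    using c_le_1[of t]
  proof eventually_elim
    fix x assume "c t x \<le> 1"
    moreover from this have "c t x < top" using le_less_trans by fastforce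
    ultimately show "ennreal (d x t) = c t x" unfolding d_def by (simp add: min_absorb2)
  qed
  \<comment> \<open>the regularisation lies above \<open>c t\<close> and below \<open>c q\<close> for rational \<open>q > t\<close>; let \<open>q\<close> tend to \<open>t\<close>\<close>
  have F_int: "(\<integral>\<^sup>+x. ennreal (F x t) * indicator B x \<partial>\<nu>) = D B t" if B: "B \<in> sets M" for B t
  proof (rule antisym)
    have [measurable]: "B \<in> sets M" by fact
    have "AE x in \<nu>. \<forall>q\<in>{q\<in>\<rat>. t < q}. c t x \<le> c q x \<and> ennreal (d x q) = c q x"
      using AE_d c_mono[of t]
      by (intro AE_ball_countable'[OF _ \<open>countable {q\<in>\<rat>. t < q}\<close>]) auto
    then have "AE x in \<nu>. c t x \<le> ennreal (F x t)" using AE_d[of t]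
    proof eventually_elim
      fix x assume *: "\<forall>q\<in>{q\<in>\<rat>. t < q}. c t x \<le> c q x \<and> ennreal (d x q) = c q x" "ennreal (d x t) = c t x"
      have "d x t \<le> F x t"
      proof (rule F_greatest)
        fix q assume "q \<in> \<rat>" "t < q"
        with * have "ennreal (d x t) \<le> ennreal (d x q)" by simp
        then show "d x t \<le> d x q" using d by simp
      qed
      with * show "c t x \<le> ennreal (F x t)" by (metis ennreal_leI)
    qed
    then have "(\<integral>\<^sup>+x. c t x * indicator B x \<partial>\<nu>) \<le> (\<integral>\<^sup>+x. ennreal (F x t) * indicator B x \<partial>\<nu>)"
      by (intro nn_integral_mono_AE) (auto split: split_indicator)
    then show "D B t \<le> (\<integral>\<^sup>+x. ennreal (F x t) * indicator B x \<partial>\<nu>)" using c_int[OF B] by simp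
    define u where "u k = t + 1 / real (Suc k)" for k
    have "(\<integral>\<^sup>+x. ennreal (F x t) * indicator B x \<partial>\<nu>) \<le> D B (u k)" for k
    proof -
      obtain q where q: "q \<in> \<rat>" "t < q" "q < u k"
        using Rats_dense_in_real[of t "u k"] by (auto simp: u_def)
      have "AE x in \<nu>. ennreal (F x t) * indicator B x \<le> c q x * indicator B x"
        using AE_d[of q]
      proof eventually_elim
        fix x assume "ennreal (d x q) = c q x"
        with F_lower[OF q(1,2), of x] have "ennreal (F x t) \<le> c q x" by (metis ennreal_leI)
        then show "ennreal (F x t) * indicator B x \<le> c q x * indicator B x" by (rule mult_right_mono) simp
      qed
      then have "(\<integral>\<^sup>+x. ennreal (F x t) * indicator B x \<partial>\<nu>) \<le> (\<integral>\<^sup>+x. c q x * indicator B x \<partial>\<nu>)"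
        by (rule nn_integral_mono_AE)
      also have "\<dots> = D B q" by (rule c_int) fact
      also have "\<dots> \<le> D B (u k)" unfolding D_def using q by (intro emeasure_mono) auto
      finally show ?thesis .
    qed
    moreover have "(\<lambda>k. D B (u k)) \<longlonglongrightarrow> emeasure J (\<Inter>k. B \<times> {..u k})"
      unfolding D_def
    proof (rule Lim_emeasure_decseq)
      show "decseq (\<lambda>k. B \<times> {..u k})"
        by (intro decseq_SucI) (auto simp: u_def intro: order_trans[OF _ add_left_mono[OF divide_left_mono]])
    qed auto
    moreover have "(\<Inter>k. B \<times> {..u k}) = B \<times> {..t}"
    proof -
      have "y \<le> t" if "\<And>k. y \<le> u k" for y
      proof (rule LIMSEQ_le_const[of u t y])
        show "u \<longlonglongrightarrow> t"
          unfolding u_def using tendsto_add[OF tendsto_const[of t] LIMSEQ_inverse_real_of_nat]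
          by (simp add: inverse_eq_divide)
      qed (use that in auto)
      moreover have "t \<le> u k" for k by (simp add: u_def)
      ultimately show ?thesis by (auto intro: order_trans)
    qed
    ultimately show "(\<integral>\<^sup>+x. ennreal (F x t) * indicator B x \<partial>\<nu>) \<le> D B t"
      unfolding D_def by (intro LIMSEQ_le_const) auto
  qed
  have F_int': "(\<integral>\<^sup>+x. ennreal (F x t) \<partial>\<nu>) = D (space M) t" for t
  proof -
    have "(\<integral>\<^sup>+x. ennreal (F x t) \<partial>\<nu>) = (\<integral>\<^sup>+x. ennreal (F x t) * indicator (space M) x \<partial>\<nu>)"
      by (intro nn_integral_cong) auto
    then show ?thesis using F_int[of "space M" t] by simp
  qed
  define good where "good x \<longleftrightarrow> (SUP k::nat. ennreal (F x (real k))) = 1 \<and> (INF k::nat. ennreal (F x (- real k))) = 0" for x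
  have good[measurable]: "Measurable.pred M good" unfolding good_def by measurable
  have AE_good: "AE x in \<nu>. good x"
  proof -
    have D1: "(SUP k::nat. D (space M) (real k)) = 1"
    proof -
      have "(SUP k::nat. D (space M) (real k)) = emeasure J (\<Union>k::nat. space M \<times> {..real k})"
        unfolding D_def by (intro SUP_emeasure_incseq) (auto simp: incseq_def)
      also have "(\<Union>k::nat. space M \<times> {..real k}) = space J"
        using real_arch_simple by (auto simp: space_J)
      finally show ?thesis by (simp add: J.emeasure_space_1)
    qed
    have D0: "(INF k::nat. D (space M) (- real k)) = 0"
    proof -
      have "(INF k::nat. D (space M) (- real k)) = emeasure J (\<Inter>k::nat. space M \<times> {..- real k})"
        unfolding D_def by (intro INF_emeasure_decseq) (auto simp: decseq_def)
      also have "(\<Inter>k::nat. space M \<times> {..- real k}) = {}"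
      proof -
        have "\<exists>k::nat. \<not> y \<le> - real k" for y
          using reals_Archimedean2[of "- y"] by (metis minus_less_iff not_le)
        then show ?thesis by blast
      qed
      finally show ?thesis by simp
    qed
    have "(\<integral>\<^sup>+x. (SUP k::nat. ennreal (F x (real k))) \<partial>\<nu>) = (SUP k::nat. \<integral>\<^sup>+x. ennreal (F x (real k)) \<partial>\<nu>)"
      by (intro nn_integral_monotone_convergence_SUP) (auto simp: incseq_def le_fun_def intro!: ennreal_leI F_mono)
    then have S: "(\<integral>\<^sup>+x. (SUP k::nat. ennreal (F x (real k))) \<partial>\<nu>) = 1" by (simp add: F_int' D1)
    have S1: "(SUP k::nat. ennreal (F x (real k))) \<le> 1" for x
      by (intro SUP_least) (simp add: F_le_1)
    have "(\<integral>\<^sup>+x. 1 - (SUP k::nat. ennreal (F x (real k))) \<partial>\<nu>) = (\<integral>\<^sup>+x. 1 \<partial>\<nu>) - (\<integral>\<^sup>+x. (SUP k::nat. ennreal (F x (real k))) \<partial>\<nu>)"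
      by (intro nn_integral_diff) (auto simp: S S1)
    then have "(\<integral>\<^sup>+x. 1 - (SUP k::nat. ennreal (F x (real k))) \<partial>\<nu>) = 0"
      by (simp add: S nu.emeasure_space_1[simplified])
    then have 1: "AE x in \<nu>. 1 - (SUP k::nat. ennreal (F x (real k))) = 0"
      by (subst (asm) nn_integral_0_iff_AE) auto
    have "(\<integral>\<^sup>+x. (INF k::nat. ennreal (F x (- real k))) \<partial>\<nu>) = (INF k::nat. \<integral>\<^sup>+x. ennreal (F x (- real k)) \<partial>\<nu>)"
    proof (rule nn_integral_monotone_convergence_INF_decseq)
      show "decseq (\<lambda>k x. ennreal (F x (- real k)))"
        by (intro decseq_SucI le_funI ennreal_leI F_mono) simp
      show "(\<integral>\<^sup>+x. ennreal (F x (- real 0)) \<partial>\<nu>) < \<infinity>"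
        by (simp only: F_int') (simp add: D_def less_top[symmetric])
    qed measurable
    then have "(\<integral>\<^sup>+x. (INF k::nat. ennreal (F x (- real k))) \<partial>\<nu>) = 0" by (simp add: F_int' D0)
    then have "AE x in \<nu>. (INF k::nat. ennreal (F x (- real k))) = 0"
      by (subst (asm) nn_integral_0_iff_AE) auto
    with 1 show ?thesis unfolding good_def
    proof eventually_elim
      fix x
      assume *: "1 - (SUP k::nat. ennreal (F x (real k))) = 0" "(INF k::nat. ennreal (F x (- real k))) = 0"
      show "(SUP k::nat. ennreal (F x (real k))) = 1 \<and> (INF k::nat. ennreal (F x (- real k))) = 0"
        by (intro conjI antisym S1 ennreal_minus_eq_0[OF *(1)] *(2))
    qed
  qed
  have F_top: "(F x \<longlongrightarrow> 1) at_top" if "good x" for x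
  proof (rule increasing_tendsto)
    fix l :: real assume "l < 1"
    have "\<exists>k::nat. l < F x (real k)"
    proof (rule ccontr)
      assume "\<not> ?thesis"
      then have "(SUP k::nat. ennreal (F x (real k))) \<le> ennreal l"
        by (intro SUP_least ennreal_leI) (simp add: not_less)
      with that have "1 \<le> ennreal l" unfolding good_def by simp
      with \<open>l < 1\<close> show False by simp
    qed
    then obtain k :: nat where "l < F x (real k)" ..
    then show "eventually (\<lambda>t. l < F x t) at_top"
      unfolding eventually_at_top_linorder using F_mono by (metis order_less_le_trans)
  qed (use F_le_1 in auto)
  have F_bot: "(F x \<longlongrightarrow> 0) at_bot" if "good x" for x
  proof (rule decreasing_tendsto)
    fix l :: real assume "0 < l"
    have "\<exists>k::nat. F x (- real k) < l"
    proof (rule ccontr)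
      assume "\<not> ?thesis"
      then have "ennreal l \<le> (INF k::nat. ennreal (F x (- real k)))"
        by (intro INF_greatest ennreal_leI) (simp add: not_less)
      with that \<open>0 < l\<close> show False unfolding good_def by (simp add: ennreal_eq_0_iff)
    qed
    then obtain k :: nat where "F x (- real k) < l" ..
    then show "eventually (\<lambda>t. F x t < l) at_bot"
      unfolding eventually_at_bot_linorder using F_mono by (metis order_le_less_trans)
  qed (use F_nonneg in auto)
  define \<kappa> where "\<kappa> x = (if good x then interval_measure (F x) else return borel 0)" for x
  have borel_Iic: "sets borel = sigma_sets UNIV (range (\<lambda>a::real. {..a}))"
    by (subst borel_eq_atMost) simp
  have \<kappa>_Iic: "emeasure (\<kappa> x) {..t} = (if good x then ennreal (F x t) else indicator {..t} 0)" for x t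
    unfolding \<kappa>_def
    using emeasure_interval_measure_Iic[of "F x" t, OF F_mono F_cont F_bot] by auto
  have \<kappa>: "\<kappa> \<in> M \<rightarrow>\<^sub>M prob_algebra borel"
  proof (rule measurable_prob_algebra_generated[OF borel_Iic])
    show "Int_stable (range (\<lambda>a::real. {..a}))" by (auto simp: Int_stable_def)
    show "prob_space (\<kappa> x)" for x
      unfolding \<kappa>_def
      using real_distribution_interval_measure[of "F x", OF F_mono F_cont F_bot F_top]
      by (auto simp: real_distribution_def intro!: prob_space_return)
    show "sets (\<kappa> x) = sets borel" for x by (simp add: \<kappa>_def)
    show "(\<lambda>x. emeasure (\<kappa> x) A) \<in> borel_measurable M" if "A \<in> range (\<lambda>a::real. {..a})" for A
      using that by (auto simp: \<kappa>_Iic)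
  qed auto
  then have \<kappa>s[measurable]: "\<kappa> \<in> M \<rightarrow>\<^sub>M subprob_algebra borel" by (rule measurable_prob_algebraD)
  \<comment> \<open>the first marginal and the kernel rebuild \<open>J\<close>, as a comparison on the sets \<open>B \<times> {..t}\<close> shows\<close>
  define J' where "J' = \<nu> \<bind> (\<lambda>x. distr (\<kappa> x) (M \<Otimes>\<^sub>M borel) (Pair x))"
  have K[measurable]: "(\<lambda>x. distr (\<kappa> x) (M \<Otimes>\<^sub>M borel) (Pair x)) \<in> M \<rightarrow>\<^sub>M subprob_algebra (M \<Otimes>\<^sub>M borel)"
    by (rule measurable_distr2) measurable
  then have K\<nu>: "(\<lambda>x. distr (\<kappa> x) (M \<Otimes>\<^sub>M borel) (Pair x)) \<in> \<nu> \<rightarrow>\<^sub>M subprob_algebra (M \<Otimes>\<^sub>M borel)"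
    by (simp cong: measurable_cong_sets)
  have ne: "space \<nu> \<noteq> {}" using nu.not_empty .
  have sets_\<kappa>: "sets (\<kappa> x) = sets borel" "space (\<kappa> x) = UNIV" if "x \<in> space M" for x
    using subprob_measurableD[OF \<kappa>s that] by auto
  have J': "emeasure J' (B \<times> {..t}) = D B t" if [measurable]: "B \<in> sets M" for B t
  proof -
    have "emeasure J' (B \<times> {..t}) = (\<integral>\<^sup>+x. emeasure (distr (\<kappa> x) (M \<Otimes>\<^sub>M borel) (Pair x)) (B \<times> {..t}) \<partial>\<nu>)"
      unfolding J'_def by (rule emeasure_bind[OF ne K\<nu>]) measurable
    also have "\<dots> = (\<integral>\<^sup>+x. ennreal (F x t) * indicator B x \<partial>\<nu>)"
    proof (rule nn_integral_cong_AE)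
      show "AE x in \<nu>. emeasure (distr (\<kappa> x) (M \<Otimes>\<^sub>M borel) (Pair x)) (B \<times> {..t}) = ennreal (F x t) * indicator B x"
        using AE_good AE_space
      proof eventually_elim
        fix x assume x: "good x" "x \<in> space \<nu>"
        then have [measurable]: "Pair x \<in> \<kappa> x \<rightarrow>\<^sub>M M \<Otimes>\<^sub>M borel"
          using sets_\<kappa>[of x] by (simp cong: measurable_cong_sets)
        have "emeasure (distr (\<kappa> x) (M \<Otimes>\<^sub>M borel) (Pair x)) (B \<times> {..t}) = emeasure (\<kappa> x) (Pair x -` (B \<times> {..t}) \<inter> space (\<kappa> x))"
          by (rule emeasure_distr) measurable
        also have "Pair x -` (B \<times> {..t}) \<inter> space (\<kappa> x) = (if x \<in> B then {..t} else {})"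
          using x sets_\<kappa> by auto
        finally show "emeasure (distr (\<kappa> x) (M \<Otimes>\<^sub>M borel) (Pair x)) (B \<times> {..t}) = ennreal (F x t) * indicator B x"
          using x by (simp add: \<kappa>_Iic)
      qed
    qed
    finally show ?thesis by (simp add: F_int)
  qed
  have "J = J'"
  proof (rule measure_eqI_generator_eq_countable)
    let ?E = "{B \<times> C | B C. B \<in> sets M \<and> C \<in> range (\<lambda>a::real. {..a})}"
    have pair: "sets (M \<Otimes>\<^sub>M (borel :: real measure)) = sigma_sets (space M \<times> UNIV) ?E"
    proof -
      have "(\<Union>n::nat. {..real n}) = (UNIV :: real set)" using real_arch_simple by auto
      then have "sets (M \<Otimes>\<^sub>M (borel :: real measure)) = sets (sigma (space M \<times> space (borel::real measure)) ?E)"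
        by (intro sets_pair_eq[where Ca="{space M}" and Cb="range (\<lambda>n::nat. {..real n})"])
           (auto simp: borel_Iic sets.sigma_sets_eq dest: sets.sets_into_space)
      also have "\<dots> = sigma_sets (space M \<times> UNIV) ?E"
        by (subst sets_measure_of) (auto dest: sets.sets_into_space)
      finally show ?thesis .
    qed
    then show "sets J = sigma_sets (space M \<times> UNIV) ?E" using sets_J by simp
    have "sets J' = sets (M \<Otimes>\<^sub>M borel)"
      unfolding J'_def by (rule sets_bind[OF sets_kernel[OF K\<nu>] ne]) 
    then show "sets J' = sigma_sets (space M \<times> UNIV) ?E" using pair by simp
    show "Int_stable ?E"
    proof (rule Int_stableI)
      fix P Q assume "P \<in> ?E" "Q \<in> ?E"
      then obtain B s C t where "P = B \<times> {..s}" "Q = C \<times> {..t}" "B \<in> sets M" "C \<in> sets M" by auto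
      then have "P \<inter> Q = (B \<inter> C) \<times> {..min s t}" "B \<inter> C \<in> sets M" by auto
      then show "P \<inter> Q \<in> ?E" by blast
    qed
    show "?E \<subseteq> Pow (space M \<times> UNIV)" by (auto dest: sets.sets_into_space)
    show "emeasure J P = emeasure J' P" if "P \<in> ?E" for P
      using that J' by (auto simp: D_def)
    show "range (\<lambda>n::nat. space M \<times> {..real n}) \<subseteq> ?E" by auto
    show "\<Union> (range (\<lambda>n::nat. space M \<times> {..real n})) = space M \<times> UNIV"
      using real_arch_simple by auto
    show "emeasure J a \<noteq> \<infinity>" for a by simp
  qed auto
  show thesis
  proof (rule that[OF \<kappa>])
    fix f :: "'b \<times> real \<Rightarrow> ennreal" assume f[measurable]: "f \<in> borel_measurable (M \<Otimes>\<^sub>M borel)"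
    have "(\<integral>\<^sup>+p. f p \<partial>J) = (\<integral>\<^sup>+x. \<integral>\<^sup>+p. f p \<partial>distr (\<kappa> x) (M \<Otimes>\<^sub>M borel) (Pair x) \<partial>\<nu>)"
      unfolding \<open>J = J'\<close> J'_def by (rule nn_integral_bind[OF f K\<nu>])
    also have "\<dots> = (\<integral>\<^sup>+x. \<integral>\<^sup>+y. f (x, y) \<partial>\<kappa> x \<partial>\<nu>)"
    proof (rule nn_integral_cong)
      fix x assume "x \<in> space \<nu>"
      then have [measurable]: "Pair x \<in> \<kappa> x \<rightarrow>\<^sub>M M \<Otimes>\<^sub>M borel"
        using sets_\<kappa>[of x] by (simp cong: measurable_cong_sets)
      show "(\<integral>\<^sup>+p. f p \<partial>distr (\<kappa> x) (M \<Otimes>\<^sub>M borel) (Pair x)) = (\<integral>\<^sup>+y. f (x, y) \<partial>\<kappa> x)"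
        by (rule nn_integral_distr) measurable
    qed
    also have "\<dots> = (\<integral>\<^sup>+p. (\<integral>\<^sup>+y. f (fst p, y) \<partial>\<kappa> (fst p)) \<partial>J)"
      unfolding \<nu>_def
      by (rule nn_integral_distr) (auto intro!: nn_integral_measurable_subprob_algebra2[OF _ \<kappa>s])
    finally show "(\<integral>\<^sup>+p. f p \<partial>J) = (\<integral>\<^sup>+p. (\<integral>\<^sup>+y. f (fst p, y) \<partial>\<kappa> (fst p)) \<partial>J)" .
  qed
qed

section \<open>Integrating out independent variables\<close>

locale regular_iid = regular_sublinear_expectation H E
  for H :: "('a \<Rightarrow> real) set" and E +
  fixes X :: "nat \<Rightarrow> 'a \<Rightarrow> real"
  assumes iid: "iid_sequence H E X"
begin

lemma X_mem: "X i \<in> H"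
  using iid unfolding iid_sequence_def by blast

lemma seq_mem:
  assumes "\<phi> \<in> C_Lip n" shows "(\<lambda>\<omega>. \<phi> (\<lambda>i. X i \<omega>)) \<in> H"
  by (rule Lip_mem[of "Suc n" X \<phi>]) (use C_Lip_mono[OF assms, of "Suc n"] X_mem in auto)

end

lemma C_Lip_section:
  assumes \<phi>: "\<phi> \<in> C_Lip (Suc n)" shows "(\<lambda>t. \<phi> (x(n := t))) \<in> C_Lip_real"
proof -
  obtain L where L: "0 \<le> L" "\<And>x y. \<bar>\<phi> x - \<phi> y\<bar> \<le> L * L2_set (\<lambda>i. x i - y i) {0..<Suc n}"
    by (rule C_LipE[OF \<phi>]) blast
  have "\<bar>\<phi> (x(n := s)) - \<phi> (x(n := t))\<bar> \<le> L * \<bar>s - t\<bar>" for s t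
  proof -
    have "L2_set (\<lambda>i. (x(n := s)) i - (x(n := t)) i) {0..<Suc n} = \<bar>s - t\<bar>"
      by (simp add: L2_set_def)
    with L(2)[of "x(n := s)" "x(n := t)"] show ?thesis by (simp only:)
  qed
  with L(1) show ?thesis unfolding C_Lip_real_iff by blast
qed

lemma bounded_range_realE:
  fixes f :: "'b \<Rightarrow> real"
  assumes "bounded (range f)" obtains B where "0 \<le> B" "\<And>x. \<bar>f x\<bar> \<le> B"
proof -
  obtain B where B: "\<And>x. norm (f x) \<le> B" using assms unfolding bounded_iff by blast
  show thesis
    by (rule that[of "max 0 B"]) (use B in \<open>auto simp: le_max_iff_disj\<close>)
qed

context regular_iid
begin

text \<open>
  The operator that removes the last variable. By independence, a bounded Lipschitz function of the
  first \<open>n + 1\<close> variables has the same expectation as its image under this operator, which depends on the first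
  \<open>n\<close> variables only.
\<close>

definition integrate_out :: "((nat \<Rightarrow> real) \<Rightarrow> real) \<Rightarrow> nat \<Rightarrow> (nat \<Rightarrow> real) \<Rightarrow> real" where
  "integrate_out \<phi> n x = E (\<lambda>\<omega>. \<phi> (x(n := X 0 \<omega>)))"

lemma section_mem:
  assumes "\<phi> \<in> C_Lip (Suc n)" shows "(\<lambda>\<omega>. \<phi> (x(n := X i \<omega>))) \<in> H"
  by (rule Lip_real_mem[OF C_Lip_section[OF assms] X_mem])

lemma integrate_out_bounds:
  assumes \<phi>: "\<phi> \<in> C_Lip (Suc n)" and "\<And>x. a \<le> \<phi> x" "\<And>x. \<phi> x \<le> b"
  shows "a \<le> integrate_out \<phi> n x" "integrate_out \<phi> n x \<le> b"
  using mono[OF section_mem[OF \<phi>] lattice.const_mem] mono[OF lattice.const_mem section_mem[OF \<phi>]] assms(2,3)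
  by (auto simp: integrate_out_def const)

text \<open>
  Changing the frozen variables changes every section by at most \<open>L\<close> times their distance, and
  \<^term>\<open>E\<close> is monotone and commutes with adding constants; so the Lipschitz constant is preserved.
\<close>

lemma integrate_out_bLip:
  assumes \<phi>: "\<phi> \<in> C_bLip (Suc n)" shows "integrate_out \<phi> n \<in> C_bLip n"
proof -
  have \<phi>_Lip: "\<phi> \<in> C_Lip (Suc n)" using \<phi> by (simp add: C_bLip_def)
  obtain B where B: "0 \<le> B" "\<And>x. \<bar>\<phi> x\<bar> \<le> B"
    using \<phi> bounded_range_realE unfolding C_bLip_def by blast
  obtain L where L: "0 \<le> L" "\<And>x y. \<bar>\<phi> x - \<phi> y\<bar> \<le> L * L2_set (\<lambda>i. x i - y i) {0..<Suc n}"
    by (rule C_LipE[OF \<phi>_Lip]) blast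
  have "integrate_out \<phi> n \<in> C_Lip n"
  proof (rule C_LipI[OF L(1)])
    fix x y :: "nat \<Rightarrow> real"
    have "\<phi> (x(n := t)) \<le> \<phi> (y(n := t)) + L * L2_set (\<lambda>i. x i - y i) {0..<n}" for t
    proof -
      have "L2_set (\<lambda>i. (x(n := t)) i - (y(n := t)) i) {0..<Suc n} = L2_set (\<lambda>i. x i - y i) {0..<n}"
        by (simp add: L2_set_def)
      with L(2)[of "x(n := t)" "y(n := t)"] show ?thesis by simp
    qed
    then have "integrate_out \<phi> n x \<le> integrate_out \<phi> n y + L * L2_set (\<lambda>i. x i - y i) {0..<n}"
      unfolding integrate_out_def by (intro E_le_add section_mem \<phi>_Lip)
    then show "integrate_out \<phi> n x - integrate_out \<phi> n y \<le> L * L2_set (\<lambda>i. x i - y i) {0..<n}" by simp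
  qed
  moreover have "-B \<le> \<phi> x \<and> \<phi> x \<le> B" for x using B(2)[of x] by linarith
  then have "\<bar>integrate_out \<phi> n x\<bar> \<le> B" for x
    using integrate_out_bounds[OF \<phi>_Lip, of "-B" B x] by (simp add: abs_le_iff)
  then have "bounded (range (integrate_out \<phi> n))" by (intro boundedI) auto
  ultimately show ?thesis unfolding C_bLip_def by blast
qed

lemma E_section:
  assumes \<phi>: "\<phi> \<in> C_bLip (Suc n)"
  shows "E (\<lambda>\<omega>. \<phi> (x(n := X i \<omega>))) = integrate_out \<phi> n x"
proof -
  have "bounded (range (\<lambda>t. \<phi> (x(n := t))))"
    using \<phi> unfolding C_bLip_def by (auto intro: bounded_subset)
  then have "(\<lambda>t. \<phi> (x(n := t))) \<in> C_bLip_real"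
    using \<phi> C_Lip_section unfolding C_bLip_def C_bLip_real_def by blast
  moreover have "\<forall>f\<in>C_bLip_real. E (\<lambda>\<omega>. f (X i \<omega>)) = E (\<lambda>\<omega>. f (X 0 \<omega>))"
    using iid unfolding iid_sequence_def identically_distributed_def by blast
  ultimately show ?thesis unfolding integrate_out_def by (rule bspec[rotated])
qed

text \<open>
  The first variable is not covered by independence, which starts at the second one. For it the
  inner expectation does not depend on the frozen point.
\<close>

lemma E_integrate_out:
  assumes \<phi>: "\<phi> \<in> C_bLip (Suc n)"
  shows "E (\<lambda>\<omega>. \<phi> (\<lambda>i. X i \<omega>)) = E (\<lambda>\<omega>. integrate_out \<phi> n (\<lambda>i. X i \<omega>))"
proof (cases "n = 0")
  case True
  have \<phi>_Lip: "\<phi> \<in> C_Lip (Suc n)" using \<phi> by (simp add: C_bLip_def)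
  have "\<phi> (x(n := X 0 \<omega>)) = \<phi> (\<lambda>i. X i \<omega>)" for x \<omega>
    by (rule C_Lip_cong[OF \<phi>_Lip]) (simp add: True)
  then show ?thesis by (simp add: integrate_out_def const)
next
  case False
  then have "independent_of_previous E X n" using iid unfolding iid_sequence_def by simp
  then show ?thesis using \<phi> unfolding independent_of_previous_def by (simp add: E_section)
qed

lemma nn_integral_section_le:
  assumes \<nu>: "\<nu> \<in> P_one E (X 0)" and \<phi>: "\<phi> \<in> C_bLip (Suc n)" and "\<And>x. 0 \<le> \<phi> x"
  shows "(\<integral>\<^sup>+y. ennreal (\<phi> (x(n := y))) \<partial>\<nu>) \<le> ennreal (integrate_out \<phi> n x)"
proof -
  have "(\<lambda>t. \<phi> (x(n := t))) \<in> C_Lip_real" using \<phi> by (intro C_Lip_section) (simp add: C_bLip_def)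
  then have "integrable \<nu> (\<lambda>t. \<phi> (x(n := t)))" "(\<integral>t. \<phi> (x(n := t)) \<partial>\<nu>) \<le> integrate_out \<phi> n x"
    using \<nu> unfolding P_one_def integrate_out_def by blast+
  then show ?thesis using assms(3) by (simp add: nn_integral_eq_integral ennreal_leI)
qed

end

section \<open>Laws generated by kernels\<close>

lemma space_R_pow_upd: "x \<in> space (R_pow i) \<Longrightarrow> x(i := y) \<in> space (R_pow (Suc i))"
  by (auto simp: space_PiM PiE_iff extensional_def)

lemma iterated_integral_mono:
  assumes "\<And>z. z \<in> space (R_pow (i + m)) \<Longrightarrow> f z \<le> g z" and "x \<in> space (R_pow i)"
  shows "iterated_integral \<kappa> f m i x \<le> iterated_integral \<kappa> g m i x"
  using assms
proof (induction m arbitrary: i x)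
  case (Suc m)
  have "iterated_integral \<kappa> f m (Suc i) (x(i := y)) \<le> iterated_integral \<kappa> g m (Suc i) (x(i := y))" for y
    by (rule Suc.IH[OF _ space_R_pow_upd[OF Suc.prems(2)]]) (use Suc.prems(1) in simp)
  then show ?case by (simp add: nn_integral_mono)
qed simp

text \<open>
  The iterated integral is defined by splitting off the outermost integral, while independence and
  conditioning act on the innermost one.
\<close>

lemma iterated_integral_last:
  "iterated_integral \<kappa> f (Suc m) i x =
   iterated_integral \<kappa> (\<lambda>z. \<integral>\<^sup>+y. f (z(i + m := y)) \<partial>\<kappa> (i + m) z) m i x"
proof (induction m arbitrary: i x)
  case (Suc m)
  have "iterated_integral \<kappa> f (Suc (Suc m)) i x
      = (\<integral>\<^sup>+y. iterated_integral \<kappa> f (Suc m) (Suc i) (x(i := y)) \<partial>\<kappa> i x)" by (rule iterated_integral.simps)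
  also have "\<dots> = (\<integral>\<^sup>+y. iterated_integral \<kappa>
      (\<lambda>z. \<integral>\<^sup>+y. f (z(Suc i + m := y)) \<partial>\<kappa> (Suc i + m) z) m (Suc i) (x(i := y)) \<partial>\<kappa> i x)"
    by (simp only: Suc.IH)
  finally show ?case by (simp only: iterated_integral.simps add_Suc add_Suc_right)
qed simp

lemma space_R_pow_0: "(\<lambda>_. undefined) \<in> space (R_pow 0)"
  by (simp add: space_PiM)

text \<open>
  The innermost integral, over a kernel in \<^term>\<open>P_one E (X 0)\<close>, is dominated by the integrated out
  function, which is again bounded and Lipschitz. So the induction runs from the last variable to
  the first.
\<close>

lemma (in regular_iid) iterated_integral_le:
  assumes \<kappa>: "\<And>i x. x \<in> space (R_pow i) \<Longrightarrow> \<kappa> i x \<in> P_one E (X 0)"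
    and \<phi>: "\<phi> \<in> C_bLip n" "\<And>x. 0 \<le> \<phi> x"
  shows "iterated_integral \<kappa> (\<lambda>x. ennreal (\<phi> x)) n 0 (\<lambda>_. undefined) \<le> ennreal (E (\<lambda>\<omega>. \<phi> (\<lambda>i. X i \<omega>)))"
  using \<phi>
proof (induction n arbitrary: \<phi>)
  case 0
  have "(\<lambda>\<omega>. \<phi> (\<lambda>i. X i \<omega>)) = (\<lambda>_. \<phi> (\<lambda>_. undefined))"
    using 0 by (intro ext C_Lip_cong[of \<phi> 0]) (auto simp: C_bLip_def)
  then have "E (\<lambda>\<omega>. \<phi> (\<lambda>i. X i \<omega>)) = \<phi> (\<lambda>_. undefined)" by (simp only: const)
  then show ?case by simp
next
  case (Suc n)
  have \<phi>_Lip: "\<phi> \<in> C_Lip (Suc n)" using Suc.prems by (simp add: C_bLip_def)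
  have "0 \<le> integrate_out \<phi> n x" for x
    unfolding integrate_out_def
    using mono[OF section_mem[OF \<phi>_Lip] lattice.const_mem[of 0]] Suc.prems(2) by (simp add: const)
  then have IH: "iterated_integral \<kappa> (\<lambda>x. ennreal (integrate_out \<phi> n x)) n 0 (\<lambda>_. undefined)
      \<le> ennreal (E (\<lambda>\<omega>. integrate_out \<phi> n (\<lambda>i. X i \<omega>)))"
    by (rule Suc.IH[OF integrate_out_bLip[OF Suc.prems(1)]])
  have "iterated_integral \<kappa> (\<lambda>x. ennreal (\<phi> x)) (Suc n) 0 (\<lambda>_. undefined)
      = iterated_integral \<kappa> (\<lambda>z. \<integral>\<^sup>+y. ennreal (\<phi> (z(0 + n := y))) \<partial>\<kappa> (0 + n) z) n 0 (\<lambda>_. undefined)"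
    by (rule iterated_integral_last)
  also have "\<dots> \<le> iterated_integral \<kappa> (\<lambda>x. ennreal (integrate_out \<phi> n x)) n 0 (\<lambda>_. undefined)"
    by (rule iterated_integral_mono[OF _ space_R_pow_0])
       (simp only: add_0, rule nn_integral_section_le[OF \<kappa> Suc.prems])
  finally show ?case using IH E_integrate_out[OF Suc.prems(1)] by simp
qed

lemma (in Ionescu_Tulcea) nn_integral_C_iterated:
  fixes f :: "(nat \<Rightarrow> 'a) \<Rightarrow> ennreal"
  assumes "f \<in> borel_measurable (PiM {0..<Suc m} M)" and x: "x \<in> space (PiM {0..<0} M)"
  shows "(\<integral>\<^sup>+z. f z \<partial>C 0 (Suc m) x) = (\<integral>\<^sup>+z. \<integral>\<^sup>+y. f (z(m := y)) \<partial>P m z \<partial>C 0 m x)"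
proof -
  have "(\<integral>\<^sup>+z. f z \<partial>C 0 (Suc m) x) = (\<integral>\<^sup>+z. \<integral>\<^sup>+w. f w \<partial>eP m z \<partial>C 0 m x)"
    using assms measurable_eP[of m] sets_C[OF x, of m]
    by (simp add: nn_integral_bind[where B="PiM {0..<Suc m} M"] cong: measurable_cong_sets)
  also have "\<dots> = (\<integral>\<^sup>+z. \<integral>\<^sup>+y. f (z(m := y)) \<partial>P m z \<partial>C 0 m x)"
    using assms by (intro nn_integral_cong nn_integral_eP) (auto simp: space_C)
  finally show ?thesis .
qed

lemma measurable_initial_segment:
  assumes "sets P = sets R_seq" shows "(\<lambda>x. restrict x {0..<n}) \<in> P \<rightarrow>\<^sub>M R_pow n"
proof -
  have "(\<lambda>x. restrict x {0..<n}) \<in> R_seq \<rightarrow>\<^sub>M R_pow n" by (rule measurable_restrict_subset) simp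
  then show ?thesis using measurable_cong_sets[OF assms refl] by blast
qed

text \<open>
  Prescribing the measure of cylinders determines the integrals of all non-negative functions of
  finitely many coordinates: the kernels generate a measure on the finite product, whose integrals
  are the iterated ones, and it agrees with the image of \<open>P\<close> on all measurable sets.
\<close>

lemma nn_integral_iterated_integral:
  fixes \<kappa> :: "nat \<Rightarrow> (nat \<Rightarrow> real) \<Rightarrow> real measure"
  assumes P_sets: "sets P = sets R_seq"
    and \<kappa>: "\<And>i. \<kappa> i \<in> R_pow i \<rightarrow>\<^sub>M prob_algebra borel"
    and cyl: "\<And>A. A \<in> sets (R_pow n) \<Longrightarrow>
      emeasure P (prod_emb UNIV (\<lambda>_. borel) {0..<n} A) = iterated_integral \<kappa> (indicator A) n 0 (\<lambda>_. undefined)"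
    and f: "f \<in> borel_measurable (R_pow n)"
  shows "(\<integral>\<^sup>+x. f (restrict x {0..<n}) \<partial>P) = iterated_integral \<kappa> f n 0 (\<lambda>_. undefined)"
proof -
  let ?u = "\<lambda>_. undefined :: real"
  interpret Ionescu_Tulcea \<kappa> "\<lambda>_. borel"
  proof (rule Ionescu_Tulcea.intro, goal_cases)
    case (1 i) show ?case by (rule measurable_prob_algebraD[OF \<kappa>])
  next
    case (2 i x) then show ?case using measurable_space[OF \<kappa>] by (simp add: space_prob_algebra)
  qed
  have C_iter: "(\<integral>\<^sup>+z. h z \<partial>C 0 m ?u) = iterated_integral \<kappa> h m 0 ?u"
    if "h \<in> borel_measurable (R_pow m)" for h m
    using that
  proof (induction m arbitrary: h)
    case 0
    then show ?case by (simp add: nn_integral_return space_R_pow_0)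
  next
    case (Suc m)
    have "(\<lambda>(z, y). h (z(m := y))) \<in> borel_measurable (R_pow m \<Otimes>\<^sub>M borel)"
      unfolding split_beta
      by (rule measurable_compose[OF _ Suc.prems], rule measurable_fun_upd[where J="{0..<m}"]) auto
    then have "(\<lambda>z. \<integral>\<^sup>+y. h (z(m := y)) \<partial>\<kappa> m z) \<in> borel_measurable (R_pow m)"
      by (rule nn_integral_measurable_subprob_algebra2[OF _ P])
    from Suc.IH[OF this] show ?case
      using nn_integral_C_iterated[OF Suc.prems space_R_pow_0] iterated_integral_last[of \<kappa> h m 0 ?u]
      by (simp only: add_0)
  qed
  have restr: "(\<lambda>x. restrict x {0..<n}) \<in> P \<rightarrow>\<^sub>M R_pow n"
    by (rule measurable_initial_segment[OF P_sets])
  have space_P: "space P = UNIV" using sets_eq_imp_space_eq[OF P_sets] by (simp add: space_PiM)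
  have "distr P (R_pow n) (\<lambda>x. restrict x {0..<n}) = C 0 n ?u"
  proof (rule measure_eqI)
    show "sets (distr P (R_pow n) (\<lambda>x. restrict x {0..<n})) = sets (C 0 n ?u)"
      using sets_C[OF space_R_pow_0, of n] by simp
    fix A assume "A \<in> sets (distr P (R_pow n) (\<lambda>x. restrict x {0..<n}))"
    then have A: "A \<in> sets (R_pow n)" by simp
    have "emeasure (distr P (R_pow n) (\<lambda>x. restrict x {0..<n})) A = emeasure P (prod_emb UNIV (\<lambda>_. borel) {0..<n} A)"
      using A by (simp add: emeasure_distr[OF restr] prod_emb_def space_P)
    also have "\<dots> = (\<integral>\<^sup>+z. indicator A z \<partial>C 0 n ?u)" using A by (simp only: cyl C_iter[of "indicator A"] borel_measurable_indicator)
    also have "\<dots> = emeasure (C 0 n ?u) A" using A sets_C[OF space_R_pow_0, of n] by simp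
    finally show "emeasure (distr P (R_pow n) (\<lambda>x. restrict x {0..<n})) A = emeasure (C 0 n ?u) A" .
  qed
  moreover have "(\<integral>\<^sup>+x. f (restrict x {0..<n}) \<partial>P) = (\<integral>\<^sup>+z. f z \<partial>distr P (R_pow n) (\<lambda>x. restrict x {0..<n}))"
    by (subst nn_integral_distr[OF restr]) (simp_all add: f)
  ultimately show ?thesis using C_iter[OF f] by (simp only:)
qed

context regular_iid
begin

text \<open>
  Adding a constant reduces bounded test functions to non-negative ones, and truncation reduces
  arbitrary test functions to bounded ones.
\<close>

lemma Q_maxI:
  assumes \<mu>: "prob_space \<mu>" "sets \<mu> = sets R_seq"
    and le: "\<And>n \<phi>. n \<ge> 1 \<Longrightarrow> \<phi> \<in> C_bLip n \<Longrightarrow> (\<And>x. 0 \<le> \<phi> x) \<Longrightarrow>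
      (\<integral>\<^sup>+x. ennreal (\<phi> x) \<partial>\<mu>) \<le> ennreal (E (\<lambda>\<omega>. \<phi> (\<lambda>i. X i \<omega>)))"
  shows "\<mu> \<in> Q_max E X"
proof -
  interpret prob_space \<mu> by fact
  have meas: "\<phi> \<in> borel_measurable \<mu>" if "\<phi> \<in> C_Lip n" for \<phi> n
    using C_Lip_measurable[OF that] \<mu>(2) by (simp cong: measurable_cong_sets)
  have bdd: "(\<integral>x. \<phi> x \<partial>\<mu>) \<le> E (\<lambda>\<omega>. \<phi> (\<lambda>i. X i \<omega>))" if n: "n \<ge> 1" and \<phi>: "\<phi> \<in> C_bLip n" for \<phi> n
  proof -
    have \<phi>_Lip: "\<phi> \<in> C_Lip n" using \<phi> by (simp add: C_bLip_def)
    obtain B where B: "0 \<le> B" "\<And>x. \<bar>\<phi> x\<bar> \<le> B"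
      using \<phi> bounded_range_realE unfolding C_bLip_def by blast
    have pos: "0 \<le> \<phi> x + B" for x using B(2)[of x] by linarith
    have "\<bar>\<phi> x + B\<bar> \<le> 2 * B" for x using B(2)[of x] by linarith
    then have "bounded (range (\<lambda>x. \<phi> x + B))" by (intro boundedI) auto
    then have sh: "(\<lambda>x. \<phi> x + B) \<in> C_bLip n"
      unfolding C_bLip_def using C_Lip.add_mem[OF \<phi>_Lip C_Lip.const_mem] by blast
    have int: "integrable \<mu> \<phi>"
      by (rule integrable_const_bound[of _ B]) (use B meas[OF \<phi>_Lip] in auto)
    have "ennreal (\<integral>x. \<phi> x + B \<partial>\<mu>) = (\<integral>\<^sup>+x. ennreal (\<phi> x + B) \<partial>\<mu>)"
      using int pos by (intro nn_integral_eq_integral[symmetric]) auto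
    also have "\<dots> \<le> ennreal (E (\<lambda>\<omega>. \<phi> (\<lambda>i. X i \<omega>) + B))" by (rule le[OF n sh pos])
    finally have "(\<integral>x. \<phi> x + B \<partial>\<mu>) \<le> E (\<lambda>\<omega>. \<phi> (\<lambda>i. X i \<omega>) + B)"
      using mono[OF add_mem[OF seq_mem[OF \<phi>_Lip] lattice.const_mem[of B]] lattice.const_mem[of 0]] pos
      by (simp add: const ennreal_le_iff)
    then show ?thesis
      using int by (simp add: E_translate[OF seq_mem[OF \<phi>_Lip]] prob_space)
  qed
  have "integrable \<mu> \<phi> \<and> integral\<^sup>L \<mu> \<phi> \<le> E (\<lambda>\<omega>. \<phi> (\<lambda>i. X i \<omega>))" if n: "n \<ge> 1" and \<phi>: "\<phi> \<in> C_Lip n" for \<phi> n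
    using bdd[OF n C_bLip_truncate[OF \<phi>]] bdd[OF n C_bLip_truncate[OF C_Lip.abs_mem[OF \<phi>]]]
    by (intro dominated_by_truncations \<mu>(1) meas[OF \<phi>] seq_mem[OF \<phi>])
  with \<mu> show ?thesis unfolding Q_max_def by blast
qed

theorem P_kernel_subset_Q_max: "P_kernel E (X 0) \<subseteq> Q_max E X"
proof
  fix P assume "P \<in> P_kernel E (X 0)"
  then obtain \<kappa> where P: "prob_space P" "sets P = sets R_seq"
    and \<kappa>: "\<And>i x. x \<in> space (R_pow i) \<Longrightarrow> \<kappa> i x \<in> P_one E (X 0)"
    and \<kappa>_meas: "\<And>i B. B \<in> sets borel \<Longrightarrow> (\<lambda>x. measure (\<kappa> i x) B) \<in> borel_measurable (R_pow i)"
    and cyl: "\<And>n A. n \<ge> 1 \<Longrightarrow> A \<in> sets (R_pow n) \<Longrightarrow>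
      emeasure P (prod_emb UNIV (\<lambda>_. borel) {0..<n} A) = iterated_integral \<kappa> (indicator A) n 0 (\<lambda>_. undefined)"
    unfolding P_kernel_def by blast
  have \<kappa>_prob: "prob_space (\<kappa> i x)" "sets (\<kappa> i x) = sets borel" if "x \<in> space (R_pow i)" for i x
    using \<kappa>[OF that] unfolding P_one_def by blast+
  have \<kappa>_alg: "\<kappa> i \<in> R_pow i \<rightarrow>\<^sub>M prob_algebra borel" for i
  proof (rule measurable_prob_algebra_generated[where \<Omega>=UNIV and G="sets borel"])
    show "sets (borel :: real measure) = sigma_sets UNIV (sets borel)"
      using sets.sigma_sets_eq[of "borel :: real measure"] by simp
    fix B :: "real set" assume B: "B \<in> sets borel"
    have "(\<lambda>x. ennreal (measure (\<kappa> i x) B)) \<in> borel_measurable (R_pow i)" using \<kappa>_meas[OF B] by simp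
    also have "?this \<longleftrightarrow> (\<lambda>x. emeasure (\<kappa> i x) B) \<in> borel_measurable (R_pow i)"
      by (intro measurable_cong finite_measure.emeasure_eq_measure[symmetric] prob_space.finite_measure \<kappa>_prob)
    finally show "(\<lambda>x. emeasure (\<kappa> i x) B) \<in> borel_measurable (R_pow i)" .
  qed (auto simp: \<kappa>_prob Int_stable_def)
  show "P \<in> Q_max E X"
  proof (rule Q_maxI[OF P])
    fix n :: nat and \<phi> assume n: "n \<ge> 1" and \<phi>: "\<phi> \<in> C_bLip n" "\<And>x. 0 \<le> \<phi> x"
    have \<phi>_Lip: "\<phi> \<in> C_Lip n" using \<phi> by (simp add: C_bLip_def)
    have "(\<integral>\<^sup>+x. ennreal (\<phi> x) \<partial>P) = (\<integral>\<^sup>+x. ennreal (\<phi> (restrict x {0..<n})) \<partial>P)"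
      by (intro nn_integral_cong arg_cong[where f=ennreal] C_Lip_cong[OF \<phi>_Lip]) simp
    also have "\<dots> = iterated_integral \<kappa> (\<lambda>x. ennreal (\<phi> x)) n 0 (\<lambda>_. undefined)"
      using C_Lip_measurable_R_pow[OF \<phi>_Lip]
      by (intro nn_integral_iterated_integral[OF P(2) \<kappa>_alg cyl[OF n]]) simp_all
    also have "\<dots> \<le> ennreal (E (\<lambda>\<omega>. \<phi> (\<lambda>i. X i \<omega>)))" by (rule iterated_integral_le[OF \<kappa> \<phi>])
    finally show "(\<integral>\<^sup>+x. ennreal (\<phi> x) \<partial>P) \<le> ennreal (E (\<lambda>\<omega>. \<phi> (\<lambda>i. X i \<omega>)))" .
  qed
qed

end

section \<open>A countable family of Lipschitz test functions\<close>

text \<open>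
  Minima of finitely many cones with slope \<open>L\<close>, with rational apexes \<open>(r, q)\<close>, cut off at \<open>K\<close> and
  \<open>- K\<close>. They form a countable family, and a function with Lipschitz constant \<open>L\<close> that is bounded by
  \<open>K\<close> is the infimum of all these cones with apex on or above its graph.
\<close>

definition cone_test :: "nat \<Rightarrow> nat \<Rightarrow> (rat \<times> rat) set \<Rightarrow> real \<Rightarrow> real" where
  "cone_test K L P t =
     max (- real K) (Min (insert (real K) ((\<lambda>(r, q). of_rat q + real L * \<bar>t - of_rat r\<bar>) ` P)))"

lemma cone_test_bound: "finite P \<Longrightarrow> \<bar>cone_test K L P t\<bar> \<le> real K"
  unfolding cone_test_def by (auto simp: abs_le_iff)

lemma cone_test_bLip:
  assumes "finite P" shows "cone_test K L P \<in> C_bLip_real"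
proof -
  have cone: "(\<lambda>t. of_rat q + real L * \<bar>t - of_rat r\<bar>) \<in> C_Lip_real" for q r
    unfolding C_Lip_real_iff
  proof (intro exI[of _ "real L"] conjI allI)
    fix s t :: real
    have "\<bar>of_rat q + real L * \<bar>s - of_rat r\<bar> - (of_rat q + real L * \<bar>t - of_rat r\<bar>)\<bar>
        = real L * \<bar>\<bar>s - of_rat r\<bar> - \<bar>t - of_rat r\<bar>\<bar>"
      by (simp add: abs_mult right_diff_distrib[symmetric])
    also have "\<dots> \<le> real L * \<bar>s - t\<bar>" by (intro mult_left_mono) auto
    finally show "\<bar>of_rat q + real L * \<bar>s - of_rat r\<bar> - (of_rat q + real L * \<bar>t - of_rat r\<bar>)\<bar> \<le> real L * \<bar>s - t\<bar>" .
  qed simp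
  have "(\<lambda>t. Min (insert (real K) ((\<lambda>(r, q). of_rat q + real L * \<bar>t - of_rat r\<bar>) ` P))) \<in> C_Lip_real"
    using assms
  proof (induction P rule: finite_induct)
    case empty then show ?case by (simp add: C_Lip_real.const_mem)
  next
    case (insert p P)
    obtain r q where p: "p = (r, q)" by (cases p)
    have eq: "(\<lambda>t. Min (insert (real K) ((\<lambda>(r, q). of_rat q + real L * \<bar>t - of_rat r\<bar>) ` insert p P)))
        = (\<lambda>t. min (of_rat q + real L * \<bar>t - of_rat r\<bar>)
              (Min (insert (real K) ((\<lambda>(r, q). of_rat q + real L * \<bar>t - of_rat r\<bar>) ` P))))"
      using insert.hyps by (simp only: p image_insert prod.case insert_commute[of "real K"]) simp
    show ?case unfolding eq by (rule C_Lip_real.min_mem[OF cone insert.IH])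
  qed
  then have "cone_test K L P \<in> C_Lip_real"
    unfolding cone_test_def[abs_def] by (rule C_Lip_real.max_mem[OF C_Lip_real.const_mem])
  moreover have "bounded (range (cone_test K L P))"
    by (rule boundedI[of _ "real K"]) (use cone_test_bound[OF assms] in auto)
  ultimately show ?thesis unfolding C_bLip_real_def by blast
qed

text \<open>
  Adding the rational apexes above the graph one after the other gives a decreasing sequence. Its
  limit at \<open>t\<close> is \<open>\<phi> t\<close>, as there are apexes arbitrarily close to the point \<open>(t, \<phi> t)\<close>.
\<close>

lemma cone_test_upper_envelope:
  assumes \<phi>: "\<And>s t. \<bar>\<phi> s - \<phi> t\<bar> \<le> real L * \<bar>s - t\<bar>" and K: "\<And>t. \<bar>\<phi> t\<bar> \<le> real K"
  defines "P k \<equiv> {p \<in> from_nat ` {..<k::nat}. \<phi> (of_rat (fst p)) \<le> of_rat (snd p)}"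
  shows "decseq (\<lambda>k. cone_test K L (P k) t)" and "(\<lambda>k. cone_test K L (P k) t) \<longlonglongrightarrow> \<phi> t"
    and "\<phi> t \<le> cone_test K L (P k) t"
proof -
  have fin: "finite (P k)" for k by (simp add: P_def)
  have Pm: "P k \<subseteq> P m" if "k \<le> m" for k m using that by (auto simp: P_def)
  have lower: "\<phi> t \<le> cone_test K L (P k) t" for k
  proof -
    have "\<phi> t \<le> of_rat q + real L * \<bar>t - of_rat r\<bar>" if "(r, q) \<in> P k" for r q
    proof -
      have "\<phi> (of_rat r) \<le> of_rat q" using that by (simp add: P_def)
      with \<phi>[of t "of_rat r"] show ?thesis by linarith
    qed
    moreover have "\<phi> t \<le> real K" using K[of t] by simp
    ultimately have "\<phi> t \<le> Min (insert (real K) ((\<lambda>(r, q). of_rat q + real L * \<bar>t - of_rat r\<bar>) ` P k))"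
      using fin by auto
    then show ?thesis unfolding cone_test_def by (simp add: le_max_iff_disj)
  qed
  then show "\<phi> t \<le> cone_test K L (P k) t" .
  show "decseq (\<lambda>k. cone_test K L (P k) t)"
  proof (rule decseq_SucI)
    fix k
    let ?V = "\<lambda>k. insert (real K) ((\<lambda>(r, q). of_rat q + real L * \<bar>t - of_rat r\<bar>) ` P k)"
    have "?V k \<subseteq> ?V (Suc k)" by (rule Set.insert_mono[OF image_mono[OF Pm]]) simp
    then have "Min (?V (Suc k)) \<le> Min (?V k)" by (rule Min_antimono) (simp_all add: fin)
    then show "cone_test K L (P (Suc k)) t \<le> cone_test K L (P k) t"
      unfolding cone_test_def by (rule max.mono[OF order_refl])
  qed
  show "(\<lambda>k. cone_test K L (P k) t) \<longlonglongrightarrow> \<phi> t"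
  proof (rule LIMSEQ_I)
    fix e :: real assume e: "0 < e"
    \<comment> \<open>the apex is taken within distance \<open>d\<close> of \<open>t\<close>, where \<open>\<phi>\<close> and the cone vary by less than \<open>e / 4\<close> each\<close>
    define d where "d = e / (4 * (real L + 1))"
    have d: "0 < d" "real L * d < e / 4" using e by (auto simp: d_def field_simps)
    obtain r where r: "r \<in> \<rat>" "t < r" "r < t + d" using Rats_dense_in_real[of t "t + d"] d by auto
    obtain r' where r': "r = of_rat r'" using r(1) by (rule Rats_cases)
    obtain q where q: "q \<in> \<rat>" "\<phi> r < q" "q < \<phi> r + e / 4"
      using Rats_dense_in_real[of "\<phi> r" "\<phi> r + e / 4"] e by auto
    obtain q' where q': "q = of_rat q'" using q(1) by (rule Rats_cases)
    obtain N where N: "from_nat N = (r', q')" using surj_from_nat by (metis surjD)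
    have "\<bar>cone_test K L (P k) t - \<phi> t\<bar> < e" if "Suc N \<le> k" for k
    proof -
      have "(r', q') \<in> P k" using that N q r' q' by (auto simp: P_def intro!: image_eqI[of _ _ N])
      then have mem: "of_rat q' + real L * \<bar>t - of_rat r'\<bar>
          \<in> insert (real K) ((\<lambda>(r, q). of_rat q + real L * \<bar>t - of_rat r\<bar>) ` P k)"
        by (auto intro!: image_eqI[of _ _ "(r', q')"])
      have "Min (insert (real K) ((\<lambda>(r, q). of_rat q + real L * \<bar>t - of_rat r\<bar>) ` P k))
          \<le> of_rat q' + real L * \<bar>t - of_rat r'\<bar>"
        using mem fin by (intro Min_le) auto
      also have "\<dots> = q + real L * \<bar>t - r\<bar>" by (simp add: r' q')
      also have "\<dots> \<le> q + real L * d" using r by (intro add_left_mono mult_left_mono) auto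
      also have "\<dots> < \<phi> t + e"
      proof -
        have "\<phi> r - \<phi> t \<le> real L * \<bar>r - t\<bar>" using \<phi>[of r t] by simp
        also have "\<dots> \<le> real L * d" using r by (intro mult_left_mono) auto
        finally show ?thesis using q d by linarith
      qed
      finally have "Min (insert (real K) ((\<lambda>(r, q). of_rat q + real L * \<bar>t - of_rat r\<bar>) ` P k)) < \<phi> t + e" .
      moreover have "- real K < \<phi> t + e" using K[of t] e by linarith
      ultimately have "cone_test K L (P k) t < \<phi> t + e" unfolding cone_test_def by simp
      with lower[of k] show ?thesis by simp
    qed
    then show "\<exists>no. \<forall>k\<ge>no. norm (cone_test K L (P k) t - \<phi> t) < e"
      by (intro exI[of _ "Suc N"]) simp
  qed
qed

lemma C_Lip_real_nat_const:
  assumes "f \<in> C_Lip_real" obtains L :: nat where "\<And>s t. \<bar>f s - f t\<bar> \<le> real L * \<bar>s - t\<bar>"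
proof -
  obtain L where L: "0 \<le> L" "\<And>s t. \<bar>f s - f t\<bar> \<le> L * \<bar>s - t\<bar>"
    using assms unfolding C_Lip_real_iff by blast
  obtain N :: nat where "L \<le> real N" using real_arch_simple by blast
  then have "L * \<bar>s - t\<bar> \<le> real N * \<bar>s - t\<bar>" for s t by (intro mult_right_mono) auto
  with L(2) that[of N] show thesis by (meson order_trans)
qed

text \<open>
  Countably many test functions decide membership, because \<^term>\<open>E\<close> is continuous along the
  decreasing sequences of cone functions. This makes it possible to obtain membership for almost
  all conditional laws at once.
\<close>

lemma (in regular_iid) P_oneI:
  assumes \<nu>: "prob_space \<nu>" "sets \<nu> = sets borel"
    and test: "\<And>K L ps. (\<integral>t. cone_test K L (set ps) t \<partial>\<nu>) \<le> E (\<lambda>\<omega>. cone_test K L (set ps) (X 0 \<omega>))"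
  shows "\<nu> \<in> P_one E (X 0)"
proof -
  interpret prob_space \<nu> by fact
  have meas: "f \<in> borel_measurable \<nu>" if "f \<in> C_Lip_real" for f
    using C_Lip_real_measurable[OF that] \<nu>(2) by (simp cong: measurable_cong_sets)
  have bdd: "integral\<^sup>L \<nu> f \<le> E (\<lambda>\<omega>. f (X 0 \<omega>))" if f: "f \<in> C_Lip_real" and K: "\<And>t. \<bar>f t\<bar> \<le> real K" for f K
  proof -
    obtain L :: nat where L: "\<And>s t. \<bar>f s - f t\<bar> \<le> real L * \<bar>s - t\<bar>" using C_Lip_real_nat_const[OF f] by blast
    define P :: "nat \<Rightarrow> (rat \<times> rat) set"
      where "P k = {p \<in> from_nat ` {..<k}. f (of_rat (fst p)) \<le> of_rat (snd p)}" for k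
    note env = cone_test_upper_envelope[OF L K, folded P_def]
    have fin: "finite (P k)" for k by (simp add: P_def)
    have cL: "cone_test K L (P k) \<in> C_Lip_real" for k
      using cone_test_bLip[OF fin] unfolding C_bLip_real_def by blast
    have le: "integral\<^sup>L \<nu> f \<le> E (\<lambda>\<omega>. cone_test K L (P k) (X 0 \<omega>))" for k
    proof -
      obtain ps where ps: "P k = set ps" using finite_list[OF fin] by metis
      have "integral\<^sup>L \<nu> f \<le> (\<integral>t. cone_test K L (P k) t \<partial>\<nu>)"
      proof (rule integral_mono)
        show "integrable \<nu> f" using K by (intro integrable_const_bound[of _ "real K"] AE_I2 meas[OF f]) simp
        show "integrable \<nu> (cone_test K L (P k))"
          using cone_test_bound[OF fin] by (intro integrable_const_bound[of _ "real K"] AE_I2 meas[OF cL]) simp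
        show "f t \<le> cone_test K L (P k) t" for t by (rule env(3))
      qed
      also have "\<dots> \<le> E (\<lambda>\<omega>. cone_test K L (P k) (X 0 \<omega>))" unfolding ps by (rule test)
      finally show ?thesis .
    qed
    have "(\<lambda>k. E (\<lambda>\<omega>. cone_test K L (P k) (X 0 \<omega>))) \<longlonglongrightarrow> E (\<lambda>\<omega>. f (X 0 \<omega>))"
    proof (rule E_decseq)
      show "(\<lambda>\<omega>. cone_test K L (P k) (X 0 \<omega>)) \<in> H" for k by (rule Lip_real_mem[OF cL X_mem])
      show "(\<lambda>\<omega>. f (X 0 \<omega>)) \<in> H" by (rule Lip_real_mem[OF f X_mem])
    qed (rule env(1) env(2))+
    then show ?thesis by (rule LIMSEQ_le_const) (use le in blast)
  qed
  have "integrable \<nu> f \<and> integral\<^sup>L \<nu> f \<le> E (\<lambda>\<omega>. f (X 0 \<omega>))" if f: "f \<in> C_Lip_real" for f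
  proof (rule dominated_by_truncations[OF \<nu>(1) meas[OF f] Lip_real_mem[OF f X_mem]])
    have tr: "(\<lambda>t. truncate k (g t)) \<in> C_Lip_real" if g: "g \<in> C_Lip_real" for g k
    proof -
      obtain M :: nat where M: "\<And>s t. \<bar>truncate k s - truncate k t\<bar> \<le> real M * \<bar>s - t\<bar>"
        using C_Lip_real_nat_const[OF C_Lip_real_truncate] by blast
      obtain L :: nat where L: "\<And>s t. \<bar>g s - g t\<bar> \<le> real L * \<bar>s - t\<bar>"
        using C_Lip_real_nat_const[OF g] by blast
      have "\<bar>truncate k (g s) - truncate k (g t)\<bar> \<le> (real M * real L) * \<bar>s - t\<bar>" for s t
        using order_trans[OF M mult_left_mono[OF L]] by (simp add: mult.assoc)
      then show ?thesis unfolding C_Lip_real_iff by (intro exI[of _ "real M * real L"]) simp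
    qed
    show "(\<integral>t. truncate k (f t) \<partial>\<nu>) \<le> E (\<lambda>\<omega>. truncate k (f (X 0 \<omega>)))" for k
      by (rule bdd[OF tr[OF f]]) (rule truncate_bound)
    show "(\<integral>t. truncate k \<bar>f t\<bar> \<partial>\<nu>) \<le> E (\<lambda>\<omega>. truncate k \<bar>f (X 0 \<omega>)\<bar>)" for k
      by (rule bdd[OF tr[OF C_Lip_real.abs_mem[OF f]]]) (rule truncate_bound)
  qed
  with \<nu> show ?thesis unfolding P_one_def by blast
qed

section \<open>Conditional laws of dominated measures\<close>

context regular_iid
begin

lemma Q_maxD:
  assumes "\<mu> \<in> Q_max E X"
  shows "prob_space \<mu>" "sets \<mu> = sets R_seq"
    and "\<phi> \<in> C_Lip n \<Longrightarrow> integrable \<mu> \<phi>"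
    and "\<phi> \<in> C_Lip n \<Longrightarrow> integral\<^sup>L \<mu> \<phi> \<le> E (\<lambda>\<omega>. \<phi> (\<lambda>i. X i \<omega>))"
proof -
  show "prob_space \<mu>" "sets \<mu> = sets R_seq" using assms unfolding Q_max_def by blast+
  assume "\<phi> \<in> C_Lip n"
  then have "\<phi> \<in> C_Lip (Suc n)" by (rule C_Lip_mono) simp
  then show "integrable \<mu> \<phi>" "integral\<^sup>L \<mu> \<phi> \<le> E (\<lambda>\<omega>. \<phi> (\<lambda>i. X i \<omega>))"
    using assms unfolding Q_max_def by auto
qed

text \<open>
  With \<open>c = E (f (X 0))\<close>, integrating out the last variable of \<open>\<psi> (f (x n) - c)\<close> gives
  \<open>\<psi> \<cdot> (E (f (X 0)) - c) = 0\<close>. Positive homogeneity is used at a frozen point, so \<open>\<psi>\<close> must not be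
  negative.
\<close>

lemma weighted_next_coordinate_le:
  assumes \<mu>: "\<mu> \<in> Q_max E X" and f: "f \<in> C_bLip_real" and \<psi>: "\<psi> \<in> C_Lip n" "range \<psi> \<subseteq> {0..1}"
  shows "(\<integral>x. \<psi> x * (f (x n) - E (\<lambda>\<omega>. f (X 0 \<omega>))) \<partial>\<mu>) \<le> 0"
proof -
  define c where "c = E (\<lambda>\<omega>. f (X 0 \<omega>))"
  define h where "h = (\<lambda>x :: nat \<Rightarrow> real. f (x n) - c)"
  have f_Lip: "f \<in> C_Lip_real" using f by (simp add: C_bLip_real_def)
  have fX: "(\<lambda>\<omega>. f (X 0 \<omega>)) \<in> H" by (rule Lip_real_mem[OF f_Lip X_mem])
  obtain B where B: "0 \<le> B" "\<And>t. \<bar>f t\<bar> \<le> B" using f bounded_range_realE unfolding C_bLip_real_def by blast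
  have h_Lip: "h \<in> C_Lip (Suc n)"
    unfolding h_def by (intro C_Lip.diff_mem C_Lip.const_mem C_Lip_comp[OF f_Lip C_Lip_coord]) simp
  have h_bound: "\<bar>h x\<bar> \<le> B + \<bar>c\<bar> + 1" for x using B(2)[of "x n"] unfolding h_def by linarith
  have \<psi>01: "0 \<le> \<psi> x" "\<psi> x \<le> 1" for x using \<psi>(2) by (auto simp: image_subset_iff)
  have \<psi>_bound: "\<bar>\<psi> x\<bar> \<le> B + \<bar>c\<bar> + 1" for x using \<psi>01[of x] B(1) by simp
  have g_Lip: "(\<lambda>x. \<psi> x * h x) \<in> C_Lip (Suc n)"
    using \<psi>_bound h_bound by (intro C_Lip_mult[OF C_Lip_mono[OF \<psi>(1)] h_Lip]) auto
  have "\<bar>\<psi> x * h x\<bar> \<le> 1 * (B + \<bar>c\<bar> + 1)" for x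
    unfolding abs_mult using \<psi>01[of x] h_bound[of x] by (intro mult_mono) auto
  then have "bounded (range (\<lambda>x. \<psi> x * h x))" by (intro boundedI[of _ "B + \<bar>c\<bar> + 1"]) auto
  with g_Lip have g: "(\<lambda>x. \<psi> x * h x) \<in> C_bLip (Suc n)" unfolding C_bLip_def by blast
  have out: "integrate_out (\<lambda>x. \<psi> x * h x) n x = 0" for x
  proof -
    have "\<psi> (x(n := t)) = \<psi> x" for t by (rule C_Lip_cong[OF \<psi>(1)]) simp
    then have "integrate_out (\<lambda>x. \<psi> x * h x) n x = E (\<lambda>\<omega>. \<psi> x * (f (X 0 \<omega>) + - c))"
      by (simp add: integrate_out_def h_def)
    also have "\<dots> = \<psi> x * E (\<lambda>\<omega>. f (X 0 \<omega>) + - c)"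
      by (rule pos_homog[OF add_mem[OF fX lattice.const_mem] \<psi>01(1)])
    also have "E (\<lambda>\<omega>. f (X 0 \<omega>) + - c) = 0"
      using E_translate[OF fX, of "-c"] by (simp add: c_def)
    finally show ?thesis by simp
  qed
  have "(\<integral>x. \<psi> x * h x \<partial>\<mu>) \<le> E (\<lambda>\<omega>. \<psi> (\<lambda>i. X i \<omega>) * h (\<lambda>i. X i \<omega>))"
    by (rule Q_maxD(4)[OF \<mu> g_Lip])
  also have "\<dots> = 0" using E_integrate_out[OF g] by (simp add: out const)
  finally show ?thesis by (simp add: h_def c_def)
qed

text \<open>
  Weights are approximated in \<open>L\<^sup>1\<close>: the Lipschitz weights of the previous lemma yield indicators of
  arbitrary Borel sets. In other words, the conditional expectation of \<open>f (x n)\<close> given the past is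
  at most \<open>E (f (X 0))\<close>.
\<close>

lemma next_coordinate_on_cylinder_le:
  assumes \<mu>: "\<mu> \<in> Q_max E X" and f: "f \<in> C_bLip_real" and B: "B \<in> sets (R_pow n)"
  shows "(\<integral>x. indicator B (restrict x {0..<n}) * (f (x n) - E (\<lambda>\<omega>. f (X 0 \<omega>))) \<partial>\<mu>) \<le> 0"
proof (rule field_le_epsilon)
  fix e :: real assume e: "0 < e"
  interpret prob_space \<mu> by (rule Q_maxD(1)[OF \<mu>])
  note sets_\<mu> = Q_maxD(2)[OF \<mu>]
  define h where "h = (\<lambda>x :: nat \<Rightarrow> real. f (x n) - E (\<lambda>\<omega>. f (X 0 \<omega>)))"
  have f_Lip: "f \<in> C_Lip_real" using f by (simp add: C_bLip_real_def)
  obtain D where D: "0 \<le> D" "\<And>t. \<bar>f t\<bar> \<le> D" using f bounded_range_realE unfolding C_bLip_real_def by blast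
  \<comment> \<open>the summand 1 keeps \<open>C\<close> positive, since the approximation error \<open>e / C\<close> divides by it\<close>
  define C where "C = D + \<bar>E (\<lambda>\<omega>. f (X 0 \<omega>))\<bar> + 1"
  have C: "0 < C" "\<bar>h x\<bar> \<le> C" for x using D(1) D(2)[of "x n"] unfolding h_def C_def by linarith+
  have h_Lip: "h \<in> C_Lip (Suc n)"
    unfolding h_def by (intro C_Lip.diff_mem C_Lip.const_mem C_Lip_comp[OF f_Lip C_Lip_coord]) simp
  have [measurable]: "h \<in> borel_measurable \<mu>" using Q_maxD(3)[OF \<mu> h_Lip] by simp
  let ?B = "{x. restrict x {0..<n} \<in> B}"
  have "L1_approximable (C_Lip n) \<mu> \<mu> ?B"
    by (rule cylinder_L1_approximable[OF function_lattice_C_Lip C_Lip_measurable finite_measure_axioms sets_\<mu>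
          finite_measure_axioms sets_\<mu> C_Lip_coord B]) simp_all
  moreover have "0 < e / C" using e C(1) by simp
  ultimately obtain \<psi> where \<psi>: "\<psi> \<in> C_Lip n" "range \<psi> \<subseteq> {0..1}"
    "(\<integral>x. \<bar>indicator ?B x - \<psi> x\<bar> \<partial>\<mu>) < e / C" and B_sets: "?B \<in> sets \<mu>"
    unfolding L1_approximable_def by blast
  have [measurable]: "\<psi> \<in> borel_measurable \<mu>" using Q_maxD(3)[OF \<mu> \<psi>(1)] by simp
  note [measurable] = B_sets
  have err_int: "integrable \<mu> (\<lambda>x. \<bar>indicator ?B x - \<psi> x\<bar>)"
    by (rule integrable_indicator_error[OF finite_measure_axioms _ \<psi>(2) B_sets]) measurable
  have ih: "integrable \<mu> (\<lambda>x. \<psi> x * h x)"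
  proof (rule integrable_const_bound[of _ C])
    show "AE x in \<mu>. norm (\<psi> x * h x) \<le> C"
    proof (rule AE_I2)
      fix x
      have "\<psi> x \<in> {0..1}" using \<psi>(2) by blast
      then have "\<bar>\<psi> x\<bar> * \<bar>h x\<bar> \<le> 1 * C" using C by (intro mult_mono) auto
      then show "norm (\<psi> x * h x) \<le> C" by (simp add: abs_mult)
    qed
  qed measurable
  have "(\<integral>x. indicator ?B x * h x \<partial>\<mu>) \<le> (\<integral>x. C * \<bar>indicator ?B x - \<psi> x\<bar> + \<psi> x * h x \<partial>\<mu>)"
  proof (rule integral_mono)
    show "integrable \<mu> (\<lambda>x. C * \<bar>indicator ?B x - \<psi> x\<bar> + \<psi> x * h x)"
      using err_int ih by simp
    show "integrable \<mu> (\<lambda>x. indicator ?B x * h x)"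
    proof (rule integrable_const_bound[of _ C])
      have "\<bar>indicator ?B x * h x\<bar> \<le> C" for x
        using C(1) C(2)[of x] by (auto simp: indicator_def)
      then show "AE x in \<mu>. norm (indicator ?B x * h x) \<le> C" by simp
    qed measurable
    fix x
    have "indicator ?B x * h x - \<psi> x * h x \<le> \<bar>indicator ?B x - \<psi> x\<bar> * \<bar>h x\<bar>"
      by (metis abs_ge_self abs_mult left_diff_distrib)
    also have "\<dots> \<le> \<bar>indicator ?B x - \<psi> x\<bar> * C" using C(2) by (intro mult_left_mono) auto
    finally show "indicator ?B x * h x \<le> C * \<bar>indicator ?B x - \<psi> x\<bar> + \<psi> x * h x"
      by (simp add: mult.commute)
  qed
  also have "\<dots> = C * (\<integral>x. \<bar>indicator ?B x - \<psi> x\<bar> \<partial>\<mu>) + (\<integral>x. \<psi> x * h x \<partial>\<mu>)"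
    using err_int ih by simp
  also have "\<dots> \<le> C * (e / C) + 0"
    using weighted_next_coordinate_le[OF \<mu> f \<psi>(1,2)] \<psi>(3) C(1)
    by (intro add_mono mult_left_mono) (auto simp: h_def)
  also have "\<dots> = 0 + e" using C(1) by simp
  finally show "(\<integral>x. indicator B (restrict x {0..<n}) * (f (x n) - E (\<lambda>\<omega>. f (X 0 \<omega>))) \<partial>\<mu>) \<le> 0 + e"
    by (simp add: h_def indicator_def)
qed

text \<open>
  The conditional laws satisfy each inequality of the countable test family almost surely, hence
  almost all of them belong to \<^term>\<open>P_one E (X 0)\<close>. On the exceptional set they are replaced by one
  fixed good conditional law \<open>\<kappa> z0\<close>, which does not affect integrals.
\<close>

lemma conditional_kernel:
  assumes \<mu>: "\<mu> \<in> Q_max E X"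
  shows "\<exists>\<kappa>. \<kappa> \<in> R_pow n \<rightarrow>\<^sub>M prob_algebra borel \<and> (\<forall>x\<in>space (R_pow n). \<kappa> x \<in> P_one E (X 0)) \<and>
    (\<forall>f\<in>borel_measurable (R_pow (Suc n)). (\<integral>\<^sup>+x. f (restrict x {0..<Suc n}) \<partial>\<mu>)
       = (\<integral>\<^sup>+x. (\<integral>\<^sup>+y. f ((restrict x {0..<n})(n := y)) \<partial>\<kappa> (restrict x {0..<n})) \<partial>\<mu>))"
proof -
  interpret prob_space \<mu> by (rule Q_maxD(1)[OF \<mu>])
  note sets_\<mu> = Q_maxD(2)[OF \<mu>]
  have res[measurable]: "(\<lambda>x. restrict x {0..<n}) \<in> \<mu> \<rightarrow>\<^sub>M R_pow n"
    by (rule measurable_initial_segment[OF sets_\<mu>])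
  have coord[measurable]: "(\<lambda>x. x n) \<in> borel_measurable \<mu>"
    using Q_maxD(3)[OF \<mu> C_Lip_coord[of n "Suc n"]] by simp
  define T where "T = (\<lambda>x :: nat \<Rightarrow> real. (restrict x {0..<n}, x n))"
  have T[measurable]: "T \<in> \<mu> \<rightarrow>\<^sub>M R_pow n \<Otimes>\<^sub>M borel" unfolding T_def by measurable
  define J where "J = distr \<mu> (R_pow n \<Otimes>\<^sub>M borel) T"
  have J: "prob_space J" "sets J = sets (R_pow n \<Otimes>\<^sub>M borel)"
    unfolding J_def by (auto intro: prob_space_distr)
  obtain \<kappa> where \<kappa>: "\<kappa> \<in> R_pow n \<rightarrow>\<^sub>M prob_algebra borel"
    and dis: "\<And>f. f \<in> borel_measurable (R_pow n \<Otimes>\<^sub>M borel) \<Longrightarrow>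
           (\<integral>\<^sup>+p. f p \<partial>J) = (\<integral>\<^sup>+p. (\<integral>\<^sup>+y. f (fst p, y) \<partial>\<kappa> (fst p)) \<partial>J)"
    by (rule disintegration_real[OF J]) (rule that; assumption)
  note \<kappa>s = measurable_prob_algebraD[OF \<kappa>]
  have inner: "(\<lambda>z. \<integral>\<^sup>+y. f (z, y) \<partial>\<kappa> z) \<in> borel_measurable (R_pow n)"
    if "f \<in> borel_measurable (R_pow n \<Otimes>\<^sub>M borel)" for f
    by (rule nn_integral_measurable_subprob_algebra2[OF _ \<kappa>s]) (use that in simp)
  have dis\<mu>: "(\<integral>\<^sup>+x. f (restrict x {0..<n}, x n) \<partial>\<mu>)
      = (\<integral>\<^sup>+x. (\<integral>\<^sup>+y. f (restrict x {0..<n}, y) \<partial>\<kappa> (restrict x {0..<n})) \<partial>\<mu>)"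
    if f: "f \<in> borel_measurable (R_pow n \<Otimes>\<^sub>M borel)" for f
  proof -
    have "(\<lambda>p. \<integral>\<^sup>+y. f (fst p, y) \<partial>\<kappa> (fst p)) \<in> borel_measurable (R_pow n \<Otimes>\<^sub>M borel)"
      by (rule measurable_compose[OF measurable_fst inner[OF f]])
    note inner_f = this
    have "(\<integral>\<^sup>+p. g p \<partial>J) = (\<integral>\<^sup>+x. g (restrict x {0..<n}, x n) \<partial>\<mu>)"
      if "g \<in> borel_measurable (R_pow n \<Otimes>\<^sub>M borel)" for g
      unfolding J_def by (subst nn_integral_distr[OF T]) (simp_all add: that T_def)
    from this[OF f] this[OF inner_f] show ?thesis using dis[OF f] by simp
  qed
  define \<nu> where "\<nu> = distr \<mu> (R_pow n) (\<lambda>x. restrict x {0..<n})"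
  have [simp]: "sets \<nu> = sets (R_pow n)" "space \<nu> = space (R_pow n)" by (simp_all add: \<nu>_def)
  have \<nu>_prob: "prob_space \<nu>" unfolding \<nu>_def by (rule prob_space_distr[OF res])
  let ?c = "\<lambda>K L ps. E (\<lambda>\<omega>. cone_test K L (set ps) (X 0 \<omega>))"
  \<comment> \<open>adding \<open>K\<close> makes the tests non-negative, so that they can be integrated in \<open>[0, \<infinity>]\<close>\<close>
  define good where "good z \<longleftrightarrow> (\<forall>K L ps. (\<integral>\<^sup>+y. ennreal (cone_test K L (set ps) y + real K) \<partial>\<kappa> z)
      \<le> ennreal (?c K L ps + real K))" for z
  have test_Lip: "cone_test K L (set ps) \<in> C_Lip_real" for K L ps
    using cone_test_bLip[of "set ps" K L] by (simp add: C_bLip_real_def)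
  have test_meas[measurable]: "cone_test K L (set ps) \<in> borel_measurable borel" for K L ps
    by (rule C_Lip_real_measurable[OF test_Lip])
  have test_int_meas: "(\<lambda>z. \<integral>\<^sup>+y. ennreal (cone_test K L (set ps) y + real K) \<partial>\<kappa> z) \<in> borel_measurable (R_pow n)"
    for K L ps
    using inner[of "\<lambda>(z, y). ennreal (cone_test K L (set ps) y + real K)"] by simp
  have "AE z in \<nu>. (\<integral>\<^sup>+y. ennreal (cone_test K L (set ps) y + real K) \<partial>\<kappa> z) \<le> ennreal (?c K L ps + real K)"
    for K L ps
  proof (rule AE_le_of_set_integral_le)
    let ?f = "cone_test K L (set ps)" and ?c = "?c K L ps"
    have f: "?f \<in> C_bLip_real" and f_Lip: "?f \<in> C_Lip_real"
      using cone_test_bLip[of "set ps" K L] by (simp_all add: C_bLip_real_def)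
    have fb: "\<bar>?f t\<bar> \<le> real K" for t by (rule cone_test_bound) simp
    have f0: "0 \<le> ?f t + real K" for t using fb[of t] by linarith
    have c0: "0 \<le> ?c + real K"
    proof -
      have "E (\<lambda>_. - real K) \<le> ?c"
        by (rule mono[OF Lip_real_mem[OF f_Lip X_mem] lattice.const_mem]) (use fb in \<open>simp add: abs_le_iff minus_le_iff\<close>)
      then show ?thesis by (simp add: const)
    qed
    show "(\<lambda>z. \<integral>\<^sup>+y. ennreal (?f y + real K) \<partial>\<kappa> z) \<in> borel_measurable \<nu>"
      using test_int_meas by (simp add: \<nu>_def)
    show "(\<integral>\<^sup>+z. ennreal (?c + real K) \<partial>\<nu>) < \<infinity>"
      using prob_space.emeasure_space_1[OF \<nu>_prob] by simp
    fix B assume "B \<in> sets \<nu>"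
    then have B[measurable]: "B \<in> sets (R_pow n)" by simp
    have ind: "integrable \<mu> (\<lambda>x. indicator B (restrict x {0..<n}) :: real)"
      by (rule integrable_const_bound[of _ 1]) (auto simp: indicator_def)
    have ind_f: "integrable \<mu> (\<lambda>x. indicator B (restrict x {0..<n}) * (?f (x n) - ?c))"
    proof (rule integrable_const_bound[of _ "real K + \<bar>?c\<bar>"])
      have "\<bar>indicator B (restrict x {0..<n}) * (?f (x n) - ?c)\<bar> \<le> real K + \<bar>?c\<bar>" for x
        using fb[of "x n"] by (auto simp: indicator_def)
      then show "AE x in \<mu>. norm (indicator B (restrict x {0..<n}) * (?f (x n) - ?c)) \<le> real K + \<bar>?c\<bar>"
        by simp
    qed measurable
    have eq: "indicator B (restrict x {0..<n}) * (?f (x n) + real K)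
        = indicator B (restrict x {0..<n}) * (?f (x n) - ?c) + indicator B (restrict x {0..<n}) * (?c + real K)" for x
      by (simp add: algebra_simps)
    have "(\<integral>\<^sup>+z. (\<integral>\<^sup>+y. ennreal (?f y + real K) \<partial>\<kappa> z) * indicator B z \<partial>\<nu>)
        = (\<integral>\<^sup>+x. (\<integral>\<^sup>+y. ennreal (?f y + real K) * indicator B (restrict x {0..<n}) \<partial>\<kappa> (restrict x {0..<n})) \<partial>\<mu>)"
    proof -
      have "(\<integral>\<^sup>+z. (\<integral>\<^sup>+y. ennreal (?f y + real K) \<partial>\<kappa> z) * indicator B z \<partial>\<nu>)
          = (\<integral>\<^sup>+z. (\<integral>\<^sup>+y. ennreal (?f y + real K) * indicator B z \<partial>\<kappa> z) \<partial>\<nu>)"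
      proof (rule nn_integral_cong)
        fix z
        show "(\<integral>\<^sup>+y. ennreal (?f y + real K) \<partial>\<kappa> z) * indicator B z = (\<integral>\<^sup>+y. ennreal (?f y + real K) * indicator B z \<partial>\<kappa> z)"
          by (cases "z \<in> B") simp_all
      qed
      also have "\<dots> = (\<integral>\<^sup>+x. (\<integral>\<^sup>+y. ennreal (?f y + real K) * indicator B (restrict x {0..<n}) \<partial>\<kappa> (restrict x {0..<n})) \<partial>\<mu>)"
        unfolding \<nu>_def
        using inner[of "\<lambda>(z, y). ennreal (?f y + real K) * indicator B z"]
        by (intro nn_integral_distr[OF res]) simp
      finally show ?thesis .
    qed
    also have "\<dots> = (\<integral>\<^sup>+x. ennreal (?f (x n) + real K) * indicator B (restrict x {0..<n}) \<partial>\<mu>)"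
      using dis\<mu>[of "\<lambda>(z, y). ennreal (?f y + real K) * indicator B z"] by simp
    also have "\<dots> = (\<integral>\<^sup>+x. ennreal (indicator B (restrict x {0..<n}) * (?f (x n) + real K)) \<partial>\<mu>)"
      by (intro nn_integral_cong) (auto simp: indicator_def)
    also have "\<dots> = ennreal (\<integral>x. indicator B (restrict x {0..<n}) * (?f (x n) + real K) \<partial>\<mu>)"
    proof (rule nn_integral_eq_integral)
      show "integrable \<mu> (\<lambda>x. indicator B (restrict x {0..<n}) * (?f (x n) + real K))"
        unfolding eq by (rule Bochner_Integration.integrable_add[OF ind_f integrable_mult_left]) (rule ind)
    qed (use f0 in simp)
    also have "\<dots> \<le> ennreal (\<integral>x. indicator B (restrict x {0..<n}) * (?c + real K) \<partial>\<mu>)"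
      unfolding eq using next_coordinate_on_cylinder_le[OF \<mu> f B] ind ind_f
      by (intro ennreal_leI) simp
    also have "\<dots> = (\<integral>\<^sup>+x. ennreal (indicator B (restrict x {0..<n}) * (?c + real K)) \<partial>\<mu>)"
      using ind c0 by (intro nn_integral_eq_integral[symmetric] AE_I2) auto
    also have "\<dots> = (\<integral>\<^sup>+x. ennreal (?c + real K) * indicator B (restrict x {0..<n}) \<partial>\<mu>)"
      by (intro nn_integral_cong) (auto simp: indicator_def)
    also have "\<dots> = (\<integral>\<^sup>+z. ennreal (?c + real K) * indicator B z \<partial>\<nu>)"
      unfolding \<nu>_def by (rule nn_integral_distr[OF res, symmetric]) measurable
    finally show "(\<integral>\<^sup>+z. (\<integral>\<^sup>+y. ennreal (?f y + real K) \<partial>\<kappa> z) * indicator B z \<partial>\<nu>)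
        \<le> (\<integral>\<^sup>+z. ennreal (?c + real K) * indicator B z \<partial>\<nu>)" .
  qed simp
  then have AE_good: "AE z in \<nu>. good z" unfolding good_def by (simp add: AE_all_countable)
  have good_meas[measurable]: "Measurable.pred (R_pow n) good"
    unfolding good_def using test_int_meas by measurable
  have good_P_one: "\<kappa> z \<in> P_one E (X 0)" if z: "z \<in> space (R_pow n)" "good z" for z
  proof (rule P_oneI)
    have \<kappa>z: "prob_space (\<kappa> z)" "sets (\<kappa> z) = sets borel"
      using measurable_space[OF \<kappa> z(1)] by (simp_all add: space_prob_algebra)
    then show "prob_space (\<kappa> z)" "sets (\<kappa> z) = sets borel" by auto
    interpret kz: prob_space "\<kappa> z" by fact
    fix K L and ps :: "(rat \<times> rat) list"
    have fb: "\<bar>cone_test K L (set ps) t\<bar> \<le> real K" for t by (rule cone_test_bound) simp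
    have f0: "0 \<le> cone_test K L (set ps) t + real K" for t using fb[of t] by linarith
    have int: "integrable (\<kappa> z) (cone_test K L (set ps))"
      using fb test_meas \<kappa>z(2) by (intro kz.integrable_const_bound[of _ "real K"]) (auto cong: measurable_cong_sets)
    have "ennreal (\<integral>t. cone_test K L (set ps) t + real K \<partial>\<kappa> z) = (\<integral>\<^sup>+y. ennreal (cone_test K L (set ps) y + real K) \<partial>\<kappa> z)"
      using int f0 by (intro nn_integral_eq_integral[symmetric]) auto
    also have "\<dots> \<le> ennreal (?c K L ps + real K)" using z(2) unfolding good_def by blast
    finally have "(\<integral>t. cone_test K L (set ps) t + real K \<partial>\<kappa> z) \<le> ?c K L ps + real K"
    proof (rule ennreal_le_iff[THEN iffD1, rotated])
      have "E (\<lambda>_. - real K) \<le> ?c K L ps"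
        by (rule mono[OF Lip_real_mem[OF test_Lip X_mem] lattice.const_mem])
          (use fb in \<open>simp add: abs_le_iff minus_le_iff\<close>)
      then show "0 \<le> ?c K L ps + real K" by (simp add: const)
    qed
    then show "(\<integral>t. cone_test K L (set ps) t \<partial>\<kappa> z) \<le> ?c K L ps" using int by (simp add: kz.prob_space)
  qed
  have "\<exists>z\<in>space (R_pow n). good z"
  proof (rule ccontr)
    assume "\<not> ?thesis"
    with AE_good AE_space have "AE z in \<nu>. False" by (auto elim: eventually_elim2)
    then show False using prob_space.AE_False[OF \<nu>_prob] by simp
  qed
  then obtain z0 where z0: "z0 \<in> space (R_pow n)" "good z0" by blast
  define \<kappa>' where "\<kappa>' z = (if good z then \<kappa> z else \<kappa> z0)" for z
  have "\<kappa> z0 \<in> space (prob_algebra borel)" using measurable_space[OF \<kappa> z0(1)] .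
  then have "\<kappa>' \<in> R_pow n \<rightarrow>\<^sub>M prob_algebra borel"
    unfolding \<kappa>'_def using \<kappa> by measurable
  moreover have "\<forall>z\<in>space (R_pow n). \<kappa>' z \<in> P_one E (X 0)"
    using good_P_one z0 by (simp add: \<kappa>'_def)
  moreover have "(\<integral>\<^sup>+x. f (restrict x {0..<Suc n}) \<partial>\<mu>)
       = (\<integral>\<^sup>+x. (\<integral>\<^sup>+y. f ((restrict x {0..<n})(n := y)) \<partial>\<kappa>' (restrict x {0..<n})) \<partial>\<mu>)"
    if f: "f \<in> borel_measurable (R_pow (Suc n))" for f
  proof -
    have "(\<lambda>p. (fst p)(n := snd p)) \<in> R_pow n \<Otimes>\<^sub>M borel \<rightarrow>\<^sub>M R_pow (Suc n)"
      by (rule measurable_fun_upd[where J="{0..<n}"]) auto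
    then have g: "(\<lambda>p. f ((fst p)(n := snd p))) \<in> borel_measurable (R_pow n \<Otimes>\<^sub>M borel)"
      by (rule measurable_compose[OF _ f])
    have "restrict x {0..<Suc n} = (restrict x {0..<n})(n := x n)" for x :: "nat \<Rightarrow> real"
      by (auto simp: fun_eq_iff restrict_def)
    then have "(\<integral>\<^sup>+x. f (restrict x {0..<Suc n}) \<partial>\<mu>) = (\<integral>\<^sup>+x. f ((restrict x {0..<n})(n := x n)) \<partial>\<mu>)"
      by (simp only:)
    also have "\<dots> = (\<integral>\<^sup>+x. (\<integral>\<^sup>+y. f ((restrict x {0..<n})(n := y)) \<partial>\<kappa> (restrict x {0..<n})) \<partial>\<mu>)"
      using dis\<mu>[OF g] by (simp only: fst_conv snd_conv)
    also have "\<dots> = (\<integral>\<^sup>+x. (\<integral>\<^sup>+y. f ((restrict x {0..<n})(n := y)) \<partial>\<kappa>' (restrict x {0..<n})) \<partial>\<mu>)"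
    proof (rule nn_integral_cong_AE)
      have "AE x in \<mu>. good (restrict x {0..<n})" using AE_good unfolding \<nu>_def by (rule AE_distrD[OF res])
      then show "AE x in \<mu>. (\<integral>\<^sup>+y. f ((restrict x {0..<n})(n := y)) \<partial>\<kappa> (restrict x {0..<n}))
          = (\<integral>\<^sup>+y. f ((restrict x {0..<n})(n := y)) \<partial>\<kappa>' (restrict x {0..<n}))"
        by eventually_elim (simp add: \<kappa>'_def)
    qed
    finally show ?thesis .
  qed
  ultimately show ?thesis by blast
qed

text \<open>
  The conditional kernels of all coordinates together reproduce the measure of cylinders, by
  induction on the number of coordinates and with the last one integrated first.
\<close>

theorem Q_max_subset_P_kernel: "Q_max E X \<subseteq> P_kernel E (X 0)"
proof
  fix \<mu> assume \<mu>: "\<mu> \<in> Q_max E X"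
  interpret prob_space \<mu> by (rule Q_maxD(1)[OF \<mu>])
  note sets_\<mu> = Q_maxD(2)[OF \<mu>]
  have space_\<mu>: "space \<mu> = UNIV" using sigma_space_R_seq[OF sets_\<mu>] .
  have "\<forall>n. \<exists>\<kappa>. \<kappa> \<in> R_pow n \<rightarrow>\<^sub>M prob_algebra borel \<and> (\<forall>x\<in>space (R_pow n). \<kappa> x \<in> P_one E (X 0)) \<and>
    (\<forall>f\<in>borel_measurable (R_pow (Suc n)). (\<integral>\<^sup>+x. f (restrict x {0..<Suc n}) \<partial>\<mu>)
       = (\<integral>\<^sup>+x. (\<integral>\<^sup>+y. f ((restrict x {0..<n})(n := y)) \<partial>\<kappa> (restrict x {0..<n})) \<partial>\<mu>))"
    using conditional_kernel[OF \<mu>] by blast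
  from choice[OF this] obtain \<kappa> where \<kappa>: "\<And>n. \<kappa> n \<in> R_pow n \<rightarrow>\<^sub>M prob_algebra borel"
    and \<kappa>_P: "\<And>n x. x \<in> space (R_pow n) \<Longrightarrow> \<kappa> n x \<in> P_one E (X 0)"
    and step: "\<And>n f. f \<in> borel_measurable (R_pow (Suc n)) \<Longrightarrow> (\<integral>\<^sup>+x. f (restrict x {0..<Suc n}) \<partial>\<mu>)
       = (\<integral>\<^sup>+x. (\<integral>\<^sup>+y. f ((restrict x {0..<n})(n := y)) \<partial>\<kappa> n (restrict x {0..<n})) \<partial>\<mu>)"
    by blast
  have iter: "(\<integral>\<^sup>+x. f (restrict x {0..<n}) \<partial>\<mu>) = iterated_integral \<kappa> f n 0 (\<lambda>_. undefined)"
    if "f \<in> borel_measurable (R_pow n)" for f n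
    using that
  proof (induction n arbitrary: f)
    case 0
    then show ?case by (simp add: restrict_def emeasure_space_1)
  next
    case (Suc n)
    have "(\<lambda>(z, y). f (z(n := y))) \<in> borel_measurable (R_pow n \<Otimes>\<^sub>M borel)"
      unfolding split_beta
      by (rule measurable_compose[OF _ Suc.prems], rule measurable_fun_upd[where J="{0..<n}"]) auto
    then have "(\<lambda>z. \<integral>\<^sup>+y. f (z(n := y)) \<partial>\<kappa> n z) \<in> borel_measurable (R_pow n)"
      by (rule nn_integral_measurable_subprob_algebra2[OF _ measurable_prob_algebraD[OF \<kappa>]])
    from Suc.IH[OF this] show ?case
      using step[OF Suc.prems] iterated_integral_last[of \<kappa> f n 0 "\<lambda>_. undefined"] by (simp only: add_0)
  qed
  have "emeasure \<mu> (prod_emb UNIV (\<lambda>_. borel) {0..<n} A) = iterated_integral \<kappa> (indicator A) n 0 (\<lambda>_. undefined)"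
    if A: "A \<in> sets (R_pow n)" for n A
  proof -
    have emb: "prod_emb UNIV (\<lambda>_. borel) {0..<n} A = (\<lambda>x. restrict x {0..<n}) -` A \<inter> space \<mu>"
      by (auto simp: prod_emb_def space_\<mu>)
    have "prod_emb UNIV (\<lambda>_. borel) {0..<n} A \<in> sets \<mu>"
      unfolding emb by (rule measurable_sets[OF measurable_initial_segment[OF sets_\<mu>] A])
    then have "emeasure \<mu> (prod_emb UNIV (\<lambda>_. borel) {0..<n} A) = (\<integral>\<^sup>+x. indicator (prod_emb UNIV (\<lambda>_. borel) {0..<n} A) x \<partial>\<mu>)"
      by (rule nn_integral_indicator[symmetric])
    also have "\<dots> = (\<integral>\<^sup>+x. indicator A (restrict x {0..<n}) \<partial>\<mu>)"
      by (intro nn_integral_cong) (simp add: emb indicator_def)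
    also have "\<dots> = iterated_integral \<kappa> (indicator A) n 0 (\<lambda>_. undefined)"
      using A by (intro iter) simp
    finally show ?thesis .
  qed
  moreover have "(\<lambda>x. measure (\<kappa> n x) B) \<in> borel_measurable (R_pow n)" if "B \<in> sets borel" for n B
    by (rule measurable_compose[OF measurable_prob_algebraD[OF \<kappa>] measurable_measure_subprob_algebra[OF that]])
  ultimately show "\<mu> \<in> P_kernel E (X 0)"
    unfolding P_kernel_def using \<kappa>_P prob_space_axioms sets_\<mu> by blast
qed

end

section \<open>Representation of dominated laws on the original space\<close>

context regular_iid
begin

lemma sequence_measurable:
  assumes "P \<in> P_star H E" shows "(\<lambda>\<omega> i. X i \<omega>) \<in> P \<rightarrow>\<^sub>M R_seq"
proof (rule measurable_PiM_single')
  show "X i \<in> borel_measurable P" for i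
    using assms X_mem[of i] unfolding P_star_def by (blast intro: borel_measurable_integrable)
qed auto

text \<open>
  Functions of \<open>X\<close> belong to \<open>H\<close>, so this is the change of variables formula.
\<close>

theorem P_star_law_subset_Q_max: "P_star_law H E X \<subseteq> Q_max E X"
proof
  fix \<mu> assume "\<mu> \<in> P_star_law H E X"
  then obtain P where P: "P \<in> P_star H E" and \<mu>: "\<mu> = distr P R_seq (\<lambda>\<omega> i. X i \<omega>)"
    unfolding P_star_law_def by blast
  note meas = sequence_measurable[OF P]
  have "integrable \<mu> \<phi> \<and> integral\<^sup>L \<mu> \<phi> \<le> E (\<lambda>\<omega>. \<phi> (\<lambda>i. X i \<omega>))" if \<phi>: "\<phi> \<in> C_Lip n" for \<phi> n
  proof -
    have "integrable P (\<lambda>\<omega>. \<phi> (\<lambda>i. X i \<omega>)) \<and> (\<integral>\<omega>. \<phi> (\<lambda>i. X i \<omega>) \<partial>P) \<le> E (\<lambda>\<omega>. \<phi> (\<lambda>i. X i \<omega>))"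
      using P seq_mem[OF \<phi>] unfolding P_star_def by blast
    then show ?thesis
      unfolding \<mu> integrable_distr_eq[OF meas C_Lip_measurable[OF \<phi>]]
        integral_distr[OF meas C_Lip_measurable[OF \<phi>]] .
  qed
  moreover have "prob_space \<mu>"
    unfolding \<mu> using P by (intro prob_space.prob_space_distr meas) (simp add: P_star_def)
  ultimately show "\<mu> \<in> Q_max E X" unfolding Q_max_def by (simp add: \<mu>)
qed

text \<open>
  The assignment of \<open>\<integral> \<phi> d\<mu>\<close> to \<open>\<phi> (X)\<close> is the partial functional to be extended. Different \<open>\<phi>\<close>
  may give the same function \<open>\<phi> (X)\<close>; the encoding by graphs takes care of this.
\<close>

lemma dominated_subspace_of_law:
  assumes \<mu>: "\<mu> \<in> Q_max E X"
  shows "dominated_subspace {(\<lambda>\<omega>. \<phi> (\<lambda>i. X i \<omega>), integral\<^sup>L \<mu> \<phi>) | \<phi> n. n \<ge> 1 \<and> \<phi> \<in> C_Lip n}"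
    (is "dominated_subspace ?G")
proof -
  have int: "integrable \<mu> \<phi>" and le: "integral\<^sup>L \<mu> \<phi> \<le> E (\<lambda>\<omega>. \<phi> (\<lambda>i. X i \<omega>))"
    if "n \<ge> 1" "\<phi> \<in> C_Lip n" for \<phi> n
    using \<mu> that unfolding Q_max_def by blast+
  have memI: "p \<in> ?G" if "n \<ge> 1" "\<phi> \<in> C_Lip n" "p = (\<lambda>\<omega>. \<phi> (\<lambda>i. X i \<omega>), integral\<^sup>L \<mu> \<phi>)" for p \<phi> n
    using that by blast
  show ?thesis
    unfolding dominated_subspace_def
  proof (intro conjI allI impI)
    show "(\<lambda>_. 0, 0) \<in> ?G" by (rule memI[OF le_refl C_Lip.const_mem[of 0]]) simp
  next
    fix Y r Z s assume "(Y, r) \<in> ?G" "(Z, s) \<in> ?G"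
    then obtain \<phi> n \<psi> m where
      \<phi>: "n \<ge> 1" "\<phi> \<in> C_Lip n" "Y = (\<lambda>\<omega>. \<phi> (\<lambda>i. X i \<omega>))" "r = integral\<^sup>L \<mu> \<phi>" and
      \<psi>: "m \<ge> 1" "\<psi> \<in> C_Lip m" "Z = (\<lambda>\<omega>. \<psi> (\<lambda>i. X i \<omega>))" "s = integral\<^sup>L \<mu> \<psi>" by blast
    have "(\<lambda>x. \<phi> x + \<psi> x) \<in> C_Lip (max n m)"
      by (rule C_Lip.add_mem[OF C_Lip_mono[OF \<phi>(2)] C_Lip_mono[OF \<psi>(2)]]) simp_all
    then show "(\<lambda>\<omega>. Y \<omega> + Z \<omega>, r + s) \<in> ?G"
      by (rule memI[rotated]) (use \<phi> \<psi> int in auto)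
  next
    fix Y r c assume "(Y, r) \<in> ?G"
    then obtain \<phi> n where
      \<phi>: "n \<ge> 1" "\<phi> \<in> C_Lip n" "Y = (\<lambda>\<omega>. \<phi> (\<lambda>i. X i \<omega>))" "r = integral\<^sup>L \<mu> \<phi>" by blast
    show "(\<lambda>\<omega>. c * Y \<omega>, c * r) \<in> ?G"
      by (rule memI[OF \<phi>(1) C_Lip.scale_mem[OF \<phi>(2), of c]]) (simp add: \<phi>)
  next
    fix Y r assume "(Y, r) \<in> ?G"
    then obtain \<phi> n where
      \<phi>: "n \<ge> 1" "\<phi> \<in> C_Lip n" "Y = (\<lambda>\<omega>. \<phi> (\<lambda>i. X i \<omega>))" "r = integral\<^sup>L \<mu> \<phi>" by blast
    show "Y \<in> H" unfolding \<phi>(3) by (rule seq_mem[OF \<phi>(2)])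
    show "r \<le> E Y" unfolding \<phi>(3,4) by (rule le[OF \<phi>(1,2)])
  qed
qed

text \<open>
  A linear functional below \<^term>\<open>E\<close> is positive, and regularity of \<^term>\<open>E\<close> makes it continuous along
  sequences that decrease to 0. So the Hahn-Banach extension is an integral, and its measure
  induces \<open>\<mu>\<close> because Lipschitz functions determine a law on the sequence space.
\<close>

theorem Q_max_subset_P_star_law: "Q_max E X \<subseteq> P_star_law H E X"
proof
  fix \<mu> assume \<mu>: "\<mu> \<in> Q_max E X"
  obtain I where I_add: "\<And>Y Z. Y \<in> H \<Longrightarrow> Z \<in> H \<Longrightarrow> I (\<lambda>\<omega>. Y \<omega> + Z \<omega>) = I Y + I Z"
    and I_scale: "\<And>Y c. Y \<in> H \<Longrightarrow> I (\<lambda>\<omega>. c * Y \<omega>) = c * I Y"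
    and I_le: "\<And>Y. Y \<in> H \<Longrightarrow> I Y \<le> E Y"
    and I_ext: "\<And>Y r. (Y, r) \<in> {(\<lambda>\<omega>. \<phi> (\<lambda>i. X i \<omega>), integral\<^sup>L \<mu> \<phi>) | \<phi> n. n \<ge> 1 \<and> \<phi> \<in> C_Lip n} \<Longrightarrow> I Y = r"
    by (rule hahn_banach[OF dominated_subspace_of_law[OF \<mu>]]) blast
  have \<mu>_prob: "prob_space \<mu>" and \<mu>_sets: "sets \<mu> = sets R_seq" using \<mu> unfolding Q_max_def by blast+
  have I_law: "I (\<lambda>\<omega>. \<phi> (\<lambda>i. X i \<omega>)) = integral\<^sup>L \<mu> \<phi>" if "n \<ge> 1" "\<phi> \<in> C_Lip n" for \<phi> n
    by (rule I_ext) (use that in blast)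
  have I_nonneg: "0 \<le> I Y" if Y: "Y \<in> H" "\<And>\<omega>. 0 \<le> Y \<omega>" for Y
  proof -
    have "- I Y = I (\<lambda>\<omega>. -1 * Y \<omega>)" using I_scale[OF Y(1), of "-1"] by simp
    also have "\<dots> \<le> E (\<lambda>\<omega>. -1 * Y \<omega>)" by (rule I_le[OF scale_mem[OF Y(1)]])
    also have "\<dots> \<le> E (\<lambda>_. 0)" by (rule mono[OF zero_mem scale_mem[OF Y(1)]]) (use Y(2) in simp)
    finally show ?thesis by (simp add: const)
  qed
  interpret daniell_functional H I
  proof
    show "I (\<lambda>_. 1) = 1"
      using I_law[OF le_refl C_Lip.const_mem[of 1 1]] prob_space.prob_space[OF \<mu>_prob] by simp
    fix Z :: "nat \<Rightarrow> 'a \<Rightarrow> real"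
    assume Z: "\<And>i. Z i \<in> H" "\<And>\<omega>. decseq (\<lambda>i. Z i \<omega>)" "\<And>\<omega>. (\<lambda>i. Z i \<omega>) \<longlonglongrightarrow> 0"
    have "0 \<le> Z i \<omega>" for i \<omega> using decseq_ge[OF Z(2,3)] .
    then show "(\<lambda>i. I (Z i)) \<longlonglongrightarrow> 0"
      using I_nonneg[OF Z(1)] I_le[OF Z(1)]
      by (intro tendsto_sandwich[OF _ _ tendsto_const E_vanish[OF Z]]) auto
  qed (rule I_add I_scale I_nonneg; assumption)+
  obtain P where P: "prob_space P" "sets P = sets (sigma_H H)"
    and P_int: "\<And>Y. Y \<in> H \<Longrightarrow> integrable P Y \<and> integral\<^sup>L P Y = I Y"
    using daniell_stone by blast
  have P_star: "P \<in> P_star H E" unfolding P_star_def using P P_int I_le by simp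
  note meas = sequence_measurable[OF P_star]
  have "\<mu> = distr P R_seq (\<lambda>\<omega> i. X i \<omega>)"
  proof (rule measure_eqI_C_Lip[OF \<mu>_prob \<mu>_sets])
    show "prob_space (distr P R_seq (\<lambda>\<omega> i. X i \<omega>))" by (rule prob_space.prob_space_distr[OF P(1) meas])
    show "sets (distr P R_seq (\<lambda>\<omega> i. X i \<omega>)) = sets R_seq" by simp
    fix n \<phi> assume \<phi>: "\<phi> \<in> C_Lip n"
    have "\<phi> \<in> C_Lip (Suc n)" by (rule C_Lip_mono[OF \<phi>]) simp
    then have "integral\<^sup>L \<mu> \<phi> = I (\<lambda>\<omega>. \<phi> (\<lambda>i. X i \<omega>))" by (intro I_law[symmetric]) simp_all
    also have "\<dots> = (\<integral>\<omega>. \<phi> (\<lambda>i. X i \<omega>) \<partial>P)" using P_int[OF seq_mem[OF \<phi>]] by simp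
    also have "\<dots> = integral\<^sup>L (distr P R_seq (\<lambda>\<omega> i. X i \<omega>)) \<phi>"
      by (rule integral_distr[OF meas C_Lip_measurable[OF \<phi>], symmetric])
    finally show "integral\<^sup>L \<mu> \<phi> = integral\<^sup>L (distr P R_seq (\<lambda>\<omega> i. X i \<omega>)) \<phi>" .
  qed
  then show "\<mu> \<in> P_star_law H E X" using P_star unfolding P_star_law_def by blast
qed

end

section \<open>Equality of the three sets of laws\<close>

theorem proposition4p9:
  fixes H :: "('a \<Rightarrow> real) set"
    and E :: "('a \<Rightarrow> real) \<Rightarrow> real"
    and X :: "nat \<Rightarrow> 'a \<Rightarrow> real"
  assumes "sublinear_expectation_space H E"
    and "regular_expectation H E"
    and "iid_sequence H E X"
    and "((\<lambda>l. E (\<lambda>\<omega>. max 0 (\<bar>X 0 \<omega>\<bar> - l))) \<longlongrightarrow> 0) at_top"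
  shows "P_star_law H E X = P_kernel E (X 0) \<and> P_kernel E (X 0) = Q_max E X"
proof -
  interpret regular_iid H E X
    by (intro regular_iid.intro regular_sublinear_expectation.intro
        regular_sublinear_expectation_axioms.intro regular_iid_axioms.intro assms(1-3))
  show ?thesis
    using P_star_law_subset_Q_max Q_max_subset_P_star_law P_kernel_subset_Q_max Q_max_subset_P_kernel
    by blast
qed

end
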